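(* Let $(\bar M,g)$ be a compact connected smooth Riemannian manifold of dimension $3$ with nonempty smooth boundary $\partial M$. Then there exists a function $u\in C^\infty(\bar M)$ such that the conformal metric $g_u=e^{2u}g$, which is a smooth metric on all of $\bar M$ (up to and including the boundary), has negative sectional curvature: for every $x\in\bar M$ and every $2$-plane $\Sigma\subset T_x\bar M$, the sectional curvature $K_{g_u}(\Sigma)$ is strictly negative.
   Context: $\bar M=M\cup\partial M$ denotes the compact manifold including its boundary, and $g$ is smooth up to the boundary. $C^\infty(\bar M)$ denotes real-valued functions smooth up to the boundary. $K_{g}$ is the sectional curvature of the Levi-Civita connection of a metric $g$. *)

theory Defs
  imports "HOL-Analysis.Analysis"
begin

section \<open>Calculus on the closed half-space\<close>

definition half_space :: "(real^3) set" where
  "half_space = {x. 0 \<le> x $ 3}"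

primrec Ck_on :: "nat \<Rightarrow> 'a::real_normed_vector set \<Rightarrow> ('a \<Rightarrow> 'b::real_normed_vector) \<Rightarrow> bool" where
  "Ck_on 0 W f \<longleftrightarrow> continuous_on W f"
| "Ck_on (Suc k) W f \<longleftrightarrow>
     (\<forall>x\<in>W. f differentiable (at x)) \<and> (\<forall>v. Ck_on k W (\<lambda>x. frechet_derivative f (at x) v))"

text \<open>\<open>Ck_on\<close> is meant for open sets. On an arbitrary set, such as a relatively open subset of the
  half-space, smooth means locally the restriction of a smooth function on an open set of the whole
  space; on subsets of the half-space this is smoothness up to the boundary.\<close>

definition smooth_on :: "'a::real_normed_vector set \<Rightarrow> ('a \<Rightarrow> 'b::real_normed_vector) \<Rightarrow> bool" where
  "smooth_on S f \<longleftrightarrow>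
     (\<forall>x\<in>S. \<exists>W h. open W \<and> x \<in> W \<and> (\<forall>k. Ck_on k W h) \<and> (\<forall>y\<in>S \<inter> W. h y = f y))"

text \<open>The derivative of a map defined on a relatively open subset of the half-space around \<open>x\<close>. It is
  unique, also at boundary points, and depends only on the values of \<open>f\<close> in the half-space near \<open>x\<close>.\<close>

definition Dh :: "(real^3 \<Rightarrow> 'b::real_normed_vector) \<Rightarrow> real^3 \<Rightarrow> real^3 \<Rightarrow> 'b" where
  "Dh f x = frechet_derivative f (at x within half_space)"


section \<open>Three-dimensional smooth manifolds with boundary\<close>

text \<open>A chart is a domain together with a coordinate map, whose values off the domain are irrelevant.\<close>

type_synonym 'a chart = "'a set \<times> ('a \<Rightarrow> real^3)"

definition chart_inv :: "'a chart \<Rightarrow> real^3 \<Rightarrow> 'a" where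
  "chart_inv c = inv_into (fst c) (snd c)"

definition transition :: "'a chart \<Rightarrow> 'a chart \<Rightarrow> real^3 \<Rightarrow> real^3" where
  "transition c c' = snd c' \<circ> chart_inv c"

definition is_chart :: "'a topology \<Rightarrow> 'a chart \<Rightarrow> bool" where
  "is_chart X c \<longleftrightarrow>
     openin X (fst c) \<and> openin (top_of_set half_space) (snd c ` fst c) \<and>
     homeomorphic_map (subtopology X (fst c)) (top_of_set (snd c ` fst c)) (snd c)"

text \<open>The smooth structure is given by an atlas, which need not be maximal. Interior points have charts
  whose image avoids the boundary of the half-space.\<close>

definition smooth_manifold_with_boundary :: "'a topology \<Rightarrow> 'a chart set \<Rightarrow> bool" where
  "smooth_manifold_with_boundary X A \<longleftrightarrow>
     Hausdorff_space X \<and> second_countable X \<and>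
     (\<forall>c\<in>A. is_chart X c) \<and> (\<Union>c\<in>A. fst c) = topspace X \<and>
     (\<forall>c\<in>A. \<forall>c'\<in>A. smooth_on (snd c ` (fst c \<inter> fst c')) (transition c c'))"

definition manifold_boundary :: "'a chart set \<Rightarrow> 'a set" where
  "manifold_boundary A = {p. \<exists>c\<in>A. p \<in> fst c \<and> snd c p $ 3 = 0}"

definition smooth_function :: "'a chart set \<Rightarrow> ('a \<Rightarrow> real) \<Rightarrow> bool" where
  "smooth_function A u \<longleftrightarrow> (\<forall>c\<in>A. smooth_on (snd c ` fst c) (u \<circ> chart_inv c))"


section \<open>Tangent spaces and Riemannian metrics\<close>

text \<open>A tangent vector at \<open>p\<close> is the family of its components in all charts of the atlas around \<open>p\<close>,
  subject to the transformation law (and zero at all other charts, so that equality is equality of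
  functions). The vector space operations are pointwise.\<close>

type_synonym 'a tvec = "'a chart \<Rightarrow> real^3"

definition tangent_space :: "'a chart set \<Rightarrow> 'a \<Rightarrow> 'a tvec set" where
  "tangent_space A p =
     {v. (\<forall>c. \<not> (c \<in> A \<and> p \<in> fst c) \<longrightarrow> v c = 0) \<and>
         (\<forall>c\<in>A. \<forall>c'\<in>A. p \<in> fst c \<inter> fst c' \<longrightarrow> v c' = Dh (transition c c') (snd c p) (v c))}"

definition lincomb :: "real \<Rightarrow> 'a tvec \<Rightarrow> real \<Rightarrow> 'a tvec \<Rightarrow> 'a tvec" where
  "lincomb r v s w = (\<lambda>c. r *\<^sub>R v c + s *\<^sub>R w c)"

text \<open>The tangent vector at \<open>p\<close> whose component in the chart \<open>c\<close> is \<open>a\<close>, that is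
  \<open>\<Sum>i. a $ i * \<partial>/\<partial>x\<^sub>i\<close>.\<close>

definition tvec_of :: "'a chart set \<Rightarrow> 'a chart \<Rightarrow> 'a \<Rightarrow> real^3 \<Rightarrow> 'a tvec" where
  "tvec_of A c p a = (THE v. v \<in> tangent_space A p \<and> v c = a)"

type_synonym 'a metric_field = "'a \<Rightarrow> 'a tvec \<Rightarrow> 'a tvec \<Rightarrow> real"

definition metric_in_chart ::
    "'a chart set \<Rightarrow> 'a metric_field \<Rightarrow> 'a chart \<Rightarrow> real^3 \<Rightarrow> real^3 \<Rightarrow> real^3 \<Rightarrow> real" where
  "metric_in_chart A g c x a b =
     (let p = chart_inv c x in g p (tvec_of A c p a) (tvec_of A c p b))"

definition inner_product_on_tangent_space :: "'a chart set \<Rightarrow> 'a \<Rightarrow> ('a tvec \<Rightarrow> 'a tvec \<Rightarrow> real) \<Rightarrow> bool" where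
  "inner_product_on_tangent_space A p B \<longleftrightarrow>
     (\<forall>v\<in>tangent_space A p. \<forall>w\<in>tangent_space A p. B v w = B w v) \<and>
     (\<forall>v\<in>tangent_space A p. \<forall>w\<in>tangent_space A p. \<forall>z\<in>tangent_space A p. \<forall>r s.
        B (lincomb r v s w) z = r * B v z + s * B w z) \<and>
     (\<forall>v\<in>tangent_space A p. v \<noteq> (\<lambda>_. 0) \<longrightarrow> 0 < B v v)"

definition riemannian_metric :: "'a topology \<Rightarrow> 'a chart set \<Rightarrow> 'a metric_field \<Rightarrow> bool" where
  "riemannian_metric X A g \<longleftrightarrow>
     (\<forall>p\<in>topspace X. inner_product_on_tangent_space A p (g p)) \<and>
     (\<forall>c\<in>A. \<forall>a b. smooth_on (snd c ` fst c) (\<lambda>x. metric_in_chart A g c x a b))"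

definition conformal_metric :: "('a \<Rightarrow> real) \<Rightarrow> 'a metric_field \<Rightarrow> 'a metric_field" where
  "conformal_metric u g = (\<lambda>p v w. exp (2 * u p) * g p v w)"


section \<open>Levi-Civita connection and curvature in a chart\<close>

text \<open>Here \<open>G x\<close> is the metric at the point with coordinates \<open>x\<close>. In coordinates a connection reads
  \<open>\<nabla>\<^sub>X Y = D Y X + \<Gamma> X Y\<close> with \<open>\<Gamma>\<close> bilinear at each point. It is torsion-free iff \<open>\<Gamma>\<close> is symmetric, and
  metric iff \<open>D\<^sub>v (G a b) = G (\<Gamma> v a) b + G a (\<Gamma> v b)\<close> for constant \<open>a\<close>, \<open>b\<close>.\<close>

definition levi_civita_at ::
    "(real^3 \<Rightarrow> real^3 \<Rightarrow> real^3 \<Rightarrow> real) \<Rightarrow> real^3 \<Rightarrow> (real^3 \<Rightarrow> real^3 \<Rightarrow> real^3) \<Rightarrow> bool" where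
  "levi_civita_at G x \<Gamma> \<longleftrightarrow>
     bilinear \<Gamma> \<and> (\<forall>v w. \<Gamma> v w = \<Gamma> w v) \<and>
     (\<forall>v a b. Dh (\<lambda>y. G y a b) x v = G x (\<Gamma> v a) b + G x a (\<Gamma> v b))"

definition christoffel ::
    "(real^3 \<Rightarrow> real^3 \<Rightarrow> real^3 \<Rightarrow> real) \<Rightarrow> real^3 \<Rightarrow> real^3 \<Rightarrow> real^3 \<Rightarrow> real^3" where
  "christoffel G x = (THE \<Gamma>. levi_civita_at G x \<Gamma>)"

definition covariant_deriv ::
    "(real^3 \<Rightarrow> real^3 \<Rightarrow> real^3 \<Rightarrow> real) \<Rightarrow> (real^3 \<Rightarrow> real^3) \<Rightarrow> (real^3 \<Rightarrow> real^3) \<Rightarrow> real^3 \<Rightarrow> real^3" where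
  "covariant_deriv G X Y x = Dh Y x (X x) + christoffel G x (X x) (Y x)"

definition lie_bracket :: "(real^3 \<Rightarrow> real^3) \<Rightarrow> (real^3 \<Rightarrow> real^3) \<Rightarrow> real^3 \<Rightarrow> real^3" where
  "lie_bracket X Y x = Dh Y x (X x) - Dh X x (Y x)"

definition riemann_curvature ::
    "(real^3 \<Rightarrow> real^3 \<Rightarrow> real^3 \<Rightarrow> real) \<Rightarrow>
     (real^3 \<Rightarrow> real^3) \<Rightarrow> (real^3 \<Rightarrow> real^3) \<Rightarrow> (real^3 \<Rightarrow> real^3) \<Rightarrow> real^3 \<Rightarrow> real^3" where
  "riemann_curvature G X Y Z x =
     covariant_deriv G X (covariant_deriv G Y Z) x -
     covariant_deriv G Y (covariant_deriv G X Z) x -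
     covariant_deriv G (lie_bracket X Y) Z x"

text \<open>Since curvature is tensorial, the vectors \<open>v\<close>, \<open>w\<close> at \<open>x\<close> may be extended by constant fields.\<close>

definition sectional_in_chart ::
    "(real^3 \<Rightarrow> real^3 \<Rightarrow> real^3 \<Rightarrow> real) \<Rightarrow> real^3 \<Rightarrow> real^3 \<Rightarrow> real^3 \<Rightarrow> real" where
  "sectional_in_chart G x v w =
     G x (riemann_curvature G (\<lambda>_. v) (\<lambda>_. w) (\<lambda>_. w) x) v /
     (G x v v * G x w w - (G x v w)\<^sup>2)"


section \<open>Sectional curvature of tangent planes\<close>

definition plane_basis :: "'a chart set \<Rightarrow> 'a \<Rightarrow> 'a tvec set \<Rightarrow> 'a tvec \<times> 'a tvec \<Rightarrow> bool" where
  "plane_basis A p \<Sigma> = (\<lambda>(v, w).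
     v \<in> tangent_space A p \<and> w \<in> tangent_space A p \<and>
     (\<forall>r s. lincomb r v s w = (\<lambda>_. 0) \<longrightarrow> r = 0 \<and> s = 0) \<and>
     \<Sigma> = {lincomb r v s w | r s. True})"

definition tangent_plane :: "'a chart set \<Rightarrow> 'a \<Rightarrow> 'a tvec set \<Rightarrow> bool" where
  "tangent_plane A p \<Sigma> \<longleftrightarrow> (\<exists>b. plane_basis A p \<Sigma> b)"

text \<open>The value does not depend on the chart around \<open>p\<close> or on the basis of the plane, so both are
  chosen arbitrarily.\<close>

definition sectional_curvature :: "'a chart set \<Rightarrow> 'a metric_field \<Rightarrow> 'a \<Rightarrow> 'a tvec set \<Rightarrow> real" where
  "sectional_curvature A g p \<Sigma> =
     (let c = (SOME c. c \<in> A \<and> p \<in> fst c);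
          (v, w) = (SOME b. plane_basis A p \<Sigma> b)
      in sectional_in_chart (metric_in_chart A g c) (snd c p) (v c) (w c))"


section \<open>Well-definedness of \<open>Dh\<close>, \<open>christoffel\<close> and \<open>tvec_of\<close>\<close>

lemma half_space_derivative_unique:
  fixes f :: "real^3 \<Rightarrow> 'b::real_normed_vector"
  assumes x: "x \<in> half_space"
    and f': "(f has_derivative f') (at x within half_space)"
  shows "Dh f x = f'"
proof -
  have f'': "(f has_derivative Dh f x) (at x within half_space)"
    using f' unfolding Dh_def frechet_derivative_works[symmetric] by (rule differentiableI)
  show ?thesis
  proof (rule frechet_derivative_unique_within[OF f'' f'])
    fix i :: "real^3" and e :: real
    assume i: "i \<in> Basis" and e: "0 < e"
    have "0 \<le> i $ 3" using i by (auto simp: Basis_vec_def axis_def)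
    then have "x + (e/2) *\<^sub>R i \<in> half_space" using x e by (simp add: half_space_def)
    then show "\<exists>d. 0 < \<bar>d\<bar> \<and> \<bar>d\<bar> < e \<and> x + d *\<^sub>R i \<in> half_space"
      using e by (intro exI[of _ "e/2"]) auto
  qed
qed

lemma Dh_has_derivative:
  "f differentiable (at x within half_space) \<Longrightarrow> (f has_derivative Dh f x) (at x within half_space)"
  by (simp add: Dh_def frechet_derivative_works)

lemma riesz_inner:
  fixes B :: "real^3 \<Rightarrow> real^3 \<Rightarrow> real"
  assumes "bilinear B" "\<And>v. v \<noteq> 0 \<Longrightarrow> 0 < B v v" "linear l"
  shows "\<exists>z. \<forall>e. B z e = l e"
proof -
  define T :: "real^3 \<Rightarrow> real^3" where "T z = (\<Sum>i\<in>Basis. B z i *\<^sub>R i)" for z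
  have linB: "linear (\<lambda>z. B z i)" "linear (B z)" for i z
    using assms(1) by (auto simp: bilinear_def)
  have expand: "h e = (\<Sum>i\<in>Basis. (e \<bullet> i) * h i)" if "linear h" for h :: "real^3 \<Rightarrow> real" and e
  proof -
    have "h e = h (\<Sum>i\<in>Basis. (e \<bullet> i) *\<^sub>R i)" by (simp only: euclidean_representation)
    then show ?thesis by (simp add: linear_sum[OF that] linear_cmul[OF that])
  qed
  have T: "linear T"
    unfolding T_def
    by (intro linear_compose_sum ballI linearI)
       (simp_all add: linear_add[OF linB(1)] linear_cmul[OF linB(1)] algebra_simps)
  have TB: "T z \<bullet> e = B z e" for z e
    unfolding T_def expand[OF linB(2)[of z], of e]
    by (simp add: inner_sum_right inner_commute[of _ e] mult.commute)
  have "inj T"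
    using TB assms(2) by (subst linear_injective_0[OF T]) (metis inner_zero_left less_irrefl)
  then obtain z where z: "T z = (\<Sum>i\<in>Basis. l i *\<^sub>R i)"
    using linear_injective_imp_surjective[OF T] by (metis surjD)
  have "B z e = l e" for e
    using expand[OF assms(3), of e]
    by (simp add: TB[symmetric] z inner_sum_right inner_commute[of _ e] mult.commute)
  then show ?thesis by blast
qed

lemma levi_civita_ex1:
  fixes G :: "real^3 \<Rightarrow> real^3 \<Rightarrow> real^3 \<Rightarrow> real"
  assumes S: "openin (top_of_set half_space) S" "x \<in> S"
    and G: "\<And>y. y \<in> S \<Longrightarrow> bilinear (G y)" "\<And>y a b. y \<in> S \<Longrightarrow> G y a b = G y b a"
      "\<And>v. v \<noteq> 0 \<Longrightarrow> 0 < G x v v"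
    and diff: "\<And>a b. (\<lambda>y. G y a b) differentiable (at x within half_space)"
  shows "\<exists>!\<Gamma>. levi_civita_at G x \<Gamma>"
proof -
  have xh: "x \<in> half_space" using S openin_subset by fastforce
  define P where "P v a b = Dh (\<lambda>y. G y a b) x v" for v a b
  have hd: "((\<lambda>y. G y a b) has_derivative (\<lambda>v. P v a b)) (at x within half_space)" for a b
    using Dh_has_derivative[OF diff, of a b] by (simp add: P_def)
  have cong: "Dh f x = f'" if "(h has_derivative f') (at x within half_space)"
      "\<And>y. y \<in> S \<Longrightarrow> h y = f y" for f h :: "real^3 \<Rightarrow> real" and f'
  proof (rule half_space_derivative_unique[OF xh])
    obtain W where W: "open W" "S = half_space \<inter> W" using S by (auto simp: openin_open)
    have "eventually (\<lambda>y. h y = f y) (at x within half_space)"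
      using W S(2) that(2) unfolding eventually_at_topological by blast
    then show "(f has_derivative f') (at x within half_space)"
      using that S(2) by (metis has_derivative_transform_eventually xh)
  qed
  have Plin: "linear (\<lambda>v. P v a b)" for a b
    using has_derivative_linear[OF hd] .
  have Psym: "P v a b = P v b a" for v a b
    using cong[OF hd[of a b], of "\<lambda>y. G y b a"] G(2) by (simp add: P_def)
  have Padd: "P v (a + a') b = P v a b + P v a' b" for v a a' b
    using cong[OF has_derivative_add[OF hd[of a b] hd[of a' b]], of "\<lambda>y. G y (a + a') b"] G(1)
    by (simp add: bilinear_ladd P_def)
  have Pscale: "P v (r *\<^sub>R a) b = r * P v a b" for v r a b
    using cong[OF has_derivative_mult_right[OF hd[of a b], of r], of "\<lambda>y. G y (r *\<^sub>R a) b"] G(1)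
    by (simp add: bilinear_lmul P_def)
  have bil: "bilinear (G x)" and sym: "\<And>a b. G x a b = G x b a" using G S(2) by auto
  have eqI: "z = z'" if "\<And>e. G x z e = G x z' e" for z z'
    using that[of "z - z'"] G(3)[of "z - z'"] bilinear_lsub[OF bil, of z z' "z - z'"] by force
  define K where "K v w e = (P v w e + P w v e - P e v w) / 2" for v w e
  have Padd': "P v b (a + a') = P v b a + P v b a'" for v a a' b
    using Padd[of v a a' b] Psym by metis
  have Pscale': "P v b (r *\<^sub>R a) = r * P v b a" for v r a b
    using Pscale[of v r a b] Psym by metis
  note lins = Padd Pscale Padd' Pscale' linear_add[OF Plin] linear_cmul[OF Plin]
  have "linear (K v w)" for v w
    by (rule linearI) (simp_all add: K_def lins field_simps)
  then have "\<exists>z. \<forall>e. G x z e = K v w e" for v w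
    using riesz_inner[OF bil G(3)] by blast
  then obtain \<Gamma> where \<Gamma>: "\<And>v w e. G x (\<Gamma> v w) e = K v w e" by metis
  have gsym: "\<Gamma> v w = \<Gamma> w v" for v w
    by (rule eqI) (simp add: \<Gamma> K_def Psym[of _ v w])
  have "linear (\<Gamma> v)" for v
    by (rule linearI; rule eqI)
       (simp_all add: \<Gamma> bilinear_ladd[OF bil] bilinear_lmul[OF bil] K_def lins field_simps)
  moreover have "(\<lambda>v. \<Gamma> v w) = \<Gamma> w" for w using gsym by auto
  ultimately have "bilinear \<Gamma>" by (simp add: bilinear_def)
  moreover have "P v a b = G x (\<Gamma> v a) b + G x a (\<Gamma> v b)" for v a b
    using sym[of a "\<Gamma> v b"] Psym[of a v b] Psym[of b v a] Psym[of v a b]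
    by (simp add: \<Gamma> K_def field_simps)
  ultimately have ex: "levi_civita_at G x \<Gamma>"
    using gsym by (simp add: levi_civita_at_def P_def)
  have "\<Gamma>' = \<Gamma>" if "levi_civita_at G x \<Gamma>'" for \<Gamma>'
  proof (intro ext eqI)
    fix v w e
    have m: "P v a b = G x (\<Gamma>' v a) b + G x (\<Gamma>' v b) a" for v a b
      using that sym[of a "\<Gamma>' v b"] by (simp add: levi_civita_at_def P_def)
    have s: "\<Gamma>' v w = \<Gamma>' w v" for v w using that unfolding levi_civita_at_def by blast
    show "G x (\<Gamma>' v w) e = G x (\<Gamma> v w) e"
      unfolding \<Gamma> K_def m using s[of v w] s[of v e] s[of w e] by simp
  qed
  with ex show ?thesis by blast
qed


lemma chart_inv: "is_chart X c \<Longrightarrow> p \<in> fst c \<Longrightarrow> chart_inv c (snd c p) = p"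
proof -
  assume c: "is_chart X c" and p: "p \<in> fst c"
  have "topspace (subtopology X (fst c)) = fst c"
    using c topspace_subtopology_subset openin_subset by (fastforce simp: is_chart_def)
  then have "inj_on (snd c) (fst c)"
    using c homeomorphic_imp_injective_map by (fastforce simp: is_chart_def)
  then show ?thesis using p by (simp add: chart_inv_def)
qed

lemma chart_image_open:
  assumes c: "is_chart X c" and V: "openin X V"
  shows "openin (top_of_set half_space) (snd c ` (fst c \<inter> V))"
proof -
  have "openin (subtopology X (fst c)) (fst c \<inter> V)"
    using V by (auto simp: openin_subtopology)
  then have "openin (top_of_set (snd c ` fst c)) (snd c ` (fst c \<inter> V))"
    using c homeomorphic_imp_open_map unfolding is_chart_def open_map_def by blast
  then show ?thesis using c unfolding is_chart_def by (meson openin_trans)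
qed

lemma at_within_relopen:
  assumes "openin (top_of_set half_space) S" "x \<in> S"
  shows "at x within S = at x within half_space"
proof -
  obtain W where W: "open W" "S = half_space \<inter> W" using assms by (auto simp: openin_open)
  show ?thesis by (rule at_within_nhd[OF _ W(1)]) (use W assms in auto)
qed

lemma transition_derivative:
  assumes M: "smooth_manifold_with_boundary X A" and c: "c \<in> A" "c' \<in> A" and p: "p \<in> fst c" "p \<in> fst c'"
  shows "(transition c c' has_derivative Dh (transition c c') (snd c p)) (at (snd c p) within half_space)"
proof -
  let ?S = "snd c ` (fst c \<inter> fst c')"
  have ch: "is_chart X c" "is_chart X c'" using M c by (auto simp: smooth_manifold_with_boundary_def)
  then have S: "openin (top_of_set half_space) ?S" by (intro chart_image_open) (auto simp: is_chart_def)
  have x: "snd c p \<in> ?S" using p by blast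
  have "smooth_on ?S (transition c c')" using M c by (auto simp: smooth_manifold_with_boundary_def)
  then obtain W h where W: "open W" "snd c p \<in> W" "\<And>k. Ck_on k W h" "\<forall>y\<in>?S \<inter> W. h y = transition c c' y"
    using x unfolding smooth_on_def by meson
  have "h differentiable (at (snd c p))" using W(2) W(3)[of "Suc 0"] by simp
  then obtain D where "(h has_derivative D) (at (snd c p))" by (auto simp: differentiable_def)
  then have "(h has_derivative D) (at (snd c p) within ?S)" by (rule has_derivative_at_withinI)
  moreover have "eventually (\<lambda>y. h y = transition c c' y) (at (snd c p) within ?S)"
    unfolding eventually_at_topological using W by blast
  ultimately have "(transition c c' has_derivative D) (at (snd c p) within ?S)"
    by (rule has_derivative_transform_eventually) (use W(2,4) x in blast)+
  then have d: "(transition c c' has_derivative D) (at (snd c p) within half_space)"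
    unfolding at_within_relopen[OF S x] .
  have "snd c p \<in> half_space" using S x openin_imp_subset by blast
  from half_space_derivative_unique[OF this d] d show ?thesis by simp
qed

lemma transition_chain:
  assumes M: "smooth_manifold_with_boundary X A" and c: "c \<in> A" "c' \<in> A" "c'' \<in> A"
    and p: "p \<in> fst c" "p \<in> fst c'" "p \<in> fst c''"
  shows "Dh (transition c c'') (snd c p) = Dh (transition c' c'') (snd c' p) \<circ> Dh (transition c c') (snd c p)"
proof -
  let ?S = "snd c ` (fst c \<inter> (fst c' \<inter> fst c''))"
  have ch: "is_chart X c" "is_chart X c'" "is_chart X c''" using M c by (auto simp: smooth_manifold_with_boundary_def)
  have S: "openin (top_of_set half_space) ?S" using ch by (intro chart_image_open) (auto simp: is_chart_def)
  have x: "snd c p \<in> ?S" using p by blast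
  have xh: "snd c p \<in> half_space" using S x openin_imp_subset by blast
  have t: "transition c c' (snd c q) = snd c' q" if "q \<in> fst c" "q \<in> fst c'" for q
    using chart_inv[OF ch(1)] that by (simp add: transition_def)
  have sub: "transition c c' ` ?S \<subseteq> half_space"
    using t ch(2) openin_imp_subset by (force simp: is_chart_def)
  have 1: "(transition c c' has_derivative Dh (transition c c') (snd c p)) (at (snd c p) within ?S)"
    using transition_derivative[OF M c(1,2) p(1,2)] at_within_relopen[OF S x] by simp
  have 2: "(transition c' c'' has_derivative Dh (transition c' c'') (snd c' p)) (at (transition c c' (snd c p)) within transition c c' ` ?S)"
    using has_derivative_subset[OF transition_derivative[OF M c(2,3) p(2,3)] sub] t p by simp
  have "(transition c' c'' \<circ> transition c c' has_derivative Dh (transition c' c'') (snd c' p) \<circ> Dh (transition c c') (snd c p)) (at (snd c p) within ?S)"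
    by (rule diff_chain_within[OF 1 2])
  moreover have "(transition c' c'' \<circ> transition c c') y = transition c c'' y" if "y \<in> ?S" for y
    using that t chart_inv[OF ch(2)] chart_inv[OF ch(1)] by (auto simp: transition_def)
  ultimately have "(transition c c'' has_derivative Dh (transition c' c'') (snd c' p) \<circ> Dh (transition c c') (snd c p)) (at (snd c p) within ?S)"
    using x has_derivative_transform by (metis (no_types, lifting))
  then show ?thesis
    unfolding at_within_relopen[OF S x] by (rule half_space_derivative_unique[OF xh])
qed

lemma transition_refl:
  assumes M: "smooth_manifold_with_boundary X A" and c: "c \<in> A" and p: "p \<in> fst c"
  shows "Dh (transition c c) (snd c p) = id"
proof -
  have ch: "is_chart X c" using M c by (auto simp: smooth_manifold_with_boundary_def)
  have S: "openin (top_of_set half_space) (snd c ` fst c)" using ch by (simp add: is_chart_def)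
  have x: "snd c p \<in> snd c ` fst c" using p by blast
  have xh: "snd c p \<in> half_space" using S x openin_imp_subset by blast
  have "(id has_derivative id) (at (snd c p) within snd c ` fst c)" by (simp add: id_def)
  moreover have "transition c c y = id y" if "y \<in> snd c ` fst c" for y
    using that chart_inv[OF ch] by (auto simp: transition_def)
  ultimately have "(transition c c has_derivative id) (at (snd c p) within snd c ` fst c)"
    using x has_derivative_transform by (metis (no_types, lifting))
  then show ?thesis
    unfolding at_within_relopen[OF S x] by (rule half_space_derivative_unique[OF xh])
qed

lemma tangent_space_coordinates:
  assumes M: "smooth_manifold_with_boundary X A" and c: "c \<in> A" and p: "p \<in> fst c"
  shows "\<exists>!v. v \<in> tangent_space A p \<and> v c = a"
proof
  define v where "v c' = (if c' \<in> A \<and> p \<in> fst c' then Dh (transition c c') (snd c p) a else 0)" for c'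
  have "v c = a" using transition_refl[OF M c p] c p by (simp add: v_def)
  moreover have "v c'' = Dh (transition c' c'') (snd c' p) (v c')"
    if "c' \<in> A" "c'' \<in> A" "p \<in> fst c' \<inter> fst c''" for c' c''
    using that transition_chain[OF M c that(1,2) p] by (simp add: v_def)
  moreover have "v c' = 0" if "\<not> (c' \<in> A \<and> p \<in> fst c')" for c'
    using that by (simp only: v_def if_False)
  ultimately show "v \<in> tangent_space A p \<and> v c = a"
    unfolding tangent_space_def by blast
  fix w assume "w \<in> tangent_space A p \<and> w c = a"
  then have "w c' = v c'" for c'
  proof (cases "c' \<in> A \<and> p \<in> fst c'")
    case True
    then have "v c' = Dh (transition c c') (snd c p) a" by (simp add: v_def)
    moreover have "w c' = Dh (transition c c') (snd c p) (w c)"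
      using True c p \<open>w \<in> tangent_space A p \<and> w c = a\<close> unfolding tangent_space_def by blast
    ultimately show ?thesis using \<open>w \<in> tangent_space A p \<and> w c = a\<close> by simp
  next
    case False
    then have "v c' = 0" by (simp only: v_def if_False)
    moreover have "w c' = 0"
      using False \<open>w \<in> tangent_space A p \<and> w c = a\<close> unfolding tangent_space_def by blast
    ultimately show ?thesis by simp
  qed
  then show "w = v" by blast
qed

end

theory Submission
  imports Defs
begin

text \<open>
  For \<open>u = exp (\<lambda> \<phi>)\<close> the curvature of \<open>exp (2 u) g\<close> on a plane spanned by a \<open>g\<close>-orthonormal pair with normal
  \<open>n\<close> is, up to the factor \<open>exp (- 2 u)\<close>, the old curvature minus
  \<open>\<lambda> u (\<Delta>\<phi> - Hess \<phi> (n, n)) + \<lambda>\<^sup>2 u (\<bar>d\<phi>\<bar>\<^sup>2 - d\<phi>(n)\<^sup>2) + \<lambda>\<^sup>2 u\<^sup>2 d\<phi>(n)\<^sup>2\<close>. If \<open>\<phi> \<ge> 0\<close> then \<open>u \<ge> 1\<close>, and the last two terms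
  together are at least \<open>\<lambda>\<^sup>2 u \<bar>d\<phi>\<bar>\<^sup>2\<close>. So if \<open>\<phi>\<close> has no critical points, compactness makes the curvature
  negative for large \<open>\<lambda>\<close>.

  A function without critical points exists because critical points can be pushed out through the
  boundary. By Sard's theorem there is a smooth function with finitely many critical points. Call a
  point avoidable if it is missed by some injective immersion of the manifold into itself. Small
  translations in charts show that boundary points are avoidable and that the avoidable points form
  an open and closed set, so every point is avoidable. Composing a function with an injective immersion
  that misses one of its critical points decreases their number.
\<close>

section \<open>Smooth functions on the half-space\<close>

text \<open>Why \<open>u\<close> is an exponential: for \<open>u = \<lambda> \<phi>\<close> the only
  quadratic term would be \<open>\<lambda>\<^sup>2 d\<phi>(n)\<^sup>2\<close>, which vanishes on
  every plane containing the gradient. The second derivative of the exponential adds a term that is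
  largest on exactly these planes, whereas the Hessian of \<open>\<phi>\<close> enters only to first
  order in \<open>\<lambda>\<close>. At a critical point of \<open>\<phi>\<close> all quadratic
  terms are lost and the sign of the Hessian decides; hence the search for a function without
  critical points, which a closed manifold cannot carry because of maxima.

  The boundary is used through the fact that an injective immersion of the manifold into itself may
  fail to be onto: an inward push near the boundary leaves out boundary points. Critical points of
  \<open>f \<circ> F\<close> correspond under \<open>F\<close> to the critical points of
  \<open>f\<close> in the image of \<open>F\<close>, and injectivity prevents duplicates.

  Curvatures are compared on arbitrary independent pairs: all terms scale with the squared area of
  the parallelogram, so compactness gives uniform constants.\<close>

lemma Ck_on_subset: "Ck_on k W f \<Longrightarrow> W' \<subseteq> W \<Longrightarrow> Ck_on k W' f"
  by (induction k arbitrary: f) (auto intro: continuous_on_subset)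

lemma Ck_on_cong:
  assumes "open W" "\<And>x. x \<in> W \<Longrightarrow> f x = g x" "Ck_on k W f"
  shows "Ck_on k W g"
  using assms(2,3)
proof (induction k arbitrary: f g)
  case 0
  then show ?case using continuous_on_cong by fastforce
next
  case (Suc k)
  have d: "frechet_derivative f (at x) = frechet_derivative g (at x)" if "x \<in> W" for x
    using frechet_derivative_transform_within_open[OF _ assms(1) that] Suc.prems that by auto
  have "g differentiable (at x)" if "x \<in> W" for x
  proof -
    have "(f has_derivative frechet_derivative f (at x)) (at x)"
      using Suc.prems(2) that by (simp add: frechet_derivative_works)
    then have "(g has_derivative frechet_derivative f (at x)) (at x)"
      by (rule has_derivative_transform_within_open[OF _ assms(1) that Suc.prems(1)])
    then show ?thesis by (rule differentiableI)
  qed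
  moreover have "Ck_on k W (\<lambda>x. frechet_derivative g (at x) v)" for v
    using Suc.IH[of "\<lambda>x. frechet_derivative f (at x) v" "\<lambda>x. frechet_derivative g (at x) v"]
      Suc.prems(2) d by auto
  ultimately show ?case by simp
qed

text \<open>Any pointwise derivative \<open>f'\<close> may stand in for
  \<open>frechet_derivative\<close>, by uniqueness of the derivative. The differentiation rules
  below enter in this form.\<close>

lemma Ck_on_SucI:
  assumes "open W" "\<And>x. x \<in> W \<Longrightarrow> (f has_derivative f' x) (at x)"
    "\<And>v. Ck_on k W (\<lambda>x. f' x v)"
  shows "Ck_on (Suc k) W f"
proof -
  have "frechet_derivative f (at x) = f' x" if "x \<in> W" for x
    using frechet_derivative_at[OF assms(2)[OF that]] by simp
  then have "Ck_on k W (\<lambda>x. frechet_derivative f (at x) v)" for v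
    by (intro Ck_on_cong[OF assms(1) _ assms(3)[of v]]) simp
  then show ?thesis using assms(2) by (auto intro: differentiableI)
qed

lemma Ck_on_SucD:
  assumes "Ck_on (Suc k) W f" "x \<in> W"
  shows "(f has_derivative frechet_derivative f (at x)) (at x)"
  using assms by (simp add: frechet_derivative_works)

lemma Ck_on_mono_Suc: "Ck_on (Suc k) W f \<Longrightarrow> Ck_on k W f"
proof (induction k arbitrary: f)
  case 0
  then have "\<And>x. x \<in> W \<Longrightarrow> f differentiable (at x)" by simp
  then show ?case
    by (simp add: continuous_at_imp_continuous_on differentiable_imp_continuous_within)
qed simp

lemma Ck_on_const [simp]: "open W \<Longrightarrow> Ck_on k W (\<lambda>x. c)"
  by (induction k arbitrary: c) auto

lemma Ck_on_bounded_linear: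
  assumes "open W" "bounded_linear f"
  shows "Ck_on k W f"
proof (cases k)
  case 0
  then show ?thesis using assms(2) by (simp add: linear_continuous_on)
next
  case (Suc j)
  show ?thesis unfolding Suc
    by (rule Ck_on_SucI[OF assms(1), of f "\<lambda>_. f"])
       (use assms in \<open>auto intro: bounded_linear_imp_has_derivative\<close>)
qed

lemma Ck_on_add:
  assumes "open W" "Ck_on k W f" "Ck_on k W g"
  shows "Ck_on k W (\<lambda>x. f x + g x)"
  using assms(2,3)
proof (induction k arbitrary: f g)
  case 0
  then show ?case by (auto intro: continuous_intros)
next
  case (Suc k)
  show ?case
  proof (rule Ck_on_SucI[OF assms(1)])
    fix x assume "x \<in> W"
    show "((\<lambda>x. f x + g x) has_derivative
        (\<lambda>v. frechet_derivative f (at x) v + frechet_derivative g (at x) v)) (at x)"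
      by (intro has_derivative_add Ck_on_SucD[OF Suc.prems(1) \<open>x \<in> W\<close>]
          Ck_on_SucD[OF Suc.prems(2) \<open>x \<in> W\<close>])
  qed (use Suc in auto)
qed

lemma Ck_on_sum:
  assumes "open W" "\<And>i. i \<in> I \<Longrightarrow> Ck_on k W (f i)"
  shows "Ck_on k W (\<lambda>x. \<Sum>i\<in>I. f i x)"
  using assms(2)
  by (induction I rule: infinite_finite_induct) (auto intro: Ck_on_add assms(1) simp: assms(1))

text \<open>The Leibniz rule gives a sum of two products of the same kind in which one factor has
  been differentiated, so the induction on \<open>k\<close> has to keep both factors
  arbitrary.\<close>

lemma (in bounded_bilinear) Ck_on_prod:
  assumes "open W" "Ck_on k W f" "Ck_on k W g"
  shows "Ck_on k W (\<lambda>x. prod (f x) (g x))"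
  using assms(2,3)
proof (induction k arbitrary: f g)
  case 0
  then show ?case by (auto intro: continuous_on)
next
  case (Suc k)
  show ?case
  proof (rule Ck_on_SucI[OF assms(1)])
    fix x assume "x \<in> W"
    show "((\<lambda>x. prod (f x) (g x)) has_derivative
        (\<lambda>v. prod (f x) (frechet_derivative g (at x) v) + prod (frechet_derivative f (at x) v) (g x))) (at x)"
      by (intro FDERIV Ck_on_SucD[OF Suc.prems(1) \<open>x \<in> W\<close>]
          Ck_on_SucD[OF Suc.prems(2) \<open>x \<in> W\<close>])
  next
    fix v
    have "Ck_on k W (\<lambda>x. frechet_derivative f (at x) v)" "Ck_on k W (\<lambda>x. frechet_derivative g (at x) v)"
      using Suc.prems by simp_all
    then show "Ck_on k W (\<lambda>x. prod (f x) (frechet_derivative g (at x) v) +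
        prod (frechet_derivative f (at x) v) (g x))"
      using Ck_on_add[OF assms(1) Suc.IH[of f] Suc.IH[of _ g]] Ck_on_mono_Suc[OF Suc.prems(1)]
        Ck_on_mono_Suc[OF Suc.prems(2)] by blast
  qed
qed

lemmas Ck_on_mult = bounded_bilinear.Ck_on_prod[OF bounded_bilinear_mult]
lemmas Ck_on_scaleR = bounded_bilinear.Ck_on_prod[OF bounded_bilinear_scaleR]
lemmas Ck_on_inner = bounded_bilinear.Ck_on_prod[OF bounded_bilinear_inner]

text \<open>By the chain rule the derivative is \<open>Dg (f x) (Df x v)\<close>, whose argument
  varies with \<open>x\<close>. Expanding it in the basis of the Euclidean middle space gives a
  finite sum of components of \<open>Df\<close> times partial derivatives of \<open>g\<close>
  composed with \<open>f\<close>; the induction applies to the latter, since \<open>f\<close> is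
  fixed and \<open>g\<close> is arbitrary.\<close>

lemma Ck_on_compose:
  fixes f :: "'a::real_normed_vector \<Rightarrow> 'b::euclidean_space"
  assumes W: "open W" and V: "open V" "f ` W \<subseteq> V" and fg: "Ck_on k W f" "Ck_on k V g"
  shows "Ck_on k W (\<lambda>x. g (f x))"
  using fg
proof (induction k arbitrary: g)
  case 0
  then show ?case using continuous_on_compose2[of V g W f] V by simp
next
  case (Suc k)
  have expand: "h v = (\<Sum>i\<in>Basis. (v \<bullet> i) *\<^sub>R h i)" if "linear h" for h :: "'b \<Rightarrow> 'c" and v
  proof -
    have "h v = h (\<Sum>i\<in>Basis. (v \<bullet> i) *\<^sub>R i)" by (simp only: euclidean_representation)
    then show ?thesis by (simp add: linear_sum[OF that] linear_cmul[OF that])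
  qed
  show ?case
  proof (rule Ck_on_SucI[OF W])
    fix x assume x: "x \<in> W"
    have g: "(g has_derivative frechet_derivative g (at (f x))) (at (f x))"
      using Suc.prems(2) V(2) x by (intro Ck_on_SucD) auto
    have "((\<lambda>x. g (f x)) has_derivative
        (\<lambda>v. frechet_derivative g (at (f x)) (frechet_derivative f (at x) v))) (at x)"
      using diff_chain_at[OF Ck_on_SucD[OF Suc.prems(1) x] g] by (simp add: o_def)
    then show "((\<lambda>x. g (f x)) has_derivative (\<lambda>v. \<Sum>i\<in>Basis.
        (frechet_derivative f (at x) v \<bullet> i) *\<^sub>R frechet_derivative g (at (f x)) i)) (at x)"
      unfolding expand[OF has_derivative_linear[OF g], symmetric] .
  next
    fix v
    have "Ck_on k W (\<lambda>x. frechet_derivative g (at (f x)) i)" for i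
    proof (rule Suc.IH[OF Ck_on_mono_Suc[OF Suc.prems(1)]])
      show "Ck_on k V (\<lambda>x. frechet_derivative g (at x) i)" using Suc.prems(2) by simp
    qed
    moreover have "Ck_on k W (\<lambda>x. frechet_derivative f (at x) v)" using Suc.prems(1) by simp
    ultimately show "Ck_on k W (\<lambda>x. \<Sum>i\<in>Basis.
        (frechet_derivative f (at x) v \<bullet> i) *\<^sub>R frechet_derivative g (at (f x)) i)"
      by (intro Ck_on_sum Ck_on_scaleR Ck_on_inner W Ck_on_const)
  qed
qed

lemma Ck_on_exp: "open W \<Longrightarrow> Ck_on k W (exp :: real \<Rightarrow> real)"
proof (induction k)
  case (Suc k)
  have d: "(exp has_derivative (\<lambda>v. exp x * v)) (at x)" for x :: real
    using DERIV_exp[of x] by (simp add: has_field_derivative_def)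
  show ?case
    by (rule Ck_on_SucI[OF Suc.prems d]) (rule Ck_on_mult[OF Suc.prems Suc.IH[OF Suc.prems] Ck_on_const[OF Suc.prems]])
qed (simp, rule continuous_on_exp[OF continuous_on_id])

lemma Ck_on_inverse: "Ck_on k (- {0}) (inverse :: real \<Rightarrow> real)"
proof (induction k)
  case 0
  show ?case by (simp, rule continuous_on_inverse[OF continuous_on_id]) simp
next
  case (Suc k)
  have *: "open (- {0::real})" by (simp add: open_Compl)
  have d: "(inverse has_derivative (\<lambda>v. (inverse x * inverse x) * (- v))) (at x)"
    if "x \<in> - {0}" for x :: real
    using has_derivative_inverse'[of x UNIV] that by (simp add: ac_simps)
  show ?case
    by (rule Ck_on_SucI[OF * d], assumption) (rule Ck_on_mult[OF * Ck_on_mult[OF * Suc Suc] Ck_on_const[OF *]])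
qed

text \<open>The derivatives of the flat function \<open>t \<mapsto> exp (-1/t)\<close>, extended by zero, all have this form.\<close>

definition flat :: "real poly \<Rightarrow> real \<Rightarrow> real" where
  "flat P t = (if t > 0 then poly P (1/t) * exp (- 1/t) else 0)"

lemma poly_exp_tendsto_0: "((\<lambda>s::real. poly P s * exp (- s)) \<longlongrightarrow> 0) at_top"
proof -
  have "((\<lambda>s. \<Sum>i\<le>degree P. coeff P i * (s ^ i / exp s)) \<longlongrightarrow> (\<Sum>i\<le>degree P. coeff P i * 0)) at_top"
    by (intro tendsto_intros tendsto_power_div_exp_0)
  then show ?thesis
    by (simp add: poly_altdef sum_distrib_right exp_minus divide_inverse mult.assoc)
qed

text \<open>With \<open>s = 1/t\<close> the derivative of \<open>P(s) exp(-s)\<close> is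
  \<open>s^2 (P - P')(s) exp(-s)\<close>, and \<open>[:0, 0, 1:]\<close> is the polynomial
  \<open>s^2\<close>. The family is therefore closed under differentiation, which makes every member
  smooth.\<close>

lemma flat_has_derivative:
  "(flat P has_real_derivative flat ([:0, 0, 1:] * (P - pderiv P)) t) (at t)"
proof -
  consider "t > 0" | "t = 0" | "t < 0" by linarith
  then show ?thesis
  proof cases
    case 1
    have "((\<lambda>t. poly P (1/t) * exp (- 1/t)) has_real_derivative
        poly (pderiv P) (1/t) * (- 1 / (t * t)) * exp (- 1/t) +
        exp (- 1/t) * (1 / (t * t)) * poly P (1/t)) (at t)"
    proof (rule DERIV_mult[OF DERIV_chain2[OF poly_DERIV]])
      show "((\<lambda>t. 1/t) has_real_derivative - 1 / (t * t)) (at t)"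
        using 1 by (auto intro!: derivative_eq_intros)
      show "((\<lambda>t. exp (- 1/t)) has_real_derivative exp (- 1/t) * (1 / (t * t))) (at t)"
        using 1 by (auto intro!: derivative_eq_intros)
    qed
    moreover have "poly (pderiv P) (1/t) * (- 1 / (t * t)) * exp (- 1/t) +
        exp (- 1/t) * (1 / (t * t)) * poly P (1/t) = flat ([:0, 0, 1:] * (P - pderiv P)) t"
      using 1 by (simp add: flat_def field_simps)
    moreover have ev: "\<forall>\<^sub>F t in nhds t. poly P (1/t) * exp (- 1/t) = flat P t"
      using eventually_nhds_in_open[of "{0<..}" t] 1
      by (auto elim!: eventually_mono simp: flat_def)
    ultimately show ?thesis
      using DERIV_cong_ev[OF refl ev refl] by metis
  next
    case 3
    have "\<forall>\<^sub>F t in nhds t. 0 = flat P t"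
      using eventually_nhds_in_open[of "{..<0}" t] 3
      by (auto elim!: eventually_mono simp: flat_def)
    then have "(flat P has_real_derivative 0) (at t)"
      using DERIV_cong_ev[of t t "\<lambda>_. 0" "flat P" 0 0] by simp
    then show ?thesis using 3 by (simp add: flat_def)
  next
    case 2
    have r: "((\<lambda>h. flat P h / h) \<longlongrightarrow> 0) (at_right 0)"
    proof -
      \<comment> \<open>Dividing by \<open>h\<close> multiplies the polynomial in \<open>1/h\<close>
        by its variable, which gives \<open>pCons 0 P\<close>; the exponential still wins as
        \<open>1/h\<close> tends to infinity.\<close>
      have "((\<lambda>h. poly (pCons 0 P) (inverse h) * exp (- inverse h)) \<longlongrightarrow> 0) (at_right (0::real))"
        by (rule filterlim_compose[OF poly_exp_tendsto_0 filterlim_inverse_at_top_right])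
      then show ?thesis
        by (rule Lim_transform_eventually)
           (auto simp: eventually_at_filter flat_def field_simps intro!: always_eventually)
    qed
    have l: "((\<lambda>h. flat P h / h) \<longlongrightarrow> 0) (at_left 0)"
      by (rule Lim_transform_eventually[OF tendsto_const[of 0]])
         (auto simp: eventually_at_filter flat_def intro!: always_eventually)
    have "((\<lambda>h. flat P h / h) \<longlongrightarrow> 0) (at 0)"
      using filterlim_split_at[OF l r] .
    then show ?thesis using 2 by (simp add: DERIV_def flat_def)
  qed
qed

lemma Ck_on_flat: "Ck_on k UNIV (flat P)"
proof (induction k arbitrary: P)
  case 0
  show ?case
    using flat_has_derivative by (auto intro!: DERIV_isCont continuous_at_imp_continuous_on)
next
  case (Suc k)
  show ?case
    by (rule Ck_on_SucI[OF open_UNIV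
          flat_has_derivative[of P, unfolded has_field_derivative_def]])
       (rule Ck_on_mult[OF open_UNIV Suc Ck_on_const[OF open_UNIV]])
qed

text \<open>The second difference of \<open>f\<close> over a parallelogram with sides
  \<open>h v\<close> and \<open>h w\<close> is symmetric in \<open>v\<close> and \<open>w\<close>.
  Two applications of the mean value theorem express it as \<open>h * h\<close> times a mixed
  derivative at a nearby point, in either order; if the mixed derivatives differed at
  \<open>x\<close>, continuity would keep these two values apart.\<close>

lemma symmetric_second_derivative:
  fixes f :: "'a::real_normed_vector \<Rightarrow> real"
  assumes W: "open W" "x \<in> W" and f: "Ck_on 2 W f"
  shows "frechet_derivative (\<lambda>y. frechet_derivative f (at y) v) (at x) w =
         frechet_derivative (\<lambda>y. frechet_derivative f (at y) w) (at x) v"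
proof (rule ccontr)
  define a where "a v w y = frechet_derivative (\<lambda>y. frechet_derivative f (at y) v) (at y) w" for v w y
  assume "\<not> ?thesis"
  then have ne: "a v w x \<noteq> a w v x" by (simp add: a_def)
  have f2: "Ck_on (Suc (Suc 0)) W f" using f by (simp add: numeral_2_eq_2)
  have d1: "(f has_derivative frechet_derivative f (at y)) (at y)" if "y \<in> W" for y
    using Ck_on_SucD[OF f2 that] .
  have d2: "((\<lambda>y. frechet_derivative f (at y) v) has_derivative (\<lambda>w. a v w y)) (at y)"
    if "y \<in> W" for y v
    using Ck_on_SucD[of 0 W "\<lambda>y. frechet_derivative f (at y) v" y] f2 that by (simp add: a_def)
  have cont: "continuous_on W (a v w)" for v w
    using f2 by (simp add: a_def[abs_def])
  \<comment> \<open>Half the gap: values closer than \<open>e\<close> to \<open>a v w x\<close> and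
    to \<open>a w v x\<close> cannot coincide.\<close>
  define e where "e = \<bar>a v w x - a w v x\<bar> / 2"
  have "e > 0" using ne by (simp add: e_def)
  have close: "\<forall>\<^sub>F y in nhds x. \<bar>a v w y - a v w x\<bar> < e" for v w
  proof -
    have "isCont (a v w) x" using cont[of v w] W by (simp add: continuous_on_eq_continuous_at)
    then have "(a v w \<longlongrightarrow> a v w x) (nhds x)"
      by (simp add: isCont_def tendsto_at_iff_tendsto_nhds)
    then show ?thesis using \<open>e > 0\<close> by (simp add: tendsto_iff dist_real_def)
  qed
  have "\<forall>\<^sub>F y in nhds x. y \<in> W \<and> \<bar>a v w y - a v w x\<bar> < e \<and> \<bar>a w v y - a w v x\<bar> < e"
    by (rule eventually_conj[OF eventually_nhds_in_open[OF W] eventually_conj[OF close close]])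
  then obtain d where d: "d > 0" and dW: "\<And>y. dist y x < d \<Longrightarrow>
      y \<in> W \<and> \<bar>a v w y - a v w x\<bar> < e \<and> \<bar>a w v y - a w v x\<bar> < e"
    unfolding eventually_nhds_metric by auto
  define N where "N = norm v + norm w + 1"
  have N: "N > 0" by (simp add: N_def add_nonneg_pos)
  \<comment> \<open>Chosen so that the whole parallelogram stays within distance
    \<open>h * N = d / 2\<close> of \<open>x\<close>.\<close>
  define h where "h = d / (2 * N)"
  have h: "h > 0" using d N by (simp add: h_def)
  have near: "dist (x + s *\<^sub>R p + t *\<^sub>R q) x < d"
    if "0 \<le> s" "s \<le> h" "0 \<le> t" "t \<le> h" "{p, q} = {v, w}" for s t p q
  proof -
    have "norm (s *\<^sub>R p + t *\<^sub>R q) \<le> norm (s *\<^sub>R p) + norm (t *\<^sub>R q)"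
      by (rule norm_triangle_ineq)
    also have "\<dots> \<le> h * norm p + h * norm q"
      using that by (auto intro!: add_mono mult_right_mono)
    also have "\<dots> \<le> h * N"
      using that(5) h by (auto simp: N_def doubleton_eq_iff algebra_simps)
    also have "\<dots> = d / 2"
      using N by (simp add: h_def)
    also have "\<dots> < d" using d by simp
    finally show ?thesis by (simp add: dist_norm algebra_simps)
  qed
  have mvt: "\<exists>\<xi>. dist \<xi> x < d \<and>
      f (x + h *\<^sub>R p + h *\<^sub>R q) - f (x + h *\<^sub>R p) - f (x + h *\<^sub>R q) + f x = h * h * a p q \<xi>"
    if pq: "{p, q} = {v, w}" for p q
  proof -
    \<comment> \<open>The increment of \<open>f\<close> in direction \<open>q\<close>, as a function
      of the position along \<open>p\<close>. The mean value theorem is applied to it along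
      \<open>p\<close>, and then along \<open>q\<close> to the increment of the
      \<open>p\<close>-derivative that results.\<close>
    define g where "g s = f (x + s *\<^sub>R p + h *\<^sub>R q) - f (x + s *\<^sub>R p + 0 *\<^sub>R q)" for s
    have line: "((\<lambda>s. F (x + s *\<^sub>R p + t *\<^sub>R q)) has_real_derivative F' p) (at s)"
      if "(F has_derivative F') (at (x + s *\<^sub>R p + t *\<^sub>R q))" for F F' s t p q
    proof -
      have "((\<lambda>s. x + s *\<^sub>R p + t *\<^sub>R q) has_derivative (\<lambda>s. s *\<^sub>R p)) (at s)"
        by (auto intro!: derivative_eq_intros)
      from diff_chain_at[OF this that] have "((\<lambda>s. F (x + s *\<^sub>R p + t *\<^sub>R q)) has_derivative (\<lambda>s. F' (s *\<^sub>R p))) (at s)"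
        by (simp add: o_def)
      then show ?thesis
        using linear_cmul[OF has_derivative_linear[OF that]]
        by (simp add: has_field_derivative_def mult_commute_abs)
    qed
    have "(g has_real_derivative (frechet_derivative f (at (x + s *\<^sub>R p + h *\<^sub>R q)) p -
         frechet_derivative f (at (x + s *\<^sub>R p + 0 *\<^sub>R q)) p)) (at s)" if "0 \<le> s" "s \<le> h" for s
    proof -
      have "dist (x + s *\<^sub>R p + h *\<^sub>R q) x < d" "dist (x + s *\<^sub>R p + 0 *\<^sub>R q) x < d"
        using near[OF that _ _ pq, of h] near[OF that _ _ pq, of 0] h by simp_all
      then show ?thesis
        unfolding g_def[abs_def] by (intro DERIV_diff line[OF d1] dW[THEN conjunct1])
    qed
    then have "\<exists>z>0. z < h \<and> g h - g 0 = (h - 0) *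
        (frechet_derivative f (at (x + z *\<^sub>R p + h *\<^sub>R q)) p -
         frechet_derivative f (at (x + z *\<^sub>R p + 0 *\<^sub>R q)) p)"
      by (rule MVT2[OF h])
    then obtain s where s: "0 < s" "s < h" "g h - g 0 = h *
        (frechet_derivative f (at (x + s *\<^sub>R p + h *\<^sub>R q)) p -
         frechet_derivative f (at (x + s *\<^sub>R p + 0 *\<^sub>R q)) p)" by auto
    have eq: "x + s *\<^sub>R p + t *\<^sub>R q = x + t *\<^sub>R q + s *\<^sub>R p" for t by (simp add: algebra_simps)
    have "((\<lambda>t. frechet_derivative f (at (x + t *\<^sub>R q + s *\<^sub>R p)) p) has_real_derivative
        a p q (x + t *\<^sub>R q + s *\<^sub>R p)) (at t)" if "0 \<le> t" "t \<le> h" for t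
    proof -
      have "dist (x + t *\<^sub>R q + s *\<^sub>R p) x < d"
        using near[of t s q p] that s(1,2) pq by (simp add: insert_commute)
      then show ?thesis
        by (intro line[where F = "\<lambda>y. frechet_derivative f (at y) p", OF d2] dW[THEN conjunct1])
    qed
    then have "\<exists>z>0. z < h \<and>
        frechet_derivative f (at (x + h *\<^sub>R q + s *\<^sub>R p)) p -
        frechet_derivative f (at (x + 0 *\<^sub>R q + s *\<^sub>R p)) p = (h - 0) * a p q (x + z *\<^sub>R q + s *\<^sub>R p)"
      by (rule MVT2[OF h])
    then obtain t where t: "0 < t" "t < h"
        "frechet_derivative f (at (x + h *\<^sub>R q + s *\<^sub>R p)) p -
        frechet_derivative f (at (x + 0 *\<^sub>R q + s *\<^sub>R p)) p = h * a p q (x + t *\<^sub>R q + s *\<^sub>R p)" by auto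
    have "g h - g 0 = h * h * a p q (x + t *\<^sub>R q + s *\<^sub>R p)"
      unfolding s(3) eq t(3) by simp
    moreover have "dist (x + t *\<^sub>R q + s *\<^sub>R p) x < d"
      using near[of s t p q] s t pq by (simp add: algebra_simps)
    ultimately show ?thesis by (auto simp: g_def intro!: exI[of _ "x + t *\<^sub>R q + s *\<^sub>R p"])
  qed
  obtain \<xi> where \<xi>: "dist \<xi> x < d"
      "f (x + h *\<^sub>R v + h *\<^sub>R w) - f (x + h *\<^sub>R v) - f (x + h *\<^sub>R w) + f x = h * h * a v w \<xi>"
    using mvt[of v w] by auto
  obtain \<eta> where \<eta>: "dist \<eta> x < d"
      "f (x + h *\<^sub>R w + h *\<^sub>R v) - f (x + h *\<^sub>R w) - f (x + h *\<^sub>R v) + f x = h * h * a w v \<eta>"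
    using mvt[of w v] by (auto simp: insert_commute)
  have "h * h * a v w \<xi> = h * h * a w v \<eta>"
    using \<xi>(2) \<eta>(2) by (simp add: algebra_simps)
  then have "a v w \<xi> = a w v \<eta>" using h by simp
  then show False using dW[OF \<xi>(1)] dW[OF \<eta>(1)] unfolding e_def by (auto simp: abs_if split: if_splits)
qed

lemma Ck_on_norm_square:
  "Ck_on k UNIV (\<lambda>x::'a::real_inner. (norm (x - a))\<^sup>2)"
proof -
  have "Ck_on k UNIV (\<lambda>x::'a. x + - a)"
    by (intro Ck_on_add Ck_on_const open_UNIV Ck_on_bounded_linear bounded_linear_ident)
  then have "Ck_on k UNIV (\<lambda>x::'a. (x + - a) \<bullet> (x + - a))"
    by (intro Ck_on_inner open_UNIV)
  then show ?thesis by (simp add: power2_norm_eq_inner)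
qed

text \<open>The quotient \<open>p / (p + q)\<close>, where \<open>p\<close> is positive exactly
  inside radius \<open>2 * r\<close> and \<open>q\<close> exactly outside radius \<open>r\<close>;
  these regions cover the space, so the denominator never vanishes. Squared norms keep both
  functions smooth at the centre.\<close>

lemma smooth_bump:
  fixes a :: "'a::real_inner"
  assumes r: "0 < r"
  obtains \<beta> :: "'a \<Rightarrow> real" where "\<And>k. Ck_on k UNIV \<beta>" "\<And>x. 0 \<le> \<beta> x" "\<And>x. \<beta> x \<le> 1"
    "\<And>x. dist x a \<le> r \<Longrightarrow> \<beta> x = 1" "\<And>x. 2 * r \<le> dist x a \<Longrightarrow> \<beta> x = 0"
proof -
  define p where "p x = flat 1 (4 * r\<^sup>2 - (norm (x - a))\<^sup>2)" for x
  define q where "q x = flat 1 ((norm (x - a))\<^sup>2 - r\<^sup>2)" for x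
  have nonneg: "flat 1 t \<ge> 0" for t by (simp add: flat_def)
  have pos: "p x + q x > 0" for x
  proof (cases "4 * r\<^sup>2 - (norm (x - a))\<^sup>2 > 0")
    case True
    then show ?thesis using nonneg by (simp add: p_def q_def flat_def[of _ "4 * r\<^sup>2 - (norm (x - a))\<^sup>2"] add_pos_nonneg)
  next
    case False
    then have "(norm (x - a))\<^sup>2 - r\<^sup>2 > 0" using r by (smt (verit) zero_less_power)
    then show ?thesis using nonneg by (simp add: p_def q_def flat_def[of _ "(norm (x - a))\<^sup>2 - r\<^sup>2"] add_nonneg_pos)
  qed
  have shift: "Ck_on k UNIV (\<lambda>x. c * (norm (x - a))\<^sup>2 + d)" for k c d
    by (intro Ck_on_add Ck_on_mult Ck_on_norm_square Ck_on_const open_UNIV)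
  have p: "Ck_on k UNIV p" for k
    using Ck_on_compose[OF open_UNIV open_UNIV subset_UNIV shift[of k "-1" "4 * r\<^sup>2"] Ck_on_flat[of k 1]]
    by (simp add: p_def[abs_def])
  have q: "Ck_on k UNIV q" for k
    using Ck_on_compose[OF open_UNIV open_UNIV subset_UNIV shift[of k "1" "- r\<^sup>2"] Ck_on_flat[of k 1]]
    by (simp add: q_def[abs_def])
  have inv: "Ck_on k UNIV (\<lambda>x. inverse (p x + q x))" for k
    by (rule Ck_on_compose[OF open_UNIV _ _ Ck_on_add[OF open_UNIV p q] Ck_on_inverse])
       (use pos in \<open>force simp: open_Compl less_le\<close>)+
  show thesis
  proof
    fix k show "Ck_on k UNIV (\<lambda>x. p x * inverse (p x + q x))"
      by (rule Ck_on_mult[OF open_UNIV p inv])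
  next
    fix x
    show "0 \<le> p x * inverse (p x + q x)"
      using pos[of x] nonneg by (simp add: p_def)
    show "p x * inverse (p x + q x) \<le> 1"
      using pos[of x] nonneg by (simp add: q_def field_simps)
  next
    fix x assume "dist x a \<le> r"
    then have "(norm (x - a))\<^sup>2 \<le> r\<^sup>2" by (simp add: dist_norm power_mono)
    then have "q x = 0" by (simp add: q_def flat_def)
    then show "p x * inverse (p x + q x) = 1" using pos[of x] by simp
  next
    fix x assume "2 * r \<le> dist x a"
    then have "(2 * r)\<^sup>2 \<le> (norm (x - a))\<^sup>2" using r by (intro power_mono) (auto simp: dist_norm)
    then have "p x = 0" by (simp add: p_def flat_def power_mult_distrib)
    then show "p x * inverse (p x + q x) = 0" by simp
  qed
qed

section \<open>Smoothness and one-sided derivatives up to the boundary\<close>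

lemma smooth_onE:
  assumes "smooth_on S f" "x \<in> S"
  obtains W h where "open W" "x \<in> W" "\<forall>k. Ck_on k W h" "\<forall>y\<in>S \<inter> W. h y = f y"
  using assms unfolding smooth_on_def by blast

lemma smooth_onI:
  assumes "\<And>x. x \<in> S \<Longrightarrow> \<exists>W h. open W \<and> x \<in> W \<and> (\<forall>k. Ck_on k W h) \<and> (\<forall>y\<in>S \<inter> W. h y = f y)"
  shows "smooth_on S f"
  unfolding smooth_on_def using assms by blast

lemma smooth_on_subset:
  assumes f: "smooth_on S f" and sub: "T \<subseteq> S"
  shows "smooth_on T f"
proof (rule smooth_onI)
  fix x assume "x \<in> T"
  then have "x \<in> S" using sub by blast
  obtain W h where "open W" "x \<in> W" "\<forall>k. Ck_on k W h" "\<forall>y\<in>S \<inter> W. h y = f y"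
    by (rule smooth_onE[OF f \<open>x \<in> S\<close>])
  then show "\<exists>W h. open W \<and> x \<in> W \<and> (\<forall>k. Ck_on k W h) \<and> (\<forall>y\<in>T \<inter> W. h y = f y)"
    using sub by (intro exI[of _ W] exI[of _ h]) auto
qed

lemma smooth_on_cong:
  assumes eq: "\<And>x. x \<in> S \<Longrightarrow> f x = g x" and f: "smooth_on S f"
  shows "smooth_on S g"
proof (rule smooth_onI)
  fix x assume "x \<in> S"
  obtain W h where "open W" "x \<in> W" "\<forall>k. Ck_on k W h" "\<forall>y\<in>S \<inter> W. h y = f y"
    by (rule smooth_onE[OF f \<open>x \<in> S\<close>])
  then show "\<exists>W h. open W \<and> x \<in> W \<and> (\<forall>k. Ck_on k W h) \<and> (\<forall>y\<in>S \<inter> W. h y = g y)"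
    using eq by (intro exI[of _ W] exI[of _ h]) auto
qed

lemma smooth_on_local:
  assumes "\<And>x. x \<in> S \<Longrightarrow> \<exists>U. open U \<and> x \<in> U \<and> smooth_on (S \<inter> U) f"
  shows "smooth_on S f"
  unfolding smooth_on_def
proof
  fix x assume "x \<in> S"
  with assms obtain U where U: "open U" "x \<in> U" "smooth_on (S \<inter> U) f" by blast
  from \<open>x \<in> S\<close> U(2) have "x \<in> S \<inter> U" by simp
  obtain W h where "open W" "x \<in> W" "\<forall>k. Ck_on k W h" "\<forall>y\<in>S \<inter> U \<inter> W. h y = f y"
    by (rule smooth_onE[OF U(3) \<open>x \<in> S \<inter> U\<close>])
  then show "\<exists>W h. open W \<and> x \<in> W \<and> (\<forall>k. Ck_on k W h) \<and> (\<forall>y\<in>S \<inter> W. h y = f y)"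
    using U by (intro exI[of _ "U \<inter> W"] exI[of _ h]) (auto intro: Ck_on_subset)
qed

lemma smooth_on_Ck_on: "open W \<Longrightarrow> S \<subseteq> W \<Longrightarrow> (\<And>k. Ck_on k W f) \<Longrightarrow> smooth_on S f"
  unfolding smooth_on_def by blast

lemma smooth_on_const [simp]: "smooth_on S (\<lambda>x. c)"
  by (rule smooth_on_Ck_on[OF open_UNIV]) auto

lemma smooth_on_bounded_linear: "bounded_linear f \<Longrightarrow> smooth_on S f"
  by (rule smooth_on_Ck_on[OF open_UNIV]) (auto intro: Ck_on_bounded_linear)

lemma smooth_on_binop:
  fixes S :: "'a::real_normed_vector set"
  assumes "\<And>(W::'a set) f g. open W \<Longrightarrow> (\<And>k. Ck_on k W f) \<Longrightarrow> (\<And>k. Ck_on k W g) \<Longrightarrow> (\<And>k. Ck_on k W (\<lambda>x. F (f x) (g x)))"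
    and fg: "smooth_on S f" "smooth_on S g"
  shows "smooth_on S (\<lambda>x. F (f x) (g x))"
  unfolding smooth_on_def
proof
  fix x assume "x \<in> S"
  then obtain W h W' h' where "open W" "x \<in> W" "\<And>k. Ck_on k W h" "\<forall>y\<in>S \<inter> W. h y = f y"
    "open W'" "x \<in> W'" "\<And>k. Ck_on k W' h'" "\<forall>y\<in>S \<inter> W'. h' y = g y"
    using fg unfolding smooth_on_def by meson
  note h = this
  have "Ck_on k (W \<inter> W') (\<lambda>x. F (h x) (h' x))" for k
    by (rule assms(1)) (simp_all add: open_Int h(1,5) Ck_on_subset[OF h(3)] Ck_on_subset[OF h(7)])
  then show "\<exists>W h. open W \<and> x \<in> W \<and> (\<forall>k. Ck_on k W h) \<and> (\<forall>y\<in>S \<inter> W. h y = F (f y) (g y))"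
    using h by (intro exI[of _ "W \<inter> W'"] exI[of _ "\<lambda>x. F (h x) (h' x)"]) auto
qed

lemma smooth_on_add: "smooth_on S f \<Longrightarrow> smooth_on S g \<Longrightarrow> smooth_on S (\<lambda>x. f x + g x)"
  by (rule smooth_on_binop[where F = "(+)"]) (rule Ck_on_add)

lemma smooth_on_mult:
  fixes f :: "'a::real_normed_vector \<Rightarrow> 'b::real_normed_algebra"
  shows "smooth_on S f \<Longrightarrow> smooth_on S g \<Longrightarrow> smooth_on S (\<lambda>x. f x * g x)"
  by (rule smooth_on_binop[where F = "(*)"]) (rule Ck_on_mult)

lemma smooth_on_sum:
  "(\<And>i. i \<in> I \<Longrightarrow> smooth_on S (f i)) \<Longrightarrow> smooth_on S (\<lambda>x. \<Sum>i\<in>I. f i x)"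
  by (induction I rule: infinite_finite_induct) (auto intro: smooth_on_add)

text \<open>A local extension \<open>h\<close> of \<open>f\<close> may leave the open set on which
  the extension \<open>j\<close> of \<open>g\<close> is smooth; restricting to the preimage of that
  set repairs this, and on \<open>S\<close> the composite is the right one because \<open>f\<close>
  maps into \<open>T\<close>.\<close>

lemma smooth_on_compose:
  fixes f :: "'a::real_normed_vector \<Rightarrow> 'b::euclidean_space"
  assumes "smooth_on S f" "smooth_on T g" "f ` S \<subseteq> T"
  shows "smooth_on S (\<lambda>x. g (f x))"
  unfolding smooth_on_def
proof
  fix x assume x: "x \<in> S"
  obtain W h where h: "open W" "x \<in> W" "\<And>k. Ck_on k W h" "\<forall>y\<in>S \<inter> W. h y = f y"
    using assms(1) x unfolding smooth_on_def by meson
  have "f x \<in> T" using x assms by auto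
  then obtain V j where j: "open V" "f x \<in> V" "\<And>k. Ck_on k V j" "\<forall>y\<in>T \<inter> V. j y = g y"
    using assms(2) unfolding smooth_on_def by meson
  have o: "open (W \<inter> h -` V)"
    using h(1) h(3)[of 0] j(1) by (auto intro: continuous_open_preimage)
  have "Ck_on k (W \<inter> h -` V) (\<lambda>x. j (h x))" for k
    by (rule Ck_on_compose[OF o j(1) _ Ck_on_subset[OF h(3)] j(3)]) auto
  moreover have "j (h y) = g (f y)" if "y \<in> S \<inter> (W \<inter> h -` V)" for y
    using that h(4) j(4) assms(3) by auto
  moreover have "h x = f x" using h x by auto
  ultimately show "\<exists>W h. open W \<and> x \<in> W \<and> (\<forall>k. Ck_on k W h) \<and> (\<forall>y\<in>S \<inter> W. h y = g (f y))"
    using o h(2) j(2) by (intro exI[of _ "W \<inter> h -` V"] exI[of _ "\<lambda>x. j (h x)"]) simp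
qed

lemma smooth_on_linear_compose:
  fixes f :: "'a::real_normed_vector \<Rightarrow> 'b::euclidean_space"
  shows "bounded_linear L \<Longrightarrow> smooth_on S f \<Longrightarrow> smooth_on S (\<lambda>x. L (f x))"
  by (rule smooth_on_compose[OF _ smooth_on_bounded_linear[of L UNIV]]) auto

lemma smooth_on_exp: "smooth_on S f \<Longrightarrow> smooth_on S (\<lambda>x. exp (f x :: real))"
  by (rule smooth_on_compose[OF _ smooth_on_Ck_on[OF open_UNIV subset_UNIV Ck_on_exp]]) auto

lemma smooth_on_imp_continuous_on:
  assumes "smooth_on S f" shows "continuous_on S f"
  unfolding continuous_on_eq_continuous_within
proof
  fix x assume x: "x \<in> S"
  then obtain W h where h: "open W" "x \<in> W" "\<And>k. Ck_on k W h" "\<forall>y\<in>S \<inter> W. h y = f y"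
    using assms unfolding smooth_on_def by meson
  have "isCont h x" using h(1,2) h(3)[of 0] by (simp add: continuous_on_eq_continuous_at)
  then have "(h \<longlongrightarrow> f x) (at x within S)"
    using h x by (metis IntI continuous_at_imp_continuous_at_within continuous_within)
  moreover have "eventually (\<lambda>y. h y = f y) (at x within S)"
    unfolding eventually_at_topological using h by blast
  ultimately show "continuous (at x within S) f"
    unfolding continuous_within by (rule Lim_transform_eventually)
qed

text \<open>A relatively open set contains all points of the half-space near \<open>x\<close>, so
  limits within \<open>S\<close> and within the half-space agree. Derivatives can thus be computed
  from formulas valid only on \<open>S\<close>.\<close>

lemma has_Dh_eqI:
  assumes S: "openin (top_of_set half_space) S" "x \<in> S"
    and d: "(f has_derivative f') (at x within half_space)" and eq: "\<And>y. y \<in> S \<Longrightarrow> f y = g y"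
  shows "(g has_derivative f') (at x within half_space)" "Dh g x = f'"
proof -
  have "(f has_derivative f') (at x within S)" using d at_within_relopen[OF S] by simp
  then have "(g has_derivative f') (at x within S)"
    using S(2) eq by (metis has_derivative_transform)
  then show g: "(g has_derivative f') (at x within half_space)"
    unfolding at_within_relopen[OF S] .
  show "Dh g x = f'"
    using half_space_derivative_unique[OF _ g] S openin_imp_subset by blast
qed

text \<open>On \<open>S\<close> the one-sided derivative is the full derivative of a smooth
  extension, at boundary points too. Through the extension, facts about open sets such as the
  symmetry of second derivatives carry over to the boundary.\<close>

lemma smooth_on_has_Dh:
  assumes S: "openin (top_of_set half_space) S" "x \<in> S" and f: "smooth_on S f"
  shows "(f has_derivative Dh f x) (at x within half_space)"
    and "\<exists>W h. open W \<and> x \<in> W \<and> (\<forall>k. Ck_on k W h) \<and> (\<forall>y\<in>S \<inter> W. h y = f y) \<and>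
           (\<forall>y\<in>S \<inter> W. Dh f y = frechet_derivative h (at y))"
proof -
  obtain W h where h: "open W" "x \<in> W" "\<And>k. Ck_on k W h" "\<forall>y\<in>S \<inter> W. h y = f y"
    using f S(2) unfolding smooth_on_def by meson
  have o: "openin (top_of_set half_space) (S \<inter> W)"
    using openin_Int_open[OF S(1) h(1)] .
  have d: "(h has_derivative frechet_derivative h (at y)) (at y within half_space)" if "y \<in> W" for y
    using Ck_on_SucD[OF h(3) that] has_derivative_at_withinI by blast
  have *: "(f has_derivative frechet_derivative h (at y)) (at y within half_space)"
    "Dh f y = frechet_derivative h (at y)" if "y \<in> S \<inter> W" for y
    using has_Dh_eqI[OF o that d, of f] that h(4) by auto
  then show "(f has_derivative Dh f x) (at x within half_space)" using S(2) h(2) by auto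
  show "\<exists>W h. open W \<and> x \<in> W \<and> (\<forall>k. Ck_on k W h) \<and> (\<forall>y\<in>S \<inter> W. h y = f y) \<and>
           (\<forall>y\<in>S \<inter> W. Dh f y = frechet_derivative h (at y))"
    using h *(2) by (intro exI[of _ W] exI[of _ h]) simp
qed

lemma smooth_on_Dh:
  assumes S: "openin (top_of_set half_space) S" and f: "smooth_on S f"
  shows "smooth_on S (\<lambda>x. Dh f x v)"
  unfolding smooth_on_def
proof
  fix x assume "x \<in> S"
  from smooth_on_has_Dh(2)[OF S this f] obtain W h where h: "open W" "x \<in> W" "\<And>k. Ck_on k W h"
      "\<forall>y\<in>S \<inter> W. Dh f y = frechet_derivative h (at y)"
    by meson
  have "Ck_on k W (\<lambda>y. frechet_derivative h (at y) v)" for k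
    using h(3)[of "Suc k"] by simp
  then show "\<exists>W h. open W \<and> x \<in> W \<and> (\<forall>k. Ck_on k W h) \<and> (\<forall>y\<in>S \<inter> W. h y = Dh f y v)"
    using h by (intro exI[of _ W] exI[of _ "\<lambda>y. frechet_derivative h (at y) v"]) auto
qed

lemma Dh_symmetric_real:
  fixes f :: "real^3 \<Rightarrow> real"
  assumes S: "openin (top_of_set half_space) S" "x \<in> S" and f: "smooth_on S f"
  shows "Dh (\<lambda>y. Dh f y v) x w = Dh (\<lambda>y. Dh f y w) x v"
proof -
  from smooth_on_has_Dh(2)[OF S f] obtain W h where h: "open W" "x \<in> W" "\<And>k. Ck_on k W h"
      "\<forall>y\<in>S \<inter> W. Dh f y = frechet_derivative h (at y)"
    by meson
  have o: "openin (top_of_set half_space) (S \<inter> W)"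
    using openin_Int_open[OF S(1) h(1)] .
  have "Dh (\<lambda>y. Dh f y v) x = frechet_derivative (\<lambda>y. frechet_derivative h (at y) v) (at x)" for v
  proof (rule has_Dh_eqI(2)[OF o])
    have "Ck_on (Suc 0) W (\<lambda>y. frechet_derivative h (at y) v)"
      using h(3)[of "Suc (Suc 0)"] by simp
    from has_derivative_at_withinI[OF Ck_on_SucD[OF this h(2)]]
    show "((\<lambda>y. frechet_derivative h (at y) v) has_derivative
        frechet_derivative (\<lambda>y. frechet_derivative h (at y) v) (at x)) (at x within half_space)" .
  qed (use h S in auto)
  then show ?thesis using symmetric_second_derivative[OF h(1,2,3)] by metis
qed

lemma Dh_linear_compose:
  assumes S: "openin (top_of_set half_space) S" "x \<in> S" and f: "smooth_on S f" and L: "bounded_linear L"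
  shows "Dh (\<lambda>y. L (f y)) x v = L (Dh f x v)"
proof -
  have "((\<lambda>y. L (f y)) has_derivative (\<lambda>v. L (Dh f x v))) (at x within half_space)"
    by (rule bounded_linear.has_derivative[OF L smooth_on_has_Dh(1)[OF S f]])
  from has_Dh_eqI(2)[OF S this] show ?thesis by simp
qed

lemma Dh_symmetric:
  fixes f :: "real^3 \<Rightarrow> 'b::euclidean_space"
  assumes S: "openin (top_of_set half_space) S" "x \<in> S" and f: "smooth_on S f"
  shows "Dh (\<lambda>y. Dh f y v) x w = Dh (\<lambda>y. Dh f y w) x v"
proof (rule euclidean_eqI)
  fix i :: 'b
  have L: "bounded_linear (\<lambda>z::'b. z \<bullet> i)" by (rule bounded_linear_inner_left)
  have *: "Dh (\<lambda>y. Dh f y v) x w \<bullet> i = Dh (\<lambda>y. Dh (\<lambda>y. f y \<bullet> i) y v) x w" for v w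
  proof -
    have "Dh (\<lambda>y. Dh f y v) x w \<bullet> i = Dh (\<lambda>y. Dh f y v \<bullet> i) x w"
      using Dh_linear_compose[OF S smooth_on_Dh[OF S(1) f] L] by simp
    also have "\<dots> = Dh (\<lambda>y. Dh (\<lambda>y. f y \<bullet> i) y v) x w"
    proof -
      have "((\<lambda>y. Dh f y v \<bullet> i) has_derivative Dh (\<lambda>y. Dh f y v \<bullet> i) x) (at x within half_space)"
        by (rule smooth_on_has_Dh(1)[OF S smooth_on_linear_compose[OF L smooth_on_Dh[OF S(1) f]]])
      from has_Dh_eqI(2)[OF S this, of "\<lambda>y. Dh (\<lambda>y. f y \<bullet> i) y v"]
      show ?thesis using Dh_linear_compose[OF S(1) _ f L] by simp
    qed
    finally show ?thesis .
  qed
  show "Dh (\<lambda>y. Dh f y v) x w \<bullet> i = Dh (\<lambda>y. Dh f y w) x v \<bullet> i"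
    unfolding * by (rule Dh_symmetric_real[OF S smooth_on_linear_compose[OF L f]])
qed

text \<open>Mapping \<open>S\<close> into the half-space is what lets the one-sided derivative of
  \<open>g\<close> be used at \<open>f x\<close>, which may be a boundary point.\<close>

lemma has_derivative_half_space_compose:
  assumes S: "openin (top_of_set half_space) S" "x \<in> S" and f: "(f has_derivative f') (at x within half_space)"
    and im: "f ` S \<subseteq> half_space" and g: "(g has_derivative g') (at (f x) within half_space)"
  shows "((\<lambda>x. g (f x)) has_derivative (\<lambda>v. g' (f' v))) (at x within half_space)"
proof -
  have "(f has_derivative f') (at x within S)" using f at_within_relopen[OF S] by simp
  from diff_chain_within[OF this has_derivative_subset[OF g im]]
  show ?thesis unfolding at_within_relopen[OF S] o_def .
qed

lemma differentiable_half_space_cong: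
  assumes "openin (top_of_set half_space) S" "x \<in> S" "f differentiable (at x within half_space)"
    and "\<And>y. y \<in> S \<Longrightarrow> f y = g y"
  shows "g differentiable (at x within half_space)"
  using has_Dh_eqI(1)[OF assms(1,2) Dh_has_derivative[OF assms(3)] assms(4)] by (auto intro: differentiableI)

section \<open>Levi-Civita connection and curvature in a chart\<close>

lemma linear_vec3_expansion:
  fixes h :: "real^3 \<Rightarrow> 'b::real_vector"
  assumes "linear h"
  shows "h a = (\<Sum>i\<in>UNIV. a $ i *\<^sub>R h (axis i 1))"
proof -
  have "h a = h (\<Sum>i\<in>UNIV. a $ i *\<^sub>R axis i 1)"
    using basis_expansion[of a] by (simp add: scalar_mult_eq_scaleR)
  then show ?thesis by (simp add: linear_sum[OF assms] linear_cmul[OF assms])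
qed

text \<open>Product rule for the evaluation of a variable linear map at a variable vector.
  Differentiability is given for each fixed vector; in finite dimension this is enough, by expanding
  \<open>Z y\<close> in coordinates.\<close>

lemma linear_field_has_derivative:
  fixes L :: "real^3 \<Rightarrow> real^3 \<Rightarrow> 'b::real_normed_vector"
  assumes S: "openin (top_of_set half_space) S" "x \<in> S" and L: "\<And>y. y \<in> S \<Longrightarrow> linear (L y)"
    and L': "\<And>a. ((\<lambda>y. L y a) has_derivative L' a) (at x within half_space)"
    and Z: "(Z has_derivative Z') (at x within half_space)"
  shows "((\<lambda>y. L y (Z y)) has_derivative (\<lambda>v. L' (Z x) v + L x (Z' v))) (at x within half_space)"
proof -
  have xh: "x \<in> half_space" using S openin_imp_subset by blast
  have expand: "(\<Sum>i\<in>UNIV. a $ i *\<^sub>R L y (axis i 1)) = L y a" if "y \<in> S" for y a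
    using linear_vec3_expansion[OF L[OF that]] by metis
  have "((\<lambda>y. \<Sum>i\<in>UNIV. a $ i *\<^sub>R L y (axis i 1)) has_derivative
      (\<lambda>v. \<Sum>i\<in>UNIV. a $ i *\<^sub>R L' (axis i 1) v)) (at x within half_space)" for a
    by (intro has_derivative_sum has_derivative_scaleR_right L')
  \<comment> \<open>Uniqueness of the one-sided derivative transfers the linearity of
    \<open>L y\<close> in its argument to \<open>L'\<close>.\<close>
  from half_space_derivative_unique[OF xh has_Dh_eqI(1)[OF S this expand]]
  have "L' a = (\<lambda>v. \<Sum>i\<in>UNIV. a $ i *\<^sub>R L' (axis i 1) v)" for a
    using half_space_derivative_unique[OF xh L'] by metis
  then have L'_expand: "L' a v = (\<Sum>i\<in>UNIV. a $ i *\<^sub>R L' (axis i 1) v)" for a v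
    by metis
  have "((\<lambda>y. \<Sum>i\<in>UNIV. Z y $ i *\<^sub>R L y (axis i 1)) has_derivative
      (\<lambda>v. \<Sum>i\<in>UNIV. Z x $ i *\<^sub>R L' (axis i 1) v + Z' v $ i *\<^sub>R L x (axis i 1))) (at x within half_space)"
    by (intro has_derivative_sum has_derivative_scaleR L' bounded_linear.has_derivative[OF bounded_linear_vec_nth Z])
  moreover have "(\<Sum>i\<in>UNIV. Z x $ i *\<^sub>R L' (axis i 1) v + Z' v $ i *\<^sub>R L x (axis i 1)) =
      L' (Z x) v + L x (Z' v)" for v
    unfolding sum.distrib expand[OF S(2)] L'_expand[of "Z x" v, symmetric] ..
  ultimately have "((\<lambda>y. \<Sum>i\<in>UNIV. Z y $ i *\<^sub>R L y (axis i 1)) has_derivative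
      (\<lambda>v. L' (Z x) v + L x (Z' v))) (at x within half_space)" by simp
  from has_Dh_eqI(1)[OF S this expand] show ?thesis .
qed

locale chart_metric =
  fixes S :: "(real^3) set" and G :: "real^3 \<Rightarrow> real^3 \<Rightarrow> real^3 \<Rightarrow> real"
  assumes S: "openin (top_of_set half_space) S"
    and bil: "x \<in> S \<Longrightarrow> bilinear (G x)"
    and sym: "x \<in> S \<Longrightarrow> G x a b = G x b a"
    and pos: "x \<in> S \<Longrightarrow> v \<noteq> 0 \<Longrightarrow> 0 < G x v v"
    and smooth: "smooth_on S (\<lambda>y. G y a b)"
begin

lemma in_half_space: "x \<in> S \<Longrightarrow> x \<in> half_space"
  using openin_imp_subset[OF S] by blast

lemmas bil_simps = bilinear_ladd[OF bil] bilinear_radd[OF bil] bilinear_lmul[OF bil]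
  bilinear_rmul[OF bil] bilinear_lsub[OF bil] bilinear_rsub[OF bil]
  bilinear_lneg[OF bil] bilinear_rneg[OF bil] bilinear_lzero[OF bil] bilinear_rzero[OF bil]

lemma metric_eqI: "x \<in> S \<Longrightarrow> (\<And>e. G x a e = G x b e) \<Longrightarrow> a = b"
proof (rule ccontr)
  assume x: "x \<in> S" and eq: "\<And>e. G x a e = G x b e" and "a \<noteq> b"
  then have "0 < G x (a - b) (a - b)" by (intro pos) auto
  then show False using eq bil_simps(5)[OF x] by simp
qed

lemma lin: "x \<in> S \<Longrightarrow> linear (\<lambda>a. G x a b)" "x \<in> S \<Longrightarrow> linear (G x a)"
  using bil by (auto simp: bilinear_def)

text \<open>Cramer's rule: in coordinates \<open>z y\<close> solves a linear system whose matrix is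
  the Gram matrix of \<open>G y\<close>, invertible by positive definiteness, so \<open>z\<close> is
  a quotient of polynomials in differentiable functions. This serves for Christoffel symbols and
  gradients, which are given implicitly by their metric products.\<close>

lemma representing_vector_differentiable:
  fixes z :: "real^3 \<Rightarrow> real^3"
  assumes x: "x \<in> S" and L: "\<And>e. (\<lambda>y. L y e) differentiable (at x within half_space)"
    and z: "\<And>y e. y \<in> S \<Longrightarrow> G y (z y) e = L y e"
  shows "z differentiable (at x within half_space)"
proof -
  define A :: "real^3 \<Rightarrow> real^3^3" where "A y = (\<chi> i j. G y (axis j 1) (axis i 1))" for y
  define b :: "real^3 \<Rightarrow> real^3" where "b y = (\<chi> i. L y (axis i 1))" for y
  have Az: "(A y *v a) $ i = G y a (axis i 1)" if "y \<in> S" for y a i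
  proof -
    have "G y a (axis i 1) = (\<Sum>j\<in>UNIV. a $ j *\<^sub>R G y (axis j 1) (axis i 1))"
      by (rule linear_vec3_expansion[OF lin(1)[OF that]])
    then show ?thesis by (simp add: A_def matrix_vector_mult_def mult.commute)
  qed
  have det: "det (A y) \<noteq> 0" if y: "y \<in> S" for y
  proof -
    have "a = 0" if "A y *v a = 0" for a
    proof (rule metric_eqI[OF y])
      fix e
      have "G y a (axis i 1) = 0" for i using Az[OF y, of a i] that by simp
      moreover have "G y a e = (\<Sum>i\<in>UNIV. e $ i *\<^sub>R G y a (axis i 1))"
        by (rule linear_vec3_expansion[OF lin(2)[OF y]])
      ultimately show "G y a e = G y 0 e"
        using bil_simps(9)[OF y] by simp
    qed
    then have "inj ((*v) (A y))" by (simp add: linear_injective_0)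
    then show ?thesis using det_nz_iff_inj[OF matrix_vector_mul_linear[of "A y"]] by simp
  qed
  have dA: "(\<lambda>y. A y $ i $ j) differentiable (at x within half_space)" for i j
    using smooth_on_has_Dh(1)[OF S x smooth] by (auto simp: A_def intro: differentiableI)
  have dprod: "(\<lambda>y. \<Prod>i\<in>I. f i y) differentiable (at x within half_space)"
    if "finite I" "\<And>i. (\<lambda>y. f i y :: real) differentiable (at x within half_space)" for I :: "3 set" and f
    using that by (induction I) auto
  have ddet: "(\<lambda>y. det (M y)) differentiable (at x within half_space)"
    if "\<And>i j. (\<lambda>y. M y $ i $ j) differentiable (at x within half_space)" for M :: "real^3 \<Rightarrow> real^3^3"
    unfolding det_def using that
    by (intro differentiable_sum ballI differentiable_mult differentiable_const dprod) auto
  have "(\<lambda>y. if j = k then b y $ i else A y $ i $ j) differentiable (at x within half_space)" for i j k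
    by (cases "j = k") (use L dA in \<open>auto simp: b_def\<close>)
  then have d: "(\<lambda>y. det (\<chi> i j. if j = k then b y $ i else A y $ i $ j) / det (A y))
      differentiable (at x within half_space)" for k
    using det[OF x] by (intro differentiable_divide ddet dA) auto
  have zk: "z y $ k = det (\<chi> i j. if j = k then b y $ i else A y $ i $ j) / det (A y)"
    if "y \<in> S" for y k
  proof -
    have "A y *v z y = b y" using that z Az by (simp add: vec_eq_iff b_def)
    then show ?thesis using cramer[OF det[OF that]] by simp
  qed
  have k: "(\<lambda>y. z y $ k) differentiable (at x within half_space)" for k
    by (rule differentiable_half_space_cong[OF S x d zk[symmetric]])
  show ?thesis
    unfolding differentiable_componentwise_within[of z]
    using k by (auto simp: Basis_vec_def inner_axis)
qed

abbreviation P where "P x v a b \<equiv> Dh (\<lambda>y. G y a b) x v"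

abbreviation \<Gamma> where "\<Gamma> \<equiv> christoffel G"

text \<open>Christoffel symbols of the first kind: the Koszul formula for constant fields, which
  uses derivatives of the metric but not its inverse.\<close>

definition \<kappa> where "\<kappa> x v w e = (P x v w e + P x w v e - P x e v w) / 2"

lemma levi_civita_unique:
  assumes "x \<in> S" shows "\<exists>!\<Gamma>. levi_civita_at G x \<Gamma>"
proof (rule levi_civita_ex1[OF S assms])
  show "(\<lambda>y. G y a b) differentiable (at x within half_space)" for a b
    using smooth_on_has_Dh(1)[OF S assms smooth] by (rule differentiableI)
qed (fact bil sym pos[OF assms])+

lemma levi_civita: "x \<in> S \<Longrightarrow> levi_civita_at G x (\<Gamma> x)"
  unfolding christoffel_def by (rule theI'[OF levi_civita_unique])

lemma christoffel_eqI: "x \<in> S \<Longrightarrow> levi_civita_at G x \<Gamma>' \<Longrightarrow> \<Gamma> x = \<Gamma>'"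
  using levi_civita_unique levi_civita by blast

lemma \<Gamma>_bil: "x \<in> S \<Longrightarrow> bilinear (\<Gamma> x)"
  and \<Gamma>_sym: "x \<in> S \<Longrightarrow> \<Gamma> x v w = \<Gamma> x w v"
  and P_eq: "x \<in> S \<Longrightarrow> P x v a b = G x (\<Gamma> x v a) b + G x a (\<Gamma> x v b)"
  using levi_civita unfolding levi_civita_at_def by blast+

lemmas \<Gamma>_simps = bilinear_ladd[OF \<Gamma>_bil] bilinear_radd[OF \<Gamma>_bil] bilinear_lmul[OF \<Gamma>_bil]
  bilinear_rmul[OF \<Gamma>_bil] bilinear_lsub[OF \<Gamma>_bil] bilinear_rsub[OF \<Gamma>_bil]
  bilinear_lneg[OF \<Gamma>_bil] bilinear_rneg[OF \<Gamma>_bil] bilinear_lzero[OF \<Gamma>_bil] bilinear_rzero[OF \<Gamma>_bil]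

lemma \<kappa>_eq: "x \<in> S \<Longrightarrow> \<kappa> x v w e = G x (\<Gamma> x v w) e"
  unfolding \<kappa>_def P_eq
  by (simp add: \<Gamma>_sym[of x w v] \<Gamma>_sym[of x e v] \<Gamma>_sym[of x e w] sym[of x w] sym[of x v] field_simps)

lemma P_smooth: "smooth_on S (\<lambda>x. P x v a b)"
  by (rule smooth_on_Dh[OF S smooth])

lemma \<kappa>_smooth: "smooth_on S (\<lambda>x. \<kappa> x v w e)"
proof -
  have "smooth_on S (\<lambda>x. (P x v w e + P x w v e + (-1) * P x e v w) * (1/2))"
    by (intro smooth_on_add smooth_on_mult P_smooth smooth_on_const)
  then show ?thesis by (simp add: \<kappa>_def[abs_def])
qed

lemma \<Gamma>_differentiable:
  assumes "x \<in> S" shows "(\<lambda>y. \<Gamma> y v w) differentiable (at x within half_space)"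
proof (rule representing_vector_differentiable[OF assms, where L = "\<lambda>y. \<kappa> y v w"])
  show "(\<lambda>y. \<kappa> y v w e) differentiable (at x within half_space)" for e
    using smooth_on_has_Dh(1)[OF S assms \<kappa>_smooth] by (rule differentiableI)
qed (simp add: \<kappa>_eq)

lemma Dh_const: "x \<in> half_space \<Longrightarrow> Dh (\<lambda>_. c) x v = 0"
  using half_space_derivative_unique[OF _ has_derivative_const[of c]] by metis

text \<open>Constant fields commute, and the covariant derivative of a constant field is a
  Christoffel symbol; what remains is the coordinate formula
  \<open>D\<Gamma> + \<Gamma>\<Gamma>\<close>, antisymmetrized in \<open>v\<close> and
  \<open>w\<close>.\<close>

lemma riemann_curvature_eq:
  assumes x: "x \<in> S"
  shows "riemann_curvature G (\<lambda>_. v) (\<lambda>_. w) (\<lambda>_. z) x =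
    Dh (\<lambda>y. \<Gamma> y w z) x v + \<Gamma> x v (\<Gamma> x w z) - Dh (\<lambda>y. \<Gamma> y v z) x w - \<Gamma> x w (\<Gamma> x v z)"
proof -
  have cd: "covariant_deriv G (\<lambda>_. w) (\<lambda>_. z) y = \<Gamma> y w z" if "y \<in> S" for y w
    by (simp add: covariant_deriv_def Dh_const[OF in_half_space[OF that]])
  have "Dh (covariant_deriv G (\<lambda>_. w) (\<lambda>_. z)) x = Dh (\<lambda>y. \<Gamma> y w z) x" for w
    by (rule has_Dh_eqI(2)[OF S x Dh_has_derivative[OF \<Gamma>_differentiable[OF x]]]) (simp add: cd)
  then have "covariant_deriv G (\<lambda>_. v) (covariant_deriv G (\<lambda>_. w) (\<lambda>_. z)) x =
      Dh (\<lambda>y. \<Gamma> y w z) x v + \<Gamma> x v (\<Gamma> x w z)" for v w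
    using cd[OF x] by (simp add: covariant_deriv_def[of _ _ "covariant_deriv _ _ _"])
  moreover have "covariant_deriv G (lie_bracket (\<lambda>_. v) (\<lambda>_. w)) (\<lambda>_. z) x = 0"
    using \<Gamma>_simps(9)[OF x]
    by (simp add: covariant_deriv_def lie_bracket_def Dh_const[OF in_half_space[OF x]])
  ultimately show ?thesis by (simp add: riemann_curvature_def)
qed

text \<open>Lowering an index removes the derivatives of the Christoffel symbols in favour of derivatives
  of the smooth functions \<open>\<kappa>\<close>.\<close>

lemma riemann_lowered:
  assumes x: "x \<in> S"
  shows "G x (riemann_curvature G (\<lambda>_. v) (\<lambda>_. w) (\<lambda>_. z) x) e =
    Dh (\<lambda>y. \<kappa> y w z e) x v - Dh (\<lambda>y. \<kappa> y v z e) x w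
    - G x (\<Gamma> x w z) (\<Gamma> x v e) + G x (\<Gamma> x v z) (\<Gamma> x w e)"
proof -
  \<comment> \<open>The product rule for \<open>\<kappa> = G \<Gamma>\<close> produces
    \<open>P x v (\<Gamma> x w z) e\<close>. Metric compatibility splits it in two: one half
    accounts for the \<open>\<Gamma>\<Gamma>\<close> term of the curvature, the other is the
    quadratic term that remains.\<close>
  have "Dh (\<lambda>y. \<kappa> y w z e) x v = G x (Dh (\<lambda>y. \<Gamma> y w z) x v) e + P x v (\<Gamma> x w z) e" for v w
  proof -
    have "Dh (\<lambda>y. \<kappa> y w z e) x = (\<lambda>v. G x (Dh (\<lambda>y. \<Gamma> y w z) x v) e + P x v (\<Gamma> x w z) e)"
    proof (rule has_Dh_eqI(2)[OF S x])
      have "((\<lambda>y. G y (\<Gamma> y w z) e) has_derivative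
          (\<lambda>v. P x v (\<Gamma> x w z) e + G x (Dh (\<lambda>y. \<Gamma> y w z) x v) e)) (at x within half_space)"
        by (rule linear_field_has_derivative[OF S x lin(1) smooth_on_has_Dh(1)[OF S x smooth]
              Dh_has_derivative[OF \<Gamma>_differentiable[OF x]]])
      then show "((\<lambda>y. G y (\<Gamma> y w z) e) has_derivative
          (\<lambda>v. G x (Dh (\<lambda>y. \<Gamma> y w z) x v) e + P x v (\<Gamma> x w z) e)) (at x within half_space)"
        by (simp add: add.commute)
    qed (simp add: \<kappa>_eq)
    then show ?thesis by simp
  qed
  then show ?thesis
    by (simp add: riemann_curvature_eq[OF x] P_eq[OF x] bil_simps[OF x])
qed

end

section \<open>Conformal change of the metric\<close>

locale conformal_chart = chart_metric +
  fixes u :: "real^3 \<Rightarrow> real"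
  assumes u: "smooth_on S u"
begin

definition G' where "G' y a b = exp (2 * u y) * G y a b"

sublocale conf: chart_metric S G'
proof
  show "openin (top_of_set half_space) S" by (rule S)
  fix x a b
  show "smooth_on S (\<lambda>y. G' y a b)"
    unfolding G'_def by (intro smooth_on_mult smooth_on_exp smooth_on_const u smooth)
  assume x: "x \<in> S"
  show "bilinear (G' x)"
    unfolding bilinear_def G'_def
    by (intro conjI allI linearI) (simp_all add: bil_simps[OF x] algebra_simps)
  show "G' x a b = G' x b a" using sym[OF x] by (simp add: G'_def)
  show "0 < G' x v v" if "v \<noteq> 0" for v using pos[OF x that] by (simp add: G'_def)
qed

abbreviation \<theta> where "\<theta> x v \<equiv> Dh u x v"
abbreviation \<theta>2 where "\<theta>2 x v w \<equiv> Dh (\<lambda>y. Dh u y w) x v"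

lemma \<theta>_lin: "x \<in> S \<Longrightarrow> linear (\<theta> x)"
  by (rule has_derivative_linear[OF smooth_on_has_Dh(1)[OF S _ u]])

lemmas \<theta>_simps = linear_add[OF \<theta>_lin] linear_cmul[OF \<theta>_lin] linear_diff[OF \<theta>_lin] linear_neg[OF \<theta>_lin]

definition grad where "grad x = (SOME z. \<forall>e. G x z e = \<theta> x e)"

lemma grad: "x \<in> S \<Longrightarrow> G x (grad x) e = \<theta> x e"
  using someI_ex[OF riesz_inner[OF bil pos \<theta>_lin]] unfolding grad_def by blast

lemma grad': "x \<in> S \<Longrightarrow> G x e (grad x) = \<theta> x e"
  using grad sym by metis

lemma conf_P:
  assumes x: "x \<in> S"
  shows "conf.P x v a b = exp (2 * u x) * (2 * \<theta> x v * G x a b + P x v a b)"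
proof -
  have "((\<lambda>y. exp (2 * u y) * G y a b) has_derivative
      (\<lambda>v. exp (2 * u x) * (2 * \<theta> x v * G x a b + P x v a b))) (at x within half_space)"
    by (rule derivative_eq_intros smooth_on_has_Dh(1)[OF S x u] smooth_on_has_Dh(1)[OF S x smooth] refl)+
       (simp add: algebra_simps fun_eq_iff)
  from has_Dh_eqI(2)[OF S x this, of "\<lambda>y. G' y a b"] show ?thesis by (simp add: G'_def)
qed

text \<open>Verified rather than derived: the right-hand side is bilinear, symmetric and compatible
  with \<open>G'\<close>, and the Levi-Civita connection is unique.\<close>

lemma conf_\<Gamma>:
  assumes x: "x \<in> S"
  shows "conf.\<Gamma> x v w = \<Gamma> x v w + \<theta> x v *\<^sub>R w + \<theta> x w *\<^sub>R v - G x v w *\<^sub>R grad x"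
proof -
  have "conf.\<Gamma> x = (\<lambda>v w. \<Gamma> x v w + \<theta> x v *\<^sub>R w + \<theta> x w *\<^sub>R v - G x v w *\<^sub>R grad x)"
  proof (rule conf.christoffel_eqI[OF x], unfold levi_civita_at_def, intro conjI allI)
    show "bilinear (\<lambda>v w. \<Gamma> x v w + \<theta> x v *\<^sub>R w + \<theta> x w *\<^sub>R v - G x v w *\<^sub>R grad x)"
      unfolding bilinear_def
      by (intro conjI allI linearI)
         (simp_all add: \<Gamma>_simps[OF x] bil_simps[OF x] \<theta>_simps[OF x] algebra_simps)
  next
    fix v a b
    show "conf.P x v a b =
        G' x (\<Gamma> x v a + \<theta> x v *\<^sub>R a + \<theta> x a *\<^sub>R v - G x v a *\<^sub>R grad x) b +
        G' x a (\<Gamma> x v b + \<theta> x v *\<^sub>R b + \<theta> x b *\<^sub>R v - G x v b *\<^sub>R grad x)"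
      unfolding conf_P[OF x] unfolding P_eq[OF x] G'_def
      by (simp add: bil_simps[OF x] grad[OF x] grad'[OF x] sym[OF x, of a v] algebra_simps)
  next
    show "\<Gamma> x v w + \<theta> x v *\<^sub>R w + \<theta> x w *\<^sub>R v - G x v w *\<^sub>R grad x =
        \<Gamma> x w v + \<theta> x w *\<^sub>R v + \<theta> x v *\<^sub>R w - G x w v *\<^sub>R grad x" for v w
      by (simp add: \<Gamma>_sym[OF x, of v w] sym[OF x, of v w])
  qed
  then show ?thesis by simp
qed

text \<open>In lowered form the new symbols are built from \<open>u\<close>, its differential, the
  metric and the old lowered symbols. The gradient does not occur, so the product rule alone gives
  their derivatives.\<close>

lemma conf_\<kappa>:
  assumes x: "x \<in> S"
  shows "conf.\<kappa> x w z e = exp (2 * u x) *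
    (\<kappa> x w z e + \<theta> x w * G x z e + \<theta> x z * G x w e - G x w z * \<theta> x e)"
  unfolding conf.\<kappa>_def \<kappa>_def conf_P[OF x]
  by (simp add: sym[OF x, of z w] sym[OF x, of e w] sym[OF x, of e z] field_simps)

lemma conf_\<kappa>_deriv:
  assumes x: "x \<in> S"
  shows "Dh (\<lambda>y. conf.\<kappa> y w z e) x v = exp (2 * u x) *
    (2 * \<theta> x v * (\<kappa> x w z e + \<theta> x w * G x z e + \<theta> x z * G x w e - G x w z * \<theta> x e) +
     Dh (\<lambda>y. \<kappa> y w z e) x v + \<theta>2 x v w * G x z e + \<theta> x w * P x v z e +
     \<theta>2 x v z * G x w e + \<theta> x z * P x v w e - P x v w z * \<theta> x e - G x w z * \<theta>2 x v e)"
proof -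
  have "((\<lambda>y. exp (2 * u y) * (\<kappa> y w z e + \<theta> y w * G y z e + \<theta> y z * G y w e - G y w z * \<theta> y e))
      has_derivative (\<lambda>v. exp (2 * u x) *
    (2 * \<theta> x v * (\<kappa> x w z e + \<theta> x w * G x z e + \<theta> x z * G x w e - G x w z * \<theta> x e) +
     Dh (\<lambda>y. \<kappa> y w z e) x v + \<theta>2 x v w * G x z e + \<theta> x w * P x v z e +
     \<theta>2 x v z * G x w e + \<theta> x z * P x v w e - P x v w z * \<theta> x e - G x w z * \<theta>2 x v e)))
     (at x within half_space)"
    by (rule derivative_eq_intros smooth_on_has_Dh(1)[OF S x u] smooth_on_has_Dh(1)[OF S x smooth]
          smooth_on_has_Dh(1)[OF S x \<kappa>_smooth] smooth_on_has_Dh(1)[OF S x smooth_on_Dh[OF S u]] refl)+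
       (simp add: algebra_simps fun_eq_iff)
  from has_Dh_eqI(2)[OF S x this, of "\<lambda>y. conf.\<kappa> y w z e"] show ?thesis
    by (simp add: conf_\<kappa>)
qed

text \<open>The covariant Hessian of \<open>u\<close> minus the tensor square of \<open>du\<close>,
  the correction term in the classical formula for the curvature of a conformal metric.\<close>

definition T where "T x v w = \<theta>2 x v w - \<theta> x (\<Gamma> x v w) - \<theta> x v * \<theta> x w"

text \<open>The classical formula \<open>R' = exp (2 u) (R - g \<and> (T + |du|^2 g / 2))\<close>,
  with \<open>\<and>\<close> the Kulkarni-Nomizu product, evaluated on \<open>(v, w, w, v)\<close>;
  the last summand becomes the Gram determinant. Both curvatures are taken in lowered form, after
  which a polynomial identity is left.\<close>

lemma conformal_curvature:
  assumes x: "x \<in> S"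
  shows "G' x (riemann_curvature G' (\<lambda>_. v) (\<lambda>_. w) (\<lambda>_. w) x) v = exp (2 * u x) *
    (G x (riemann_curvature G (\<lambda>_. v) (\<lambda>_. w) (\<lambda>_. w) x) v
     - (G x w w * T x v v + G x v v * T x w w - 2 * G x v w * T x v w)
     - \<theta> x (grad x) * (G x v v * G x w w - (G x v w)\<^sup>2))"
proof -
  have s: "\<theta>2 x w v = \<theta>2 x v w" by (rule Dh_symmetric[OF S x u])
  have G_sym: "G x v (\<Gamma> x a b) = G x (\<Gamma> x a b) v" "G x w (\<Gamma> x a b) = G x (\<Gamma> x a b) w" for a b
    using sym[OF x] by auto
  show ?thesis
    unfolding conf.riemann_lowered[OF x] riemann_lowered[OF x] conf_\<kappa>_deriv[OF x] conf_\<Gamma>[OF x] T_def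
    unfolding G'_def P_eq[OF x] \<kappa>_eq[OF x]
    by (simp only: bil_simps[OF x] grad[OF x] grad'[OF x] \<theta>_simps[OF x] real_scaleR_def
        s \<Gamma>_sym[OF x, of w v] sym[OF x, of w v] G_sym)
       (simp add: algebra_simps power2_eq_square)
qed

end

section \<open>Negative curvature over compact sets in a chart\<close>

lemma continuous_on_linear_apply:
  fixes L :: "'a::topological_space \<Rightarrow> real^3 \<Rightarrow> real"
  assumes "\<And>p. p \<in> D \<Longrightarrow> linear (L p)" "\<And>a. continuous_on D (\<lambda>p. L p a)" "continuous_on D V"
  shows "continuous_on D (\<lambda>p. L p (V p))"
proof -
  have "continuous_on D (\<lambda>p. \<Sum>i\<in>UNIV. V p $ i *\<^sub>R L p (axis i 1))"
    by (intro continuous_intros assms)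
  then show ?thesis
    by (rule continuous_on_eq) (rule linear_vec3_expansion[OF assms(1), symmetric])
qed

text \<open>The tensors which depend only on the bivectors \<open>a \<and> b\<close> and \<open>c \<and> d\<close>.\<close>

definition biform_on :: "(real^3) set \<Rightarrow> (real^3 \<Rightarrow> real^3 \<Rightarrow> real^3 \<Rightarrow> real^3 \<Rightarrow> real^3 \<Rightarrow> real) \<Rightarrow> bool" where
  "biform_on S f \<longleftrightarrow> (\<forall>x\<in>S. \<forall>a b c d.
      linear (\<lambda>a. f x a b c d) \<and> linear (\<lambda>b. f x a b c d) \<and>
      linear (\<lambda>c. f x a b c d) \<and> linear (\<lambda>d. f x a b c d) \<and>
      f x a a c d = 0 \<and> f x a b c c = 0) \<and>
    (\<forall>a b c d. continuous_on S (\<lambda>x. f x a b c d))"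

text \<open>Joint continuity in the point and both vectors: the four slots are filled one after
  another, and linearity in a slot preserves continuity when it is filled.\<close>

lemma biform_on_continuous:
  assumes f: "biform_on S f" and D: "D \<subseteq> S \<times> UNIV"
  shows "continuous_on D (\<lambda>(x, v, w). f x v w w v)"
proof -
  have x: "fst p \<in> S" if "p \<in> D" for p using D that by auto
  have V: "continuous_on D (\<lambda>p. fst (snd p))" "continuous_on D (\<lambda>p. snd (snd p))"
    by (intro continuous_intros)+
  have "continuous_on S (\<lambda>x. f x a b c d)" for a b c d
    using f by (simp add: biform_on_def)
  then have "continuous_on D (\<lambda>p. f (fst p) a b c d)" for a b c d
    by (rule continuous_on_compose2[OF _ continuous_on_fst[OF continuous_on_id]]) (use D in auto)
  then have "continuous_on D (\<lambda>p. f (fst p) (fst (snd p)) b c d)" for b c d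
    by (rule continuous_on_linear_apply[rotated, OF _ V(1), of "\<lambda>p a. f (fst p) a b c d"])
       (use f x in \<open>simp add: biform_on_def\<close>)
  then have "continuous_on D (\<lambda>p. f (fst p) (fst (snd p)) (snd (snd p)) c d)" for c d
    by (rule continuous_on_linear_apply[rotated, OF _ V(2), of "\<lambda>p b. f (fst p) (fst (snd p)) b c d"])
       (use f x in \<open>simp add: biform_on_def\<close>)
  then have "continuous_on D (\<lambda>p. f (fst p) (fst (snd p)) (snd (snd p)) (snd (snd p)) d)" for d
    by (rule continuous_on_linear_apply[rotated, OF _ V(2),
          of "\<lambda>p c. f (fst p) (fst (snd p)) (snd (snd p)) c d"])
       (use f x in \<open>simp add: biform_on_def\<close>)
  then have "continuous_on D (\<lambda>p. f (fst p) (fst (snd p)) (snd (snd p)) (snd (snd p)) (fst (snd p)))"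
    by (rule continuous_on_linear_apply[rotated, OF _ V(1),
          of "\<lambda>p d. f (fst p) (fst (snd p)) (snd (snd p)) (snd (snd p)) d"])
       (use f x in \<open>simp add: biform_on_def\<close>)
  then show ?thesis by (simp add: case_prod_beta)
qed

text \<open>By Gram-Schmidt it suffices to compare on pairs that are orthonormal for the Euclidean metric,
  which range over a compact set.\<close>

lemma biform_on_bound:
  assumes f: "biform_on S f" and Q: "biform_on S Q"
    and Qpos: "\<And>x v w. x \<in> S \<Longrightarrow> (\<And>r s. r *\<^sub>R v + s *\<^sub>R w = 0 \<Longrightarrow> r = 0 \<and> s = 0) \<Longrightarrow> 0 < Q x v w w v"
    and K: "compact K" "K \<subseteq> S"
  obtains C where "0 \<le> C" "\<And>x v w. x \<in> K \<Longrightarrow> \<bar>f x v w w v\<bar> \<le> C * Q x v w w v"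
proof -
  define D :: "((real^3) \<times> (real^3) \<times> (real^3)) set"
    where "D = (K \<times> sphere 0 1 \<times> sphere 0 1) \<inter> {p. fst (snd p) \<bullet> snd (snd p) = 0}"
  have D: "D \<subseteq> S \<times> UNIV" using K by (auto simp: D_def)
  have "compact D"
    unfolding D_def
    by (intro compact_Int_closed compact_Times K compact_sphere closed_Collect_eq continuous_intros)
  have pos: "0 < Q x v w w v" if p: "(x, v, w) \<in> D" for x v w
  proof (rule Qpos)
    show "x \<in> S" using p K by (auto simp: D_def)
    fix r s assume e: "r *\<^sub>R v + s *\<^sub>R w = 0"
    have o: "v \<bullet> v = 1" "w \<bullet> w = 1" "v \<bullet> w = 0" using p by (auto simp: D_def norm_eq_1)
    have "(r *\<^sub>R v + s *\<^sub>R w) \<bullet> v = r" "(r *\<^sub>R v + s *\<^sub>R w) \<bullet> w = s"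
      using o by (simp_all add: inner_add_left inner_commute[of w v])
    then show "r = 0 \<and> s = 0" by (metis e inner_zero_left)
  qed
  have "continuous_on D (\<lambda>p. (\<lambda>(x, v, w). f x v w w v) p / (\<lambda>(x, v, w). Q x v w w v) p)"
    by (intro continuous_on_divide biform_on_continuous[OF f D] biform_on_continuous[OF Q D])
       (use pos in force)
  then have "bounded ((\<lambda>p. (\<lambda>(x, v, w). f x v w w v) p / (\<lambda>(x, v, w). Q x v w w v) p) ` D)"
    using \<open>compact D\<close> compact_continuous_image compact_imp_bounded by blast
  then obtain C where C: "\<forall>p\<in>D. \<bar>(\<lambda>(x, v, w). f x v w w v) p / (\<lambda>(x, v, w). Q x v w w v) p\<bar> \<le> C"
    by (auto simp: bounded_iff)
  \<comment> \<open>An empty \<open>D\<close> puts no lower bound on \<open>C\<close>;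
    \<open>max C 0\<close> is a nonnegative constant in every case.\<close>
  have main: "\<bar>f x v w w v\<bar> \<le> max C 0 * Q x v w w v" if x: "x \<in> K" for x v w
  proof -
    have lin: "linear (\<lambda>a. h x a b c d)" "linear (\<lambda>b. h x a b c d)"
      "linear (\<lambda>c. h x a b c d)" "linear (\<lambda>d. h x a b c d)" "h x a a c d = 0" "h x a b c c = 0"
      if "biform_on S h" for h a b c d
      using that x K by (auto simp: biform_on_def)
    have zero: "h x 0 w w 0 = 0" if "biform_on S h" for h using linear_0[OF lin(1)[OF that]] .
    show ?thesis
    proof (cases "v = 0")
      case True
      then show ?thesis using zero[OF f] zero[OF Q] by simp
    next
      case v: False
      define v1 where "v1 = v /\<^sub>R norm v"
      define a where "a = w \<bullet> v1"
      define w' where "w' = w - a *\<^sub>R v1"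
      define w1 where "w1 = w' /\<^sub>R norm w'"
      have v1: "norm v1 = 1" and ve: "v = norm v *\<^sub>R v1" using v by (simp_all add: v1_def)
      have "norm w' *\<^sub>R w1 = w'" by (cases "w' = 0") (simp_all add: w1_def)
      then have we: "w = a *\<^sub>R v1 + norm w' *\<^sub>R w1" by (simp add: w'_def)
      \<comment> \<open>Alternation kills the component of \<open>w\<close> along \<open>v\<close>,
        so both tensors scale by the squared area of the parallelogram and their ratio depends only
        on the orthonormal pair.\<close>
      have scale: "h x v w w v = (norm v * norm w')\<^sup>2 * h x v1 w1 w1 v1" if h: "biform_on S h" for h
      proof -
        note l = lin[OF h]
        have "h x v w w v = h x (norm v *\<^sub>R v1) (a *\<^sub>R v1 + norm w' *\<^sub>R w1)
            (a *\<^sub>R v1 + norm w' *\<^sub>R w1) (norm v *\<^sub>R v1)" using ve we by simp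
        also have "\<dots> = (norm v * norm w')\<^sup>2 * h x v1 w1 w1 v1"
          by (simp add: linear_add[OF l(2)] linear_add[OF l(3)] linear_cmul[OF l(1)] linear_cmul[OF l(2)]
              linear_cmul[OF l(3)] linear_cmul[OF l(4)] l(5) l(6) power2_eq_square)
        finally show ?thesis .
      qed
      show ?thesis
      proof (cases "w' = 0")
        case True
        then show ?thesis using scale[OF f] scale[OF Q] by simp
      next
        case False
        have "w' \<bullet> v1 = 0" using v1 by (simp add: w'_def a_def inner_diff_left norm_eq_1)
        then have "(x, v1, w1) \<in> D"
          using x v1 False by (simp add: D_def w1_def inner_commute)
        from bspec[OF C this] pos[OF this] have "\<bar>f x v1 w1 w1 v1\<bar> \<le> C * Q x v1 w1 w1 v1" "0 < Q x v1 w1 w1 v1"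
          by (simp_all add: field_simps)
        then have "\<bar>f x v1 w1 w1 v1\<bar> \<le> max C 0 * Q x v1 w1 w1 v1"
          by (smt (verit) mult_right_mono)
        from mult_left_mono[OF this zero_le_power2[of "norm v * norm w'"]] show ?thesis
          unfolding scale[OF f] scale[OF Q] by (simp only: abs_mult abs_power2 ac_simps)
      qed
    qed
  qed
  show thesis by (rule that[of "max C 0"]) (use main in auto)
qed

section \<open>The curvature and the Gram determinant as alternating tensors\<close>

context chart_metric
begin

lemma continuous_on_if_differentiable:
  assumes "\<And>x. x \<in> S \<Longrightarrow> f differentiable (at x within half_space)"
  shows "continuous_on S f"
  unfolding continuous_on_eq_continuous_within
  using assms differentiable_imp_continuous_within at_within_relopen[OF S] by metis

lemma Dh_linear_parameter:
  assumes x: "x \<in> S" and F: "\<And>y. y \<in> S \<Longrightarrow> linear (F y)" "\<And>a. smooth_on S (\<lambda>y. F y a :: real)"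
  shows "linear (\<lambda>a. Dh (\<lambda>y. F y a) x v)"
proof (rule linearI)
  fix a b
  have "((\<lambda>y. F y a + F y b) has_derivative (\<lambda>v. Dh (\<lambda>y. F y a) x v + Dh (\<lambda>y. F y b) x v))
      (at x within half_space)"
    by (intro has_derivative_add smooth_on_has_Dh(1)[OF S x F(2)])
  from has_Dh_eqI(2)[OF S x this, of "\<lambda>y. F y (a + b)"]
  show "Dh (\<lambda>y. F y (a + b)) x v = Dh (\<lambda>y. F y a) x v + Dh (\<lambda>y. F y b) x v"
    using linear_add[OF F(1)] by simp
next
  fix r a
  have "((\<lambda>y. r *\<^sub>R F y a) has_derivative (\<lambda>v. r *\<^sub>R Dh (\<lambda>y. F y a) x v)) (at x within half_space)"
    by (intro has_derivative_scaleR_right smooth_on_has_Dh(1)[OF S x F(2)])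
  from has_Dh_eqI(2)[OF S x this, of "\<lambda>y. F y (r *\<^sub>R a)"]
  show "Dh (\<lambda>y. F y (r *\<^sub>R a)) x v = r *\<^sub>R Dh (\<lambda>y. F y a) x v"
    using linear_cmul[OF F(1)] by simp
qed

lemma \<Gamma>_continuous: "continuous_on S (\<lambda>x. \<Gamma> x v w)"
  by (rule continuous_on_if_differentiable[OF \<Gamma>_differentiable])

lemma linear_in_metric:
  assumes "x \<in> S" "linear h" shows "linear (\<lambda>a. G x (h a) b)" "linear (\<lambda>a. G x b (h a))"
  using linear_compose[OF assms(2) lin(1)[OF assms(1)]] linear_compose[OF assms(2) lin(2)[OF assms(1)]]
  by (simp_all add: o_def)

lemma \<Gamma>_lin: "x \<in> S \<Longrightarrow> linear (\<Gamma> x v)" "x \<in> S \<Longrightarrow> linear (\<lambda>v. \<Gamma> x v w)"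
  using \<Gamma>_bil by (auto simp: bilinear_def)

lemma \<kappa>_lin:
  assumes "x \<in> S"
  shows "linear (\<lambda>v. \<kappa> x v w e)" "linear (\<lambda>w. \<kappa> x v w e)" "linear (\<kappa> x v w)"
proof -
  have "\<kappa> x v w = G x (\<Gamma> x v w)" using \<kappa>_eq[OF assms] by blast
  then show "linear (\<kappa> x v w)" using lin(2)[OF assms] by simp
qed (use linear_in_metric(1)[OF assms \<Gamma>_lin(1)[OF assms]] linear_in_metric(1)[OF assms \<Gamma>_lin(2)[OF assms]]
    in \<open>simp_all add: \<kappa>_eq[OF assms]\<close>)

text \<open>The fully lowered curvature in the form given by \<open>riemann_lowered\<close>, in
  which linearity and continuity can be checked term by term.\<close>

abbreviation Rm where
  "Rm x v w z e \<equiv> Dh (\<lambda>y. \<kappa> y w z e) x v - Dh (\<lambda>y. \<kappa> y v z e) x w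
    - G x (\<Gamma> x w z) (\<Gamma> x v e) + G x (\<Gamma> x v z) (\<Gamma> x w e)"

text \<open>Antisymmetry in the first pair is read off. In the second pair it comes from metric
  compatibility: \<open>\<kappa> b c c\<close> is half the derivative of \<open>G c c\<close> along
  \<open>b\<close>, so the derivative terms are mixed second derivatives of one function and
  cancel.\<close>

lemma biform_curvature: "biform_on S Rm"
  unfolding biform_on_def
proof (intro conjI ballI allI)
  fix x a b c d assume x: "x \<in> S"
  have D1: "linear (\<lambda>a. Dh (\<lambda>y. \<kappa> y b c d) x a)" for b c d
    by (rule has_derivative_linear[OF smooth_on_has_Dh(1)[OF S x \<kappa>_smooth]])
  have D2: "linear (\<lambda>a. Dh (\<lambda>y. \<kappa> y a c d) x e)" "linear (\<lambda>a. Dh (\<lambda>y. \<kappa> y b a d) x e)"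
    "linear (\<lambda>a. Dh (\<lambda>y. \<kappa> y b c a) x e)" for b c d e
    by (intro Dh_linear_parameter[OF x] \<kappa>_lin \<kappa>_smooth; assumption)+
  note l = D1 D2 linear_in_metric[OF x \<Gamma>_lin(1)[OF x]] linear_in_metric[OF x \<Gamma>_lin(2)[OF x]]
  show "linear (\<lambda>a. Rm x a b c d)" "linear (\<lambda>b. Rm x a b c d)" "linear (\<lambda>c. Rm x a b c d)" "linear (\<lambda>d. Rm x a b c d)"
    by (intro linear_compose_add linear_compose_sub l)+
  show "Rm x a a c d = 0" by simp
  have half: "(\<lambda>y. \<kappa> y b c c) = (\<lambda>y. P y b c c * (1/2))" for b by (simp add: \<kappa>_def fun_eq_iff)
  have "Dh (\<lambda>y. \<kappa> y b c c) x a = Dh (\<lambda>y. P y b c c) x a * (1/2)" for a b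
    unfolding half by (rule Dh_linear_compose[OF S x P_smooth bounded_linear_mult_left])
  moreover have "Dh (\<lambda>y. P y b c c) x a = Dh (\<lambda>y. P y a c c) x b"
    by (rule Dh_symmetric[OF S x smooth])
  ultimately have "Dh (\<lambda>y. \<kappa> y b c c) x a = Dh (\<lambda>y. \<kappa> y a c c) x b"
    by metis
  then show "Rm x a b c c = 0" using sym[OF x] by simp
next
  fix a b c d
  have "continuous_on S (\<lambda>x. G x (\<Gamma> x a b) (\<Gamma> x c d))" for a b c d
  proof -
    have "continuous_on S (\<lambda>x. \<kappa> x a b (\<Gamma> x c d))"
      by (rule continuous_on_linear_apply[OF \<kappa>_lin(3) smooth_on_imp_continuous_on[OF \<kappa>_smooth] \<Gamma>_continuous])
    then show ?thesis
      by (rule continuous_on_eq) (rule \<kappa>_eq)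
  qed
  then show "continuous_on S (\<lambda>x. Rm x a b c d)"
    by (intro continuous_intros smooth_on_imp_continuous_on[OF smooth_on_Dh[OF S \<kappa>_smooth]])
qed

text \<open>The Kulkarni-Nomizu product of \<open>G\<close> with a symmetric form \<open>H\<close>.
  With the Hessian for \<open>H\<close> it gives the Hessian term of the curvature formula; with
  \<open>G\<close> for \<open>H\<close> it gives twice the Gram determinant.\<close>

lemma biform_kulkarni_nomizu:
  assumes H: "\<And>x. x \<in> S \<Longrightarrow> bilinear (H x)" "\<And>x a b. x \<in> S \<Longrightarrow> H x a b = H x b a"
    "\<And>a b. continuous_on S (\<lambda>x. H x a b)"
  shows "biform_on S (\<lambda>x a b c d. G x b c * H x a d + G x a d * H x b c - G x a c * H x b d - G x b d * H x a c)"
  unfolding biform_on_def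
proof (intro conjI ballI allI)
  fix x a b c d assume x: "x \<in> S"
  note b = bil_simps[OF x] bilinear_ladd[OF H(1)[OF x]] bilinear_radd[OF H(1)[OF x]]
    bilinear_lmul[OF H(1)[OF x]] bilinear_rmul[OF H(1)[OF x]]
  let ?f = "\<lambda>a b c d. G x b c * H x a d + G x a d * H x b c - G x a c * H x b d - G x b d * H x a c"
  show "linear (\<lambda>a. ?f a b c d)" "linear (\<lambda>b. ?f a b c d)" "linear (\<lambda>c. ?f a b c d)" "linear (\<lambda>d. ?f a b c d)"
    by (rule linearI; simp add: b algebra_simps)+
  show "?f a a c d = 0" "?f a b c c = 0" by simp_all
qed (intro continuous_intros H(3) smooth_on_imp_continuous_on[OF smooth])

text \<open>Strict Cauchy-Schwarz: positivity is applied to \<open>G v v\<close> times the component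
  of \<open>w\<close> orthogonal to \<open>v\<close>.\<close>

lemma gram_pos:
  assumes x: "x \<in> S" and indep: "\<And>r s. r *\<^sub>R v + s *\<^sub>R w = 0 \<Longrightarrow> r = 0 \<and> s = 0"
  shows "0 < G x v v * G x w w - (G x v w)\<^sup>2"
proof -
  have "v \<noteq> 0" using indep[of 1 0] by auto
  then have v: "0 < G x v v" by (rule pos[OF x])
  have "(- G x v w) *\<^sub>R v + G x v v *\<^sub>R w \<noteq> 0" using indep v by fastforce
  from pos[OF x this] have "0 < G x v v * (G x v v * G x w w - (G x v w)\<^sup>2)"
    by (simp add: bil_simps[OF x] sym[OF x, of w v] algebra_simps power2_eq_square)
  then show ?thesis using v by (simp add: zero_less_mult_iff)
qed

end

section \<open>Gradient and Hessian of the conformal exponent\<close>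

context conformal_chart
begin

lemma grad_differentiable: "x \<in> S \<Longrightarrow> grad differentiable (at x within half_space)"
  by (rule representing_vector_differentiable[where L = \<theta>])
     (auto intro: differentiableI[OF smooth_on_has_Dh(1)[OF S _ smooth_on_Dh[OF S u]]] grad)

lemma grad_norm_continuous: "continuous_on S (\<lambda>x. \<theta> x (grad x))"
  by (rule continuous_on_linear_apply[OF \<theta>_lin smooth_on_imp_continuous_on[OF smooth_on_Dh[OF S u]]
        continuous_on_if_differentiable[OF grad_differentiable]])

lemma grad_norm_pos:
  assumes x: "x \<in> S" and "\<theta> x v \<noteq> 0"
  shows "0 < \<theta> x (grad x)"
proof -
  have "grad x \<noteq> 0" using assms grad[OF x, of v] bil_simps(9)[OF x] by auto
  from pos[OF x this] show ?thesis by (simp add: grad[OF x])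
qed

text \<open>The covariant Hessian, that is \<open>T\<close> without its quadratic term. It will be
  formed for \<open>\<phi>\<close>, whereas \<open>T\<close> will be formed for the exponential of a
  multiple of \<open>\<phi>\<close>.\<close>

definition hess where "hess x v w = \<theta>2 x v w - \<theta> x (\<Gamma> x v w)"

lemma hess_bilinear: "x \<in> S \<Longrightarrow> bilinear (hess x)"
proof -
  assume x: "x \<in> S"
  have "linear (\<lambda>w. \<theta>2 x v w)" for v
    by (rule Dh_linear_parameter[OF x \<theta>_lin smooth_on_Dh[OF S u]])
  moreover have "linear (\<lambda>v. \<theta>2 x v w)" for w
    by (rule has_derivative_linear[OF smooth_on_has_Dh(1)[OF S x smooth_on_Dh[OF S u]]])
  moreover have "linear (\<lambda>w. \<theta> x (\<Gamma> x v w))" "linear (\<lambda>v. \<theta> x (\<Gamma> x v w))" for v w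
    using linear_compose[OF \<Gamma>_lin(1)[OF x] \<theta>_lin[OF x]] linear_compose[OF \<Gamma>_lin(2)[OF x] \<theta>_lin[OF x]]
    by (simp_all add: o_def)
  ultimately show "bilinear (hess x)"
    unfolding bilinear_def hess_def by (auto intro!: linear_compose_sub)
qed

lemma hess_sym: "x \<in> S \<Longrightarrow> hess x v w = hess x w v"
  using Dh_symmetric[OF S _ u] \<Gamma>_sym by (simp add: hess_def)

lemma hess_continuous: "continuous_on S (\<lambda>x. hess x v w)"
  unfolding hess_def
  by (intro continuous_on_diff smooth_on_imp_continuous_on[OF smooth_on_Dh[OF S smooth_on_Dh[OF S u]]]
      continuous_on_linear_apply[OF \<theta>_lin smooth_on_imp_continuous_on[OF smooth_on_Dh[OF S u]] \<Gamma>_continuous])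

text \<open>This is the nonnegativity of the Gram determinant of the gradient, \<open>v\<close> and \<open>w\<close>.\<close>

lemma grad_gram:
  assumes x: "x \<in> S" and Q: "0 < G x v v * G x w w - (G x v w)\<^sup>2"
  shows "G x w w * (\<theta> x v)\<^sup>2 + G x v v * (\<theta> x w)\<^sup>2 - 2 * G x v w * (\<theta> x v * \<theta> x w) \<le>
    \<theta> x (grad x) * (G x v v * G x w w - (G x v w)\<^sup>2)"
proof -
  define a where "a = G x v v"
  define b where "b = G x v w"
  define d where "d = G x w w"
  define \<alpha> where "\<alpha> = \<theta> x v"
  define \<beta> where "\<beta> = \<theta> x w"
  define m where "m = \<theta> x (grad x)"
  \<comment> \<open>The Gram determinant times the component of the gradient orthogonal to the
    plane; the coefficients of \<open>v\<close> and \<open>w\<close> come from solving the normal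
    equations by Cramer's rule.\<close>
  let ?y = "(a * d - b\<^sup>2) *\<^sub>R grad x - (\<alpha> * d - \<beta> * b) *\<^sub>R v - (\<beta> * a - \<alpha> * b) *\<^sub>R w"
  have "0 \<le> G x y y" for y
    using pos[OF x, of y] bil_simps(9)[OF x, of y] by (cases "y = 0") auto
  then have "0 \<le> G x ?y ?y" .
  also have "G x ?y ?y = (a * d - b\<^sup>2) * (m * (a * d - b\<^sup>2) - (d * \<alpha>\<^sup>2 + a * \<beta>\<^sup>2 - 2 * b * (\<alpha> * \<beta>)))"
    by (simp only: bil_simps[OF x] grad[OF x] grad'[OF x] \<theta>_simps[OF x] sym[OF x, of w v] real_scaleR_def
        flip: a_def b_def d_def \<alpha>_def \<beta>_def m_def) algebra
  finally show ?thesis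
    using Q by (simp add: zero_le_mult_iff a_def b_def d_def \<alpha>_def \<beta>_def m_def)
qed

end

section \<open>The estimate for an exponential conformal exponent\<close>

context chart_metric
begin

lemma Dh_exp_scaled:
  fixes \<phi> :: "real^3 \<Rightarrow> real"
  assumes x: "x \<in> S" and \<phi>: "smooth_on S \<phi>"
  shows "Dh (\<lambda>y. exp (l * \<phi> y)) x v = l * exp (l * \<phi> x) * Dh \<phi> x v"
    and "Dh (\<lambda>y. Dh (\<lambda>y. exp (l * \<phi> y)) y w) x v =
      l * exp (l * \<phi> x) * Dh (\<lambda>y. Dh \<phi> y w) x v + l\<^sup>2 * exp (l * \<phi> x) * (Dh \<phi> x v * Dh \<phi> x w)"
proof -
  have d: "((\<lambda>y. exp (l * \<phi> y)) has_derivative (\<lambda>v. l * exp (l * \<phi> y) * Dh \<phi> y v)) (at y within half_space)"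
    if "y \<in> S" for y
  proof -
    have "((\<lambda>y. l * \<phi> y) has_derivative (\<lambda>v. l * Dh \<phi> y v)) (at y within half_space)"
      by (rule has_derivative_mult_right[OF smooth_on_has_Dh(1)[OF S that \<phi>]])
    from DERIV_compose_FDERIV[OF DERIV_exp this] show ?thesis by (simp add: mult.commute mult.left_commute)
  qed
  have 1: "Dh (\<lambda>y. exp (l * \<phi> y)) y v = l * exp (l * \<phi> y) * Dh \<phi> y v" if "y \<in> S" for y v
    using half_space_derivative_unique[OF in_half_space[OF that] d[OF that]] by simp
  then show "Dh (\<lambda>y. exp (l * \<phi> y)) x v = l * exp (l * \<phi> x) * Dh \<phi> x v" using x .
  have "((\<lambda>y. l * exp (l * \<phi> y) * Dh \<phi> y w) has_derivative (\<lambda>v. l * exp (l * \<phi> x) * Dh (\<lambda>y. Dh \<phi> y w) x v +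
      l\<^sup>2 * exp (l * \<phi> x) * (Dh \<phi> x v * Dh \<phi> x w))) (at x within half_space)"
    by (rule derivative_eq_intros d[OF x] smooth_on_has_Dh(1)[OF S x \<phi>]
        smooth_on_has_Dh(1)[OF S x smooth_on_Dh[OF S \<phi>]] refl)+
       (simp add: fun_eq_iff algebra_simps power2_eq_square)
  from has_Dh_eqI(2)[OF S x this 1[symmetric]]
  show "Dh (\<lambda>y. Dh (\<lambda>y. exp (l * \<phi> y)) y w) x v =
      l * exp (l * \<phi> x) * Dh (\<lambda>y. Dh \<phi> y w) x v + l\<^sup>2 * exp (l * \<phi> x) * (Dh \<phi> x v * Dh \<phi> x w)"
    by simp
qed

theorem conformal_negative_curvature:
  assumes K: "compact K" "K \<subseteq> S" and \<phi>: "smooth_on S \<phi>"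
    and nonneg: "\<And>x. x \<in> K \<Longrightarrow> 0 \<le> \<phi> x" and regular: "\<And>x. x \<in> K \<Longrightarrow> \<exists>v. Dh \<phi> x v \<noteq> 0"
  shows "\<exists>l\<^sub>0. \<forall>l x v w. l\<^sub>0 \<le> l \<longrightarrow> x \<in> K \<longrightarrow>
    (\<forall>r s. r *\<^sub>R v + s *\<^sub>R w = 0 \<longrightarrow> r = 0 \<and> s = 0) \<longrightarrow>
    sectional_in_chart (\<lambda>y a b. exp (2 * exp (l * \<phi> y)) * G y a b) x v w < 0"
proof -
  interpret f: conformal_chart S G \<phi> by unfold_locales (rule \<phi>)
  let ?Q = "\<lambda>x a b c d. G x b c * G x a d - G x a c * G x b d"
  let ?H = "\<lambda>x a b c d. G x b c * f.hess x a d + G x a d * f.hess x b c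
    - G x a c * f.hess x b d - G x b d * f.hess x a c"
  have H: "biform_on S ?H"
    by (rule biform_kulkarni_nomizu[OF f.hess_bilinear f.hess_sym f.hess_continuous])
  \<comment> \<open>The product of \<open>G\<close> with itself is twice the Gram form, so the
    bounds are obtained against twice \<open>?Q\<close>; this is the origin of the factors 2 in
    \<open>C\<close>.\<close>
  have "biform_on S (\<lambda>x a b c d. G x b c * G x a d + G x a d * G x b c - G x a c * G x b d - G x b d * G x a c)"
    by (rule biform_kulkarni_nomizu[OF bil sym smooth_on_imp_continuous_on[OF smooth]])
  moreover have "(\<lambda>x a b c d. G x b c * G x a d + G x a d * G x b c - G x a c * G x b d - G x b d * G x a c) =
      (\<lambda>x a b c d. ?Q x a b c d + ?Q x a b c d)"
    by (intro ext) simp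
  ultimately have Q2: "biform_on S (\<lambda>x a b c d. ?Q x a b c d + ?Q x a b c d)" by simp
  have Q2pos: "0 < ?Q x v w w v + ?Q x v w w v"
    if "x \<in> S" "\<And>r s. r *\<^sub>R v + s *\<^sub>R w = 0 \<Longrightarrow> r = 0 \<and> s = 0" for x v w
    using gram_pos[OF that] sym[OF that(1), of w v] by (simp add: power2_eq_square mult.commute)
  obtain C1 where C1: "0 \<le> C1" "\<And>x v w. x \<in> K \<Longrightarrow> \<bar>Rm x v w w v\<bar> \<le> C1 * (?Q x v w w v + ?Q x v w w v)"
    using biform_on_bound[OF biform_curvature Q2 Q2pos K] by blast
  obtain C2 where C2: "0 \<le> C2" "\<And>x v w. x \<in> K \<Longrightarrow> \<bar>?H x v w w v\<bar> \<le> C2 * (?Q x v w w v + ?Q x v w w v)"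
    using biform_on_bound[OF H Q2 Q2pos K] by blast
  define C where "C = 2 * C1 + 2 * C2"
  obtain c where c: "0 < c" "\<And>x. x \<in> K \<Longrightarrow> c \<le> Dh \<phi> x (f.grad x)"
  proof (cases "K = {}")
    case False
    obtain x0 where x0: "x0 \<in> K" "\<And>x. x \<in> K \<Longrightarrow> Dh \<phi> x0 (f.grad x0) \<le> Dh \<phi> x (f.grad x)"
      using continuous_attains_inf[OF K(1) False continuous_on_subset[OF f.grad_norm_continuous K(2)]] by blast
    moreover have "0 < Dh \<phi> x0 (f.grad x0)" using regular[OF x0(1)] f.grad_norm_pos K x0(1) by blast
    ultimately show ?thesis using that by blast
  qed (use that[of 1] in auto)
  \<comment> \<open>One \<open>C\<close> absorbs the Hessian term, the other the original curvature,
    and the remaining 1 gives strict negativity; \<open>1 \<le> l\<close> ensures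
    \<open>1 \<le> l * U\<close>.\<close>
  define l\<^sub>0 where "l\<^sub>0 = max 1 ((2 * C + 1) / c)"
  show ?thesis
  proof (intro exI[of _ l\<^sub>0] allI impI)
    fix l x and v w :: "real^3"
    assume l: "l\<^sub>0 \<le> l" and x: "x \<in> K"
      and "\<forall>r s. r *\<^sub>R v + s *\<^sub>R w = 0 \<longrightarrow> r = 0 \<and> s = 0"
    then have indep: "\<And>r s. r *\<^sub>R v + s *\<^sub>R w = 0 \<Longrightarrow> r = 0 \<and> s = 0" by blast
    have xS: "x \<in> S" using x K by blast
    interpret e: conformal_chart S G "\<lambda>y. exp (l * \<phi> y)"
      by unfold_locales (intro smooth_on_exp smooth_on_mult smooth_on_const \<phi>)
    have G': "e.G' = (\<lambda>y a b. exp (2 * exp (l * \<phi> y)) * G y a b)"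
      by (intro ext) (simp add: e.G'_def)
    define U where "U = exp (l * \<phi> x)"
    define Q where "Q = G x v v * G x w w - (G x v w)\<^sup>2"
    define m where "m = Dh \<phi> x (f.grad x)"
    define N where "N = G x (riemann_curvature G (\<lambda>_. v) (\<lambda>_. w) (\<lambda>_. w) x) v"
    define h where "h = G x w w * f.hess x v v + G x v v * f.hess x w w - 2 * G x v w * f.hess x v w"
    define q where "q = G x w w * (Dh \<phi> x v)\<^sup>2 + G x v v * (Dh \<phi> x w)\<^sup>2 - 2 * G x v w * (Dh \<phi> x v * Dh \<phi> x w)"
    have Q: "0 < Q" unfolding Q_def by (rule gram_pos[OF xS indep])
    have QQ: "?Q x v w w v = Q" using sym[OF xS, of w v] by (simp add: Q_def power2_eq_square)
    have N: "\<bar>N\<bar> \<le> C * Q" and h: "\<bar>h\<bar> \<le> C * Q"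
    proof -
      have "h = ?H x v w w v" using sym[OF xS, of w v] f.hess_sym[OF xS, of w v] by (simp add: h_def)
      moreover have "\<bar>Rm x v w w v\<bar> \<le> C1 * (?Q x v w w v + ?Q x v w w v)"
        "\<bar>?H x v w w v\<bar> \<le> C2 * (?Q x v w w v + ?Q x v w w v)" by (rule C1(2)[OF x] C2(2)[OF x])+
      ultimately have "\<bar>N\<bar> \<le> 2 * C1 * Q" "\<bar>h\<bar> \<le> 2 * C2 * Q"
        unfolding QQ N_def riemann_lowered[OF xS] by simp_all
      moreover have "2 * C1 * Q \<le> C * Q" "2 * C2 * Q \<le> C * Q"
        using C1(1) C2(1) Q by (auto simp: C_def intro!: mult_right_mono)
      ultimately show "\<bar>N\<bar> \<le> C * Q" "\<bar>h\<bar> \<le> C * Q" by linarith+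
    qed
    have q: "q \<le> m * Q" unfolding q_def m_def Q_def by (rule f.grad_gram[OF xS Q[unfolded Q_def]])
    have cm: "c \<le> m" unfolding m_def by (rule c(2)[OF x])
    have l1: "1 \<le> l" and lc: "2 * C + 1 \<le> l * c"
      using l c(1) by (simp_all add: l\<^sub>0_def field_simps)
    have U: "1 \<le> U" using nonneg[OF x] l1 by (simp add: U_def)
    have grad: "e.grad x = (l * U) *\<^sub>R f.grad x"
      by (rule metric_eqI[OF xS])
         (simp add: e.grad[OF xS] f.grad[OF xS] bil_simps[OF xS] Dh_exp_scaled[OF xS \<phi>] U_def)
    \<comment> \<open>The two quadratic terms are the second derivative of the exponential and the
      subtracted square of its differential.\<close>
    have T: "e.T x a b = l * U * f.hess x a b + (l\<^sup>2 * U - l\<^sup>2 * U\<^sup>2) * (Dh \<phi> x a * Dh \<phi> x b)" for a b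
      unfolding e.T_def f.hess_def Dh_exp_scaled[OF xS \<phi>] U_def by (simp add: algebra_simps power2_eq_square)
    have "e.G' x (riemann_curvature e.G' (\<lambda>_. v) (\<lambda>_. w) (\<lambda>_. w) x) v =
        exp (2 * U) * (N - l * U * h - (l\<^sup>2 * U - l\<^sup>2 * U\<^sup>2) * q - l\<^sup>2 * U\<^sup>2 * m * Q)"
      unfolding e.conformal_curvature[OF xS] T grad
      by (simp add: Dh_exp_scaled[OF xS \<phi>] f.\<theta>_simps[OF xS] N_def h_def q_def m_def Q_def U_def algebra_simps power2_eq_square)
    also have "\<dots> < 0"
    proof -
      have U2: "U \<le> U\<^sup>2" using U by (simp add: power2_eq_square)
      \<comment> \<open>\<open>q\<close> enters with the nonnegative factor
        \<open>l\<^sup>2 * (U\<^sup>2 - U)\<close>, so it may be replaced by its upper bound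
        \<open>m * Q\<close>; the terms with \<open>U\<^sup>2\<close> then cancel, and
        \<open>- l\<^sup>2 * U * m * Q\<close> is left.\<close>
      have "0 \<le> (l\<^sup>2 * (U\<^sup>2 - U)) * (m * Q - q)"
        using U2 q by (intro mult_nonneg_nonneg) auto
      then have "N - l * U * h - (l\<^sup>2 * U - l\<^sup>2 * U\<^sup>2) * q - l\<^sup>2 * U\<^sup>2 * m * Q \<le> N - l * U * h - l\<^sup>2 * U * m * Q"
        by (simp add: algebra_simps)
      also have "\<dots> \<le> C * Q + l * U * (C * Q) - l * U * ((2 * C + 1) * Q)"
      proof -
        have "N \<le> C * Q" using N by simp
        moreover have "- (l * U * h) \<le> l * U * (C * Q)"
        proof -
          have "l * U * (- h) \<le> l * U * (C * Q)" using h l1 U by (intro mult_left_mono) auto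
          then show ?thesis by simp
        qed
        moreover have "l * U * ((2 * C + 1) * Q) \<le> l\<^sup>2 * U * m * Q"
        proof -
          have "2 * C + 1 \<le> l * m" using lc cm l1 by (smt (verit) mult_left_mono)
          then have "l * U * ((2 * C + 1) * Q) \<le> l * U * (l * m * Q)"
            using l1 U Q by (intro mult_left_mono mult_right_mono) auto
          then show ?thesis by (simp add: power2_eq_square mult.assoc mult.left_commute)
        qed
        ultimately show ?thesis by linarith
      qed
      also have "\<dots> = Q * (C - l * U * (C + 1))" by (simp add: algebra_simps)
      also have "\<dots> < 0"
      proof -
        have "1 \<le> l * U" using mult_mono[OF l1 U] l1 by simp
        moreover have "0 \<le> C" using C1 C2 by (simp add: C_def)
        ultimately have "C + 1 \<le> l * U * (C + 1)" using mult_right_mono[of 1 "l * U" "C + 1"] by simp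
        then show ?thesis using Q by (simp add: mult_pos_neg)
      qed
      finally show ?thesis by (simp add: mult_pos_neg)
    qed
    finally have neg: "e.G' x (riemann_curvature e.G' (\<lambda>_. v) (\<lambda>_. w) (\<lambda>_. w) x) v < 0" .
    have "sectional_in_chart e.G' x v w < 0"
      unfolding sectional_in_chart_def
      by (rule divide_neg_pos[OF neg e.conf.gram_pos[OF xS indep]])
    then show "sectional_in_chart (\<lambda>y a b. exp (2 * exp (l * \<phi> y)) * G y a b) x v w < 0"
      unfolding G' .
  qed
qed

end

section \<open>Independence of the chart\<close>

lemma bilinear_field_has_derivative:
  fixes F :: "real^3 \<Rightarrow> real^3 \<Rightarrow> real^3 \<Rightarrow> 'b::real_normed_vector"
  assumes S: "openin (top_of_set half_space) S" "x \<in> S" and F: "\<And>y. y \<in> S \<Longrightarrow> bilinear (F y)"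
    and F': "\<And>a b. ((\<lambda>y. F y a b) has_derivative F' a b) (at x within half_space)"
    and A: "(A has_derivative A') (at x within half_space)"
    and B: "(B has_derivative B') (at x within half_space)"
  shows "((\<lambda>y. F y (A y) (B y)) has_derivative
    (\<lambda>v. F' (A x) (B x) v + F x (A' v) (B x) + F x (A x) (B' v))) (at x within half_space)"
proof -
  have lin: "linear (\<lambda>a. F y a b)" "linear (F y a)" if "y \<in> S" for y a b
    using F[OF that] by (auto simp: bilinear_def)
  have "((\<lambda>y. F y (A y) b) has_derivative (\<lambda>v. F' (A x) b v + F x (A' v) b)) (at x within half_space)" for b
    by (rule linear_field_has_derivative[OF S lin(1) F' A])
  from linear_field_has_derivative[OF S lin(2) this B] show ?thesis by simp
qed

lemma (in chart_metric) chart_metric_subset: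
  assumes "openin (top_of_set half_space) T" "T \<subseteq> S"
  shows "chart_metric T G"
  by unfold_locales (use assms bil sym pos in \<open>auto intro: smooth_on_subset[OF smooth]\<close>)

locale isometric_charts = src: chart_metric S G + tgt: chart_metric S' G' for S G S' G' +
  fixes \<tau> :: "real^3 \<Rightarrow> real^3"
  assumes \<tau>: "smooth_on S \<tau>" "\<tau> ` S \<subseteq> S'"
    and isometry: "y \<in> S \<Longrightarrow> G y a b = G' (\<tau> y) (Dh \<tau> y a) (Dh \<tau> y b)"
begin

lemmas S = src.S

abbreviation J where "J y \<equiv> Dh \<tau> y"
abbreviation H where "H y a b \<equiv> Dh (\<lambda>y. J y b) y a"

lemma \<tau>_has_derivative: "x \<in> S \<Longrightarrow> (\<tau> has_derivative J x) (at x within half_space)"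
  by (rule smooth_on_has_Dh(1)[OF S _ \<tau>(1)])

lemma J_has_derivative: "x \<in> S \<Longrightarrow> ((\<lambda>y. J y b) has_derivative (\<lambda>a. H x a b)) (at x within half_space)"
  by (rule smooth_on_has_Dh(1)[OF S _ smooth_on_Dh[OF S \<tau>(1)]])

lemma J_lin: "x \<in> S \<Longrightarrow> linear (J x)"
  by (rule has_derivative_linear[OF \<tau>_has_derivative])

lemma H_sym: "x \<in> S \<Longrightarrow> H x a b = H x b a"
  by (rule Dh_symmetric[OF S _ \<tau>(1)])

lemma H_lin: "x \<in> S \<Longrightarrow> linear (\<lambda>a. H x a b)" "x \<in> S \<Longrightarrow> linear (H x a)"
proof -
  show *: "x \<in> S \<Longrightarrow> linear (\<lambda>a. H x a b)" for b
    by (rule has_derivative_linear[OF J_has_derivative])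
  show "x \<in> S \<Longrightarrow> linear (H x a)"
    using *[of a] H_sym[of x a] by simp
qed

lemma \<tau>_in: "x \<in> S \<Longrightarrow> \<tau> x \<in> S'"
  using \<tau>(2) by blast

text \<open>By the isometry condition a vector killed by \<open>J x\<close> has zero product with
  every vector, hence is zero; source and target have the same dimension.\<close>

lemma J_bij: assumes x: "x \<in> S" shows "bij (J x)"
proof -
  have "a = 0" if "J x a = 0" for a
  proof (rule src.metric_eqI[OF x])
    show "G x a e = G x 0 e" for e
      using that by (simp add: isometry[OF x] linear_0[OF J_lin[OF x]])
  qed
  then have "inj (J x)" using linear_injective_0[OF J_lin[OF x]] by blast
  then show ?thesis using linear_injective_imp_surjective[OF J_lin[OF x]] by (simp add: bij_def)
qed

lemma pullback_has_derivative:
  assumes x: "x \<in> S" and h: "(h has_derivative h') (at (\<tau> x) within half_space)"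
  shows "((\<lambda>y. h (\<tau> y)) has_derivative (\<lambda>v. h' (J x v))) (at x within half_space)"
  by (rule has_derivative_half_space_compose[OF S x \<tau>_has_derivative[OF x] _ h])
     (use \<tau>_in tgt.in_half_space in blast)

text \<open>Pulling the target connection back by \<open>J\<close>, with the second derivative
  \<open>H\<close> of the coordinate change as inhomogeneous term, yields an operation with the
  defining properties of the Levi-Civita connection of \<open>G\<close>; uniqueness does the
  rest.\<close>

lemma christoffel_transform:
  assumes x: "x \<in> S"
  shows "tgt.\<Gamma> (\<tau> x) (J x v) (J x w) + H x v w = J x (src.\<Gamma> x v w)"
proof -
  define I where "I = inv (J x)"
  have JI: "J x (I a) = a" for a
    using J_bij[OF x] by (simp add: I_def bij_def surj_f_inv_f)
  have IJ: "I (J x a) = a" for a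
    using J_bij[OF x] by (simp add: I_def bij_def inv_f_f)
  have I_lin: "linear I"
    by (rule linearI; rule injD[OF bij_is_inj[OF J_bij[OF x]]])
       (simp_all add: JI linear_add[OF J_lin[OF x]] linear_cmul[OF J_lin[OF x]])
  note \<Gamma>' = tgt.\<Gamma>_bil[OF \<tau>_in[OF x]]
  have "src.\<Gamma> x = (\<lambda>v w. I (tgt.\<Gamma> (\<tau> x) (J x v) (J x w) + H x v w))"
  proof (rule src.christoffel_eqI[OF x], unfold levi_civita_at_def, intro conjI allI)
    show "bilinear (\<lambda>v w. I (tgt.\<Gamma> (\<tau> x) (J x v) (J x w) + H x v w))"
      unfolding bilinear_def
      by (intro conjI allI linearI)
         (simp_all add: linear_add[OF J_lin[OF x]] linear_cmul[OF J_lin[OF x]]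
           linear_add[OF H_lin(1)[OF x]] linear_cmul[OF H_lin(1)[OF x]]
           linear_add[OF H_lin(2)[OF x]] linear_cmul[OF H_lin(2)[OF x]]
           bilinear_ladd[OF \<Gamma>'] bilinear_radd[OF \<Gamma>'] bilinear_lmul[OF \<Gamma>'] bilinear_rmul[OF \<Gamma>']
           linear_add[OF I_lin] linear_cmul[OF I_lin] algebra_simps)
    show "I (tgt.\<Gamma> (\<tau> x) (J x v) (J x w) + H x v w) = I (tgt.\<Gamma> (\<tau> x) (J x w) (J x v) + H x w v)" for v w
      using tgt.\<Gamma>_sym[OF \<tau>_in[OF x]] H_sym[OF x] by metis
    fix v a b
    have "((\<lambda>y. G' (\<tau> y) (J y a) (J y b)) has_derivative
        (\<lambda>v. tgt.P (\<tau> x) (J x v) (J x a) (J x b) + G' (\<tau> x) (H x v a) (J x b) + G' (\<tau> x) (J x a) (H x v b)))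
        (at x within half_space)"
      by (rule bilinear_field_has_derivative[OF S x tgt.bil[OF \<tau>_in]
            pullback_has_derivative[OF x smooth_on_has_Dh(1)[OF tgt.S \<tau>_in[OF x] tgt.smooth]]
            J_has_derivative[OF x] J_has_derivative[OF x]])
    from has_Dh_eqI(2)[OF S x this isometry[symmetric]]
    have "src.P x v a b =
        tgt.P (\<tau> x) (J x v) (J x a) (J x b) + G' (\<tau> x) (H x v a) (J x b) + G' (\<tau> x) (J x a) (H x v b)"
      by simp
    then show "src.P x v a b = G x (I (tgt.\<Gamma> (\<tau> x) (J x v) (J x a) + H x v a)) b +
        G x a (I (tgt.\<Gamma> (\<tau> x) (J x v) (J x b) + H x v b))"
      unfolding isometry[OF x] JI tgt.P_eq[OF \<tau>_in[OF x]] by (simp add: tgt.bil_simps[OF \<tau>_in[OF x]])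
  qed
  then have "src.\<Gamma> x v w = I (tgt.\<Gamma> (\<tau> x) (J x v) (J x w) + H x v w)" by simp
  then show ?thesis by (simp add: JI)
qed

text \<open>The transformation law of the Christoffel symbols is differentiated and antisymmetrized
  in \<open>v\<close> and \<open>w\<close>. The third derivatives of \<open>\<tau>\<close> are
  symmetric in these arguments, and the terms in \<open>H\<close> cancel against those from the
  quadratic part of the curvature.\<close>

lemma curvature_transform:
  assumes x: "x \<in> S"
  shows "J x (riemann_curvature G (\<lambda>_. v) (\<lambda>_. w) (\<lambda>_. z) x) =
    riemann_curvature G' (\<lambda>_. J x v) (\<lambda>_. J x w) (\<lambda>_. J x z) (\<tau> x)"
proof -
  let ?H3 = "\<lambda>v w z. Dh (\<lambda>y. H y w z) x v"
  note c = christoffel_transform[OF x] and \<tau>x = \<tau>_in[OF x]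
  have D: "J x (Dh (\<lambda>y. src.\<Gamma> y w z) x v) = Dh (\<lambda>y. tgt.\<Gamma> y (J x w) (J x z)) (\<tau> x) (J x v)
      + tgt.\<Gamma> (\<tau> x) (H x v w) (J x z) + tgt.\<Gamma> (\<tau> x) (J x w) (H x v z) + ?H3 v w z
      - H x v (src.\<Gamma> x w z)" for v w z
  proof -
    have "((\<lambda>y. tgt.\<Gamma> (\<tau> y) (J y w) (J y z)) has_derivative
        (\<lambda>v. Dh (\<lambda>y. tgt.\<Gamma> y (J x w) (J x z)) (\<tau> x) (J x v)
      + tgt.\<Gamma> (\<tau> x) (H x v w) (J x z) + tgt.\<Gamma> (\<tau> x) (J x w) (H x v z))) (at x within half_space)"
      by (rule bilinear_field_has_derivative[OF S x tgt.\<Gamma>_bil[OF \<tau>_in]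
            pullback_has_derivative[OF x Dh_has_derivative[OF tgt.\<Gamma>_differentiable[OF \<tau>x]]]
            J_has_derivative[OF x] J_has_derivative[OF x]])
    moreover have "((\<lambda>y. H y w z) has_derivative (\<lambda>v. ?H3 v w z)) (at x within half_space)"
      by (rule smooth_on_has_Dh(1)[OF S x smooth_on_Dh[OF S smooth_on_Dh[OF S \<tau>(1)]]])
    ultimately have "((\<lambda>y. tgt.\<Gamma> (\<tau> y) (J y w) (J y z) + H y w z) has_derivative
        (\<lambda>v. Dh (\<lambda>y. tgt.\<Gamma> y (J x w) (J x z)) (\<tau> x) (J x v)
      + tgt.\<Gamma> (\<tau> x) (H x v w) (J x z) + tgt.\<Gamma> (\<tau> x) (J x w) (H x v z) + ?H3 v w z)) (at x within half_space)"
      by (rule has_derivative_add)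
    from has_Dh_eqI(2)[OF S x this christoffel_transform]
    have 1: "Dh (\<lambda>y. J y (src.\<Gamma> y w z)) x v = Dh (\<lambda>y. tgt.\<Gamma> y (J x w) (J x z)) (\<tau> x) (J x v)
      + tgt.\<Gamma> (\<tau> x) (H x v w) (J x z) + tgt.\<Gamma> (\<tau> x) (J x w) (H x v z) + ?H3 v w z" by simp
    have "((\<lambda>y. J y (src.\<Gamma> y w z)) has_derivative
        (\<lambda>v. H x v (src.\<Gamma> x w z) + J x (Dh (\<lambda>y. src.\<Gamma> y w z) x v))) (at x within half_space)"
      by (rule linear_field_has_derivative[OF S x J_lin J_has_derivative[OF x]
            Dh_has_derivative[OF src.\<Gamma>_differentiable[OF x]]])
    from half_space_derivative_unique[OF src.in_half_space[OF x] this]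
    have "Dh (\<lambda>y. J y (src.\<Gamma> y w z)) x v = H x v (src.\<Gamma> x w z) + J x (Dh (\<lambda>y. src.\<Gamma> y w z) x v)" by simp
    with 1 show ?thesis by (simp add: algebra_simps)
  qed
  have \<Gamma>\<Gamma>: "J x (src.\<Gamma> x v (src.\<Gamma> x w z)) = tgt.\<Gamma> (\<tau> x) (J x v) (tgt.\<Gamma> (\<tau> x) (J x w) (J x z)) +
      tgt.\<Gamma> (\<tau> x) (J x v) (H x w z) + H x v (src.\<Gamma> x w z)" for v w z
    unfolding c[symmetric, of v "src.\<Gamma> x w z"] c[symmetric, of w z] tgt.\<Gamma>_simps(2)[OF \<tau>x] by simp
  have "?H3 v w z = ?H3 w v z"
    by (rule Dh_symmetric[OF S x smooth_on_Dh[OF S \<tau>(1)]])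
  then show ?thesis
    unfolding src.riemann_curvature_eq[OF x] tgt.riemann_curvature_eq[OF \<tau>x]
    by (simp only: linear_add[OF J_lin[OF x]] linear_diff[OF J_lin[OF x]] D \<Gamma>\<Gamma>)
       (simp add: H_sym[OF x, of w v] tgt.\<Gamma>_sym[OF \<tau>x, of "J x w" "H x v z"]
          tgt.\<Gamma>_sym[OF \<tau>x, of "J x v" "H x w z"] algebra_simps)
qed

theorem sectional_in_chart_transform:
  assumes x: "x \<in> S"
  shows "sectional_in_chart G x v w = sectional_in_chart G' (\<tau> x) (J x v) (J x w)"
  by (simp add: sectional_in_chart_def isometry[OF x] curvature_transform[OF x])

end

section \<open>Smooth functions and critical points on the manifold\<close>

locale manifold3 =
  fixes X :: "'a topology" and A :: "'a chart set"
  assumes manifold: "smooth_manifold_with_boundary X A"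
begin

abbreviation img :: "'a chart \<Rightarrow> (real^3) set" where "img c \<equiv> snd c ` fst c"

lemma chart: "c \<in> A \<Longrightarrow> is_chart X c"
  using manifold by (simp add: smooth_manifold_with_boundary_def)

lemma open_chart: "c \<in> A \<Longrightarrow> openin X (fst c)"
  and open_img: "c \<in> A \<Longrightarrow> openin (top_of_set half_space) (img c)"
  using chart by (auto simp: is_chart_def)

lemma chart_subset: "c \<in> A \<Longrightarrow> fst c \<subseteq> topspace X"
  using open_chart openin_subset by blast

lemma img_half_space: "c \<in> A \<Longrightarrow> img c \<subseteq> half_space"
  using open_img openin_imp_subset by blast

lemma inv_chart: "c \<in> A \<Longrightarrow> p \<in> fst c \<Longrightarrow> chart_inv c (snd c p) = p"
  by (rule chart_inv[OF chart])

lemma chart_inv_in: "x \<in> img c \<Longrightarrow> chart_inv c x \<in> fst c"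
  unfolding chart_inv_def by (rule inv_into_into)

lemma chart_inv_right: "x \<in> img c \<Longrightarrow> snd c (chart_inv c x) = x"
  unfolding chart_inv_def by (rule f_inv_into_f)

lemma chart_at: "p \<in> topspace X \<Longrightarrow> \<exists>c\<in>A. p \<in> fst c"
  using manifold unfolding smooth_manifold_with_boundary_def by blast

lemma open_image: "c \<in> A \<Longrightarrow> openin X V \<Longrightarrow> openin (top_of_set half_space) (snd c ` (fst c \<inter> V))"
  by (rule chart_image_open[OF chart])

lemma transition_eq: "c \<in> A \<Longrightarrow> p \<in> fst c \<Longrightarrow> transition c c' (snd c p) = snd c' p"
  by (simp add: transition_def inv_chart)

lemma smooth_transition: "c \<in> A \<Longrightarrow> c' \<in> A \<Longrightarrow> smooth_on (snd c ` (fst c \<inter> fst c')) (transition c c')"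
  using manifold by (simp add: smooth_manifold_with_boundary_def)

lemma continuous_map_chart_inv:
  assumes "c \<in> A"
  shows "continuous_map (top_of_set (img c)) X (chart_inv c)"
proof -
  have top: "topspace (subtopology X (fst c)) = fst c"
    using chart_subset[OF assms] by auto
  obtain g where g: "homeomorphic_maps (subtopology X (fst c)) (top_of_set (img c)) (snd c) g"
    using chart[OF assms] homeomorphic_map_maps unfolding is_chart_def by blast
  have eq: "g x = chart_inv c x" if "x \<in> img c" for x
    using that g inv_chart[OF assms] top by (auto simp: homeomorphic_maps_def)
  have "continuous_map (top_of_set (img c)) X g"
    using g by (simp add: homeomorphic_maps_def continuous_map_in_subtopology)
  then show ?thesis by (rule continuous_map_eq) (use eq in simp)
qed

lemma open_chart_inv:
  assumes c: "c \<in> A" and V: "openin (top_of_set half_space) V" "V \<subseteq> img c"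
  shows "openin X (chart_inv c ` V)"
proof -
  have cont: "continuous_map (subtopology X (fst c)) (top_of_set (img c)) (snd c)"
    using chart[OF c] homeomorphic_imp_continuous_map unfolding is_chart_def by blast
  have V': "openin (top_of_set (img c)) V"
    by (rule openin_subset_trans[OF V img_half_space[OF c]])
  have top: "topspace (subtopology X (fst c)) = fst c"
    using chart_subset[OF c] by auto
  have "openin (subtopology X (fst c)) {p \<in> fst c. snd c p \<in> V}"
    using openin_continuous_map_preimage[OF cont V'] by (simp only: top)
  then have "openin X {p \<in> fst c. snd c p \<in> V}"
    by (rule openin_trans_full[OF _ open_chart[OF c]])
  moreover have "{p \<in> fst c. snd c p \<in> V} = chart_inv c ` V"
  proof (intro set_eqI iffI)
    fix p assume "p \<in> {p \<in> fst c. snd c p \<in> V}"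
    then show "p \<in> chart_inv c ` V" using inv_chart[OF c] by (intro image_eqI[of _ _ "snd c p"]) auto
  next
    fix p assume "p \<in> chart_inv c ` V"
    then obtain x where x: "x \<in> V" "p = chart_inv c x" by blast
    then have "x \<in> img c" using V(2) by blast
    then show "p \<in> {p \<in> fst c. snd c p \<in> V}" using x by (simp add: chart_inv_in chart_inv_right)
  qed
  ultimately show ?thesis by simp
qed

text \<open>Compact subsets of a chart are closed in the whole manifold because it is Hausdorff;
  their complements therefore provide neighbourhoods for points outside the chart.\<close>

lemma compact_chart_inv:
  assumes c: "c \<in> A" and K: "compact K" "K \<subseteq> img c"
  shows "compactin X (chart_inv c ` K)" "closedin X (chart_inv c ` K)"
proof -
  have "compactin (top_of_set (img c)) K" using K by (simp add: compactin_subtopology)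
  then show "compactin X (chart_inv c ` K)"
    by (rule image_compactin[OF _ continuous_map_chart_inv[OF c]])
  then show "closedin X (chart_inv c ` K)"
    using manifold compactin_imp_closedin unfolding smooth_manifold_with_boundary_def by blast
qed

text \<open>Smooth transitions carry smoothness from one chart around a point to all others, so a
  single chart per point suffices.\<close>

lemma smooth_functionI:
  assumes "\<And>p. p \<in> topspace X \<Longrightarrow> \<exists>c\<in>A. \<exists>V. openin X V \<and> p \<in> V \<and> V \<subseteq> fst c \<and> smooth_on (snd c ` V) (f \<circ> chart_inv c)"
  shows "smooth_function A f"
  unfolding smooth_function_def
proof (intro ballI smooth_on_local)
  fix c' x assume c': "c' \<in> A" and "x \<in> img c'"
  then obtain p where p: "p \<in> fst c'" "x = snd c' p" by blast
  have "p \<in> topspace X" using chart_subset[OF c'] p by blast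
  from assms[OF this] obtain c V where c: "c \<in> A" "openin X V" "p \<in> V" "V \<subseteq> fst c"
    "smooth_on (snd c ` V) (f \<circ> chart_inv c)" by blast
  let ?T = "snd c' ` (fst c' \<inter> V)"
  have "openin (top_of_set half_space) ?T" by (rule open_image[OF c' c(2)])
  then obtain U where U: "open U" "?T = half_space \<inter> U" by (auto simp: openin_open)
  have "smooth_on ?T (transition c' c)"
    by (rule smooth_on_subset[OF smooth_transition[OF c' c(1)]]) (use c(4) in blast)
  moreover have "transition c' c ` ?T \<subseteq> snd c ` V"
    by (auto simp: transition_eq[OF c'])
  ultimately have "smooth_on ?T (\<lambda>y. (f \<circ> chart_inv c) (transition c' c y))"
    by (rule smooth_on_compose[OF _ c(5)])
  then have T: "smooth_on ?T (f \<circ> chart_inv c')"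
    by (rule smooth_on_cong[rotated])
       (use c(4) in \<open>auto simp: transition_eq[OF c'] inv_chart[OF c'] inv_chart[OF c(1)]\<close>)
  have "img c' \<inter> U \<subseteq> ?T" using U(2) img_half_space[OF c'] by blast
  then show "\<exists>U. open U \<and> x \<in> U \<and> smooth_on (img c' \<inter> U) (f \<circ> chart_inv c')"
    using U p c(3) smooth_on_subset[OF T \<open>img c' \<inter> U \<subseteq> ?T\<close>] by (intro exI[of _ U] conjI) auto
qed

lemma smooth_functionD: "smooth_function A f \<Longrightarrow> c \<in> A \<Longrightarrow> smooth_on (img c) (f \<circ> chart_inv c)"
  by (simp add: smooth_function_def)

lemma smooth_function_binop:
  assumes "\<And>S (f :: real^3 \<Rightarrow> real) (g :: real^3 \<Rightarrow> real). smooth_on S f \<Longrightarrow> smooth_on S g \<Longrightarrow> smooth_on S (\<lambda>x. F (f x) (g x))"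
    and "smooth_function A f" "smooth_function A g"
  shows "smooth_function A (\<lambda>p. F (f p) (g p))"
  using assms(1)[OF smooth_functionD[OF assms(2)] smooth_functionD[OF assms(3)]]
  by (simp add: smooth_function_def o_def)

lemma smooth_function_const: "smooth_function A (\<lambda>p. r)"
  by (simp add: smooth_function_def o_def)

lemma smooth_function_exp: "smooth_function A f \<Longrightarrow> smooth_function A (\<lambda>p. exp (f p))"
  using smooth_on_exp[OF smooth_functionD] by (simp add: smooth_function_def o_def)

text \<open>On the chart itself nothing has to be shown beyond the smoothness of \<open>h\<close>;
  any other point has a neighbourhood avoiding the compact support, where the function is
  zero.\<close>

lemma smooth_function_extend:
  assumes c: "c \<in> A" and K: "compact K" "K \<subseteq> img c"
    and h: "smooth_on (img c) h" "\<And>x. x \<in> img c \<Longrightarrow> x \<notin> K \<Longrightarrow> h x = (0::real)"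
  shows "smooth_function A (\<lambda>p. if p \<in> fst c then h (snd c p) else 0)" (is "smooth_function A ?f")
proof (rule smooth_functionI)
  fix p assume p: "p \<in> topspace X"
  show "\<exists>c\<in>A. \<exists>V. openin X V \<and> p \<in> V \<and> V \<subseteq> fst c \<and> smooth_on (snd c ` V) (?f \<circ> chart_inv c)"
  proof (cases "p \<in> fst c")
    case True
    have "smooth_on (img c) (?f \<circ> chart_inv c)"
      by (rule smooth_on_cong[OF _ h(1)]) (auto simp: chart_inv_in chart_inv_right)
    then show ?thesis using c open_chart[OF c] True by blast
  next
    case False
    obtain c' where c': "c' \<in> A" "p \<in> fst c'" using chart_at[OF p] by blast
    let ?V = "fst c' - chart_inv c ` K"
    have V: "openin X ?V"
      by (rule openin_diff[OF open_chart[OF c'(1)] compact_chart_inv(2)[OF c K]])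
    have "p \<notin> chart_inv c ` K" using False K(2) chart_inv_in by blast
    have zero: "?f q = 0" if "q \<in> ?V" for q
    proof (cases "q \<in> fst c")
      case True
      have "snd c q \<notin> K" using that inv_chart[OF c True] by (metis DiffD2 imageI)
      then show ?thesis using h(2)[of "snd c q"] True by simp
    qed simp
    have "smooth_on (snd c' ` ?V) (?f \<circ> chart_inv c')"
    proof (rule smooth_on_cong[OF _ smooth_on_const[of _ 0]])
      fix y assume "y \<in> snd c' ` ?V"
      then obtain q where q: "q \<in> ?V" "y = snd c' q" by blast
      then have "chart_inv c' y = q" using inv_chart[OF c'(1)] by blast
      then show "0 = (?f \<circ> chart_inv c') y" using zero[OF q(1)] by (simp only: o_apply)
    qed
    then show ?thesis using c' V \<open>p \<notin> chart_inv c ` K\<close> by blast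
  qed
qed

text \<open>Asked in every chart around \<open>p\<close>, and vacuously true off
  \<open>topspace X\<close>, so sets of critical points are always intersected with it.\<close>

definition critical :: "('a \<Rightarrow> real) \<Rightarrow> 'a \<Rightarrow> bool" where
  "critical f p \<longleftrightarrow> (\<forall>c\<in>A. p \<in> fst c \<longrightarrow> (\<forall>v. Dh (f \<circ> chart_inv c) (snd c p) v = 0))"

lemma Dh_chart_change:
  assumes f: "smooth_function A f" and c: "c \<in> A" "c' \<in> A" and p: "p \<in> fst c" "p \<in> fst c'"
  shows "Dh (f \<circ> chart_inv c') (snd c' p) v =
    Dh (f \<circ> chart_inv c) (snd c p) (Dh (transition c' c) (snd c' p) v)"
proof -
  let ?T = "snd c' ` (fst c' \<inter> fst c)"
  have T: "openin (top_of_set half_space) ?T" "snd c' p \<in> ?T"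
    using open_image[OF c(2) open_chart[OF c(1)]] p by auto
  have d: "((\<lambda>y. (f \<circ> chart_inv c) (transition c' c y)) has_derivative
      (\<lambda>v. Dh (f \<circ> chart_inv c) (snd c p) (Dh (transition c' c) (snd c' p) v))) (at (snd c' p) within half_space)"
  proof (rule has_derivative_half_space_compose[OF T transition_derivative[OF manifold c(2,1) p(2,1)]])
    show "transition c' c ` ?T \<subseteq> half_space"
      using img_half_space[OF c(1)] by (auto simp: transition_eq[OF c(2)])
    show "((f \<circ> chart_inv c) has_derivative Dh (f \<circ> chart_inv c) (snd c p))
        (at (transition c' c (snd c' p)) within half_space)"
      using smooth_on_has_Dh(1)[OF open_img[OF c(1)] _ smooth_functionD[OF f c(1)], of "snd c p"] p
      by (simp add: transition_eq[OF c(2) p(2)])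
  qed
  have e: "(f \<circ> chart_inv c) (transition c' c y) = (f \<circ> chart_inv c') y" if "y \<in> ?T" for y
    using that by (auto simp: transition_eq[OF c(2)] inv_chart[OF c(2)] inv_chart[OF c(1)])
  have "Dh (f \<circ> chart_inv c') (snd c' p) =
      (\<lambda>v. Dh (f \<circ> chart_inv c) (snd c p) (Dh (transition c' c) (snd c' p) v))"
    by (rule has_Dh_eqI(2)[OF T d e])
  then show ?thesis by (simp only:)
qed

lemma critical_iff:
  assumes f: "smooth_function A f" and c: "c \<in> A" "p \<in> fst c"
  shows "critical f p \<longleftrightarrow> (\<forall>v. Dh (f \<circ> chart_inv c) (snd c p) v = 0)"
proof
  assume "critical f p"
  then show "\<forall>v. Dh (f \<circ> chart_inv c) (snd c p) v = 0" using c by (simp add: critical_def)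
next
  assume "\<forall>v. Dh (f \<circ> chart_inv c) (snd c p) v = 0"
  then show "critical f p"
    unfolding critical_def using Dh_chart_change[OF f c(1) _ c(2)] by simp
qed

text \<open>Injective immersions enter only through their effect on smooth functions and critical points,
  so they are defined by it.\<close>

definition immersions :: "('a \<Rightarrow> 'a) set" where
  "immersions = {F. F ` topspace X \<subseteq> topspace X \<and> inj_on F (topspace X) \<and>
     (\<forall>f. smooth_function A f \<longrightarrow> smooth_function A (f \<circ> F) \<and>
       (\<forall>p\<in>topspace X. critical (f \<circ> F) p \<longleftrightarrow> critical f (F p)))}"

lemma immersionsD:
  assumes "F \<in> immersions"
  shows "p \<in> topspace X \<Longrightarrow> F p \<in> topspace X" "inj_on F (topspace X)"
    "smooth_function A f \<Longrightarrow> smooth_function A (f \<circ> F)"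
    "smooth_function A f \<Longrightarrow> p \<in> topspace X \<Longrightarrow> critical (f \<circ> F) p \<longleftrightarrow> critical f (F p)"
  using assms unfolding immersions_def by blast+

lemma immersions_compose:
  assumes F: "F \<in> immersions" and H: "H \<in> immersions"
  shows "H \<circ> F \<in> immersions"
  unfolding immersions_def
proof (intro CollectI conjI allI impI ballI)
  show "(H \<circ> F) ` topspace X \<subseteq> topspace X"
    using immersionsD(1)[OF F] immersionsD(1)[OF H] by auto
  have "inj_on H (F ` topspace X)"
    by (rule inj_on_subset[OF immersionsD(2)[OF H]]) (use immersionsD(1)[OF F] in blast)
  then show "inj_on (H \<circ> F) (topspace X)"
    by (rule comp_inj_on[OF immersionsD(2)[OF F]])
  fix f assume f: "smooth_function A f"
  note fH = immersionsD(3)[OF H f]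
  show "smooth_function A (f \<circ> (H \<circ> F))"
    using immersionsD(3)[OF F fH] by (simp only: o_assoc)
  show "critical (f \<circ> (H \<circ> F)) p \<longleftrightarrow> critical f ((H \<circ> F) p)" if p: "p \<in> topspace X" for p
    using immersionsD(4)[OF F fH p] immersionsD(4)[OF H f immersionsD(1)[OF F p]]
    by (simp only: o_assoc o_apply)
qed

text \<open>\<open>T\<close> moves points only within a compact part of the chart image, so it can
  be glued with the identity. It may send \<open>img c\<close> to a proper subset of itself, which
  is how a point comes to be missed.\<close>

lemma chart_immersion:
  assumes c: "c \<in> A" and K: "compact K" "K \<subseteq> img c"
    and T: "\<And>k. Ck_on k UNIV T" "T ` img c \<subseteq> img c" "inj T" "\<And>x. x \<in> img c \<Longrightarrow> x \<notin> K \<Longrightarrow> T x = x"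
    and DT: "\<And>x. surj (frechet_derivative T (at x))"
  shows "(\<lambda>p. if p \<in> fst c then chart_inv c (T (snd c p)) else p) \<in> immersions" (is "?F \<in> _")
  unfolding immersions_def
proof (intro CollectI conjI allI impI)
  have Fc: "?F p \<in> fst c" "snd c (?F p) = T (snd c p)" if "p \<in> fst c" for p
  proof -
    have "T (snd c p) \<in> img c" using T(2) that by blast
    then show "?F p \<in> fst c" "snd c (?F p) = T (snd c p)" using that by (simp_all add: chart_inv_in chart_inv_right)
  qed
  have Fn: "?F p = p" if "p \<notin> fst c" for p using that by simp
  show "?F ` topspace X \<subseteq> topspace X"
    using Fc(1) chart_subset[OF c] by auto
  show "inj_on ?F (topspace X)"
  proof (rule inj_onI)
    fix p q assume eq: "?F p = ?F q"
    \<comment> \<open>The map sends the chart domain into itself and fixes its complement pointwise,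
      so points from the two sides are never identified.\<close>
    have "p \<in> fst c \<longleftrightarrow> q \<in> fst c"
    proof (cases "p \<in> fst c"; cases "q \<in> fst c")
      assume p: "p \<in> fst c" and q: "q \<notin> fst c"
      from Fc(1)[OF p] have "q \<in> fst c" unfolding eq Fn[OF q] .
      then show ?thesis using q by simp
    next
      assume p: "p \<notin> fst c" and q: "q \<in> fst c"
      from Fc(1)[OF q] have "p \<in> fst c" unfolding eq[symmetric] Fn[OF p] .
      then show ?thesis using p by simp
    qed simp_all
    then consider "p \<in> fst c" "q \<in> fst c" | "p \<notin> fst c" "q \<notin> fst c" by blast
    then show "p = q"
    proof cases
      case 1
      from eq have "snd c (?F p) = snd c (?F q)" by (rule arg_cong)
      then have "T (snd c p) = T (snd c q)" unfolding Fc(2)[OF 1(1)] Fc(2)[OF 1(2)] .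
      then have "snd c p = snd c q" using T(3) by (simp add: inj_eq)
      then have "chart_inv c (snd c p) = chart_inv c (snd c q)" by simp
      then show ?thesis unfolding inv_chart[OF c 1(1)] inv_chart[OF c 1(2)] .
    next
      case 2
      from eq show ?thesis unfolding Fn[OF 2(1)] Fn[OF 2(2)] .
    qed
  qed
  fix f assume f: "smooth_function A f"
  let ?f = "f \<circ> chart_inv c"
  have Tsm: "smooth_on (img c) T" by (rule smooth_on_Ck_on[OF open_UNIV subset_UNIV T(1)])
  have comp: "(f \<circ> ?F \<circ> chart_inv c) x = ?f (T x)" if "x \<in> img c" for x
    using that by (simp add: chart_inv_in chart_inv_right)
  have near: "\<exists>c'\<in>A. p \<in> fst c' \<and> (\<exists>V. openin X V \<and> p \<in> V \<and> V \<subseteq> fst c' \<and> (\<forall>q\<in>V. ?F q = q))"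
    if p: "p \<in> topspace X" "p \<notin> fst c" for p
  proof -
    obtain c' where c': "c' \<in> A" "p \<in> fst c'" using chart_at[OF p(1)] by blast
    have "openin X (fst c' - chart_inv c ` K)"
      by (rule openin_diff[OF open_chart[OF c'(1)] compact_chart_inv(2)[OF c K]])
    moreover have "p \<notin> chart_inv c ` K" using p(2) K(2) chart_inv_in by blast
    moreover have "?F q = q" if q: "q \<notin> chart_inv c ` K" for q
    proof (cases "q \<in> fst c")
      case True
      have "snd c q \<notin> K" using q inv_chart[OF c True] by (metis imageI)
      then show ?thesis using T(4)[of "snd c q"] True inv_chart[OF c True] by simp
    qed simp
    ultimately show ?thesis using c' by (intro bexI[of _ c'] conjI exI[of _ "fst c' - chart_inv c ` K"]) auto
  qed
  show smooth: "smooth_function A (f \<circ> ?F)"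
  proof (rule smooth_functionI)
    fix p assume p: "p \<in> topspace X"
    show "\<exists>c\<in>A. \<exists>V. openin X V \<and> p \<in> V \<and> V \<subseteq> fst c \<and> smooth_on (snd c ` V) (f \<circ> ?F \<circ> chart_inv c)"
    proof (cases "p \<in> fst c")
      case True
      have "smooth_on (img c) (f \<circ> ?F \<circ> chart_inv c)"
        by (rule smooth_on_cong[OF comp[symmetric] smooth_on_compose[OF Tsm smooth_functionD[OF f c] T(2)]])
      then show ?thesis using c open_chart[OF c] True by blast
    next
      case False
      then obtain c' V where c': "c' \<in> A" "openin X V" "p \<in> V" "V \<subseteq> fst c'" "\<forall>q\<in>V. ?F q = q"
        using near[OF p] by blast
      have "smooth_on (snd c' ` V) (f \<circ> ?F \<circ> chart_inv c')"
      proof (rule smooth_on_cong[OF _ smooth_on_subset[OF smooth_functionD[OF f c'(1)] image_mono[OF c'(4)]]])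
        fix y assume "y \<in> snd c' ` V"
        then obtain q where q: "q \<in> V" "y = snd c' q" by blast
        have "?F q = q" using c'(5) q(1) by blast
        moreover have "chart_inv c' y = q" using inv_chart[OF c'(1)] q c'(4) by blast
        ultimately show "(f \<circ> chart_inv c') y = (f \<circ> ?F \<circ> chart_inv c') y" by (simp only: o_apply)
      qed
      then show ?thesis using c' by blast
    qed
  qed
  show "\<forall>p\<in>topspace X. critical (f \<circ> ?F) p \<longleftrightarrow> critical f (?F p)"
  proof
    fix p assume p: "p \<in> topspace X"
    show "critical (f \<circ> ?F) p \<longleftrightarrow> critical f (?F p)"
    proof (cases "p \<in> fst c")
      case True
      let ?x = "snd c p"
      have x: "?x \<in> img c" using True by blast
      have "(T has_derivative frechet_derivative T (at ?x)) (at ?x within half_space)"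
        by (rule has_derivative_at_withinI[OF Ck_on_SucD[OF T(1) UNIV_I]])
      moreover have "T ` img c \<subseteq> half_space" using T(2) img_half_space[OF c] by blast
      moreover have "(?f has_derivative Dh ?f (T ?x)) (at (T ?x) within half_space)"
        by (rule smooth_on_has_Dh(1)[OF open_img[OF c] _ smooth_functionD[OF f c]]) (use T(2) x in blast)
      ultimately have "((\<lambda>y. ?f (T y)) has_derivative (\<lambda>v. Dh ?f (T ?x) (frechet_derivative T (at ?x) v)))
          (at ?x within half_space)"
        by (rule has_derivative_half_space_compose[OF open_img[OF c] x])
      then have "Dh (f \<circ> ?F \<circ> chart_inv c) ?x = (\<lambda>v. Dh ?f (T ?x) (frechet_derivative T (at ?x) v))"
        by (rule has_Dh_eqI(2)[OF open_img[OF c] x _ comp[symmetric]])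
      then have D: "Dh (f \<circ> ?F \<circ> chart_inv c) ?x v = Dh ?f (T ?x) (frechet_derivative T (at ?x) v)" for v
        by (simp only:)
      have "critical (f \<circ> ?F) p \<longleftrightarrow> (\<forall>v. Dh ?f (T ?x) (frechet_derivative T (at ?x) v) = 0)"
        unfolding critical_iff[OF smooth c True] D ..
      \<comment> \<open>Surjectivity of the derivative of \<open>T\<close> keeps new critical points
        from arising under composition.\<close>
      also have "\<dots> \<longleftrightarrow> (\<forall>v. Dh ?f (T ?x) v = 0)" using DT[of ?x] by (metis surjD)
      also have "\<dots> \<longleftrightarrow> critical f (?F p)"
        unfolding critical_iff[OF f c Fc(1)[OF True]] Fc(2)[OF True] ..
      finally show ?thesis .
    next
      case False
      then obtain c' V where c': "c' \<in> A" "openin X V" "p \<in> V" "V \<subseteq> fst c'" "\<forall>q\<in>V. ?F q = q"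
        using near[OF p] by blast
      have pc: "p \<in> fst c'" using c' by blast
      have T: "openin (top_of_set half_space) (snd c' ` (fst c' \<inter> V))" "snd c' p \<in> snd c' ` (fst c' \<inter> V)"
        using open_image[OF c'(1,2)] c'(3) pc by auto
      have "((f \<circ> chart_inv c') has_derivative Dh (f \<circ> chart_inv c') (snd c' p)) (at (snd c' p) within half_space)"
        by (rule smooth_on_has_Dh(1)[OF open_img[OF c'(1)] _ smooth_functionD[OF f c'(1)]]) (use pc in blast)
      note d = this
      have e: "(f \<circ> chart_inv c') y = (f \<circ> ?F \<circ> chart_inv c') y" if y: "y \<in> snd c' ` (fst c' \<inter> V)" for y
      proof -
        obtain q where q: "q \<in> fst c'" "q \<in> V" "y = snd c' q" using y by blast
        have "?F q = q" using c'(5) q(2) by blast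
        then show ?thesis by (simp only: o_apply q(3) inv_chart[OF c'(1) q(1)])
      qed
      have "Dh (f \<circ> ?F \<circ> chart_inv c') (snd c' p) = Dh (f \<circ> chart_inv c') (snd c' p)"
        by (rule has_Dh_eqI(2)[OF T d e])
      then show ?thesis
        using critical_iff[OF smooth c'(1) pc] critical_iff[OF f c'(1) pc] Fn[OF False] by simp
    qed
  qed
qed

end

section \<open>Removing critical points\<close>

text \<open>The derivative vanishes outside the closed ball of radius \<open>R\<close> and is
  bounded on it by compactness, one direction at a time; the bounds along basis vectors add up to a
  bound for all directions.\<close>

lemma bump_derivative_bound:
  fixes \<beta> :: "'a::euclidean_space \<Rightarrow> real"
  assumes \<beta>: "Ck_on 1 UNIV \<beta>" and zero: "\<And>x. R \<le> dist x a \<Longrightarrow> \<beta> x = 0"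
  obtains B where "0 < B" "\<And>x v. \<bar>frechet_derivative \<beta> (at x) v\<bar> \<le> B * norm v"
proof -
  let ?D = "\<lambda>x. frechet_derivative \<beta> (at x)"
  have d: "(\<beta> has_derivative ?D x) (at x)" and c: "continuous_on UNIV (\<lambda>x. ?D x v)" for x v
    using \<beta> by (simp_all add: frechet_derivative_works)
  have out: "?D x v = 0" if "R < dist x a" for x v
  proof -
    have "open {y. R < dist y a}" by (intro open_Collect_less continuous_intros)
    then have "((\<lambda>_. 0) has_derivative ?D x) (at x)"
      using that zero by (intro has_derivative_transform_within_open[OF d, of "{y. R < dist y a}"]) auto
    from has_derivative_unique[OF this has_derivative_const] show ?thesis by metis
  qed
  have "\<exists>b. \<forall>x. \<bar>?D x v\<bar> \<le> b" for v
  proof -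
    have "bounded ((\<lambda>x. ?D x v) ` cball a R)"
      by (intro compact_imp_bounded compact_continuous_image continuous_on_subset[OF c]) auto
    then obtain b where b: "\<forall>x\<in>cball a R. \<bar>?D x v\<bar> \<le> b" by (force simp: bounded_iff)
    have "\<bar>?D x v\<bar> \<le> max b 0" for x
      using bspec[OF b, of x] out[of x v] by (cases "x \<in> cball a R") (auto simp: dist_commute)
    then show ?thesis by blast
  qed
  then obtain b where b: "\<And>x v. \<bar>?D x v\<bar> \<le> b v" by metis
  have "\<bar>?D x v\<bar> \<le> (sum b Basis + 1) * norm v" for x v
  proof -
    have "?D x v = ?D x (\<Sum>i\<in>Basis. (v \<bullet> i) *\<^sub>R i)" by (simp only: euclidean_representation)
    also have "\<dots> = (\<Sum>i\<in>Basis. (v \<bullet> i) * ?D x i)"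
      by (simp add: linear_sum[OF has_derivative_linear[OF d]] linear_cmul[OF has_derivative_linear[OF d]])
    also have "\<bar>\<dots>\<bar> \<le> (\<Sum>i\<in>Basis. norm v * b i)"
      by (rule order_trans[OF sum_abs sum_mono]) (auto simp: abs_mult intro!: mult_mono b Basis_le_norm)
    also have "\<dots> \<le> (sum b Basis + 1) * norm v" by (simp add: sum_distrib_left algebra_simps flip: sum_distrib_left)
    finally show ?thesis .
  qed
  moreover have "0 \<le> b v" for v using b[of 0 v] by linarith
  then have "0 < sum b Basis + 1" by (simp add: add_nonneg_pos sum_nonneg)
  ultimately show thesis using that by blast
qed

section \<open>Localized translations and avoidable points\<close>

context manifold3
begin

text \<open>In the chart the map is \<open>x + \<beta> x *\<^sub>R w\<close> with a bump
  \<open>\<beta>\<close>: a translation up to radius \<open>r\<close>, the identity beyond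
  \<open>2 * r\<close>, and moved points stay within \<open>3 * r\<close>. For short
  \<open>w\<close> the displacement is a contraction, so the map is injective with invertible
  derivative. The half-space is preserved if \<open>w\<close> does not point outwards or the large
  ball lies in the half-space.\<close>

lemma translation_immersion:
  assumes c: "c \<in> A" and r: "0 < r" "cball x\<^sub>0 (3 * r) \<inter> half_space \<subseteq> img c"
  obtains e where "0 < e" "2 * e \<le> r"
    "\<And>w. norm w \<le> e \<Longrightarrow> 0 \<le> w $ 3 \<or> cball x\<^sub>0 (3 * r) \<subseteq> half_space \<Longrightarrow>
      \<exists>F\<in>immersions. (\<forall>p. F p \<in> fst c \<longrightarrow> p \<in> fst c) \<and>
        (\<forall>p\<in>fst c. dist (snd c p) (snd c (F p)) \<le> norm w \<and>
          (dist (snd c p) x\<^sub>0 \<le> r \<longrightarrow> snd c (F p) = snd c p + w \<and> F p \<in> fst c))"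
proof -
  obtain \<beta> :: "real^3 \<Rightarrow> real" where \<beta>: "\<And>k. Ck_on k UNIV \<beta>" "\<And>x. 0 \<le> \<beta> x" "\<And>x. \<beta> x \<le> 1"
    "\<And>x. dist x x\<^sub>0 \<le> r \<Longrightarrow> \<beta> x = 1" "\<And>x. 2 * r \<le> dist x x\<^sub>0 \<Longrightarrow> \<beta> x = 0"
    using smooth_bump[OF r(1)] by blast
  obtain B where B: "0 < B" "\<And>x v. \<bar>frechet_derivative \<beta> (at x) v\<bar> \<le> B * norm v"
    using bump_derivative_bound[OF \<beta>(1) \<beta>(5)] by blast
  \<comment> \<open>\<open>r / 2\<close> keeps moved points within \<open>3 * r\<close>;
    \<open>1 / (2 * B)\<close> makes the Lipschitz constant of the displacement at most 1/2.\<close>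
  define e where "e = min (r / 2) (1 / (2 * B))"
  have e: "0 < e" "2 * e \<le> r" "B * e \<le> 1 / 2"
    using r(1) B(1) by (auto simp: e_def min_def field_simps)
  have d\<beta>: "(\<beta> has_derivative frechet_derivative \<beta> (at x)) (at x)" for x
    by (rule Ck_on_SucD[OF \<beta>(1) UNIV_I])
  have lip: "\<bar>\<beta> x - \<beta> y\<bar> \<le> B * norm (x - y)" for x y
  proof -
    have "onorm (frechet_derivative \<beta> (at x)) \<le> B" for x
      by (rule onorm_bound) (use B in auto)
    then show ?thesis
      using differentiable_bound[of UNIV \<beta> "\<lambda>x. frechet_derivative \<beta> (at x)" B x y] d\<beta> by simp
  qed
  show thesis
  proof (rule that[OF e(1,2)])
    fix w :: "real^3" assume w: "norm w \<le> e" and up: "0 \<le> w $ 3 \<or> cball x\<^sub>0 (3 * r) \<subseteq> half_space"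
    define T where "T x = x + \<beta> x *\<^sub>R w" for x
    have small: "norm (t *\<^sub>R w) \<le> norm z / 2" if "\<bar>t\<bar> \<le> B * norm z" for t and z :: "real^3"
    proof -
      have "norm (t *\<^sub>R w) \<le> (B * norm z) * e"
        using that w by (auto intro!: mult_mono)
      also have "\<dots> \<le> 1 / 2 * norm z" using mult_right_mono[OF e(3), of "norm z"] by (simp add: ac_simps)
      finally show ?thesis by simp
    qed
    have T_smooth: "Ck_on k UNIV T" for k
      unfolding T_def
      by (rule Ck_on_add[OF open_UNIV Ck_on_bounded_linear[OF open_UNIV bounded_linear_ident]
            Ck_on_scaleR[OF open_UNIV \<beta>(1) Ck_on_const[OF open_UNIV]]])
    have DT: "frechet_derivative T (at x) = (\<lambda>v. v + frechet_derivative \<beta> (at x) v *\<^sub>R w)" for x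
    proof (rule frechet_derivative_at[symmetric])
      show "(T has_derivative (\<lambda>v. v + frechet_derivative \<beta> (at x) v *\<^sub>R w)) (at x)"
        unfolding T_def by (intro has_derivative_add has_derivative_ident has_derivative_scaleR_left d\<beta>)
    qed
    have T_inj: "inj T"
    proof (rule injI)
      fix x y assume "T x = T y"
      then have "x - y = (\<beta> y - \<beta> x) *\<^sub>R w" by (simp add: T_def algebra_simps)
      moreover have "norm ((\<beta> y - \<beta> x) *\<^sub>R w) \<le> norm (x - y) / 2"
        by (rule small) (use lip[of y x] in \<open>simp add: norm_minus_commute\<close>)
      ultimately have "norm (x - y) \<le> norm (x - y) / 2" by simp
      then show "x = y" by simp
    qed
    have DT_surj: "surj (frechet_derivative T (at x))" for x
    proof (rule linear_injective_imp_surjective)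
      show l: "linear (frechet_derivative T (at x))"
        by (rule has_derivative_linear[OF Ck_on_SucD[OF T_smooth UNIV_I]])
      have "v = 0" if "frechet_derivative T (at x) v = 0" for v
      proof -
        have "v = - (frechet_derivative \<beta> (at x) v *\<^sub>R w)" using that unfolding DT by (simp add: eq_neg_iff_add_eq_0)
        then have "norm v = norm (frechet_derivative \<beta> (at x) v *\<^sub>R w)" by (metis norm_minus_cancel)
        also have "\<dots> \<le> norm v / 2" by (rule small[OF B(2)])
        finally show ?thesis by simp
      qed
      then show "inj (frechet_derivative T (at x))"
        unfolding linear_injective_0[OF l] by blast
    qed simp
    have dT: "dist x (T x) \<le> norm w" for x
      using \<beta>(2,3)[of x] mult_right_mono[of "\<beta> x" 1 "norm w"] by (simp add: T_def dist_norm)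
    have T_img: "T x \<in> img c" if x: "x \<in> img c" for x
    proof (cases "2 * r \<le> dist x x\<^sub>0")
      case True
      then show ?thesis using x \<beta>(5) by (simp add: T_def)
    next
      case False
      have "dist x\<^sub>0 (T x) \<le> dist x\<^sub>0 x + dist x (T x)" by (rule dist_triangle)
      also have "\<dots> \<le> 3 * r" using False dT[of x] w e r(1) by (simp add: dist_commute)
      finally have ball: "T x \<in> cball x\<^sub>0 (3 * r)" by simp
      have "T x \<in> half_space"
        using up
      proof
        assume "0 \<le> w $ 3"
        moreover have "0 \<le> x $ 3" using x img_half_space[OF c] by (auto simp: half_space_def)
        ultimately show ?thesis using \<beta>(2)[of x] by (simp add: T_def half_space_def)
      qed (use ball in blast)
      then show ?thesis using ball r(2) by blast
    qed
    let ?F = "\<lambda>p. if p \<in> fst c then chart_inv c (T (snd c p)) else p"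
    have "?F \<in> immersions"
    proof (rule chart_immersion[OF c _ _ T_smooth _ T_inj _ DT_surj])
      show "compact (cball x\<^sub>0 (3 * r) \<inter> half_space)"
        by (intro compact_Int_closed compact_cball)
           (simp add: half_space_def closed_Collect_le continuous_on_component)
      show "T ` img c \<subseteq> img c" using T_img by blast
      show "T x = x" if "x \<in> img c" "x \<notin> cball x\<^sub>0 (3 * r) \<inter> half_space" for x
        using that img_half_space[OF c] \<beta>(5)[of x] r(1) by (auto simp: T_def dist_commute)
    qed (rule r(2))
    moreover have F: "?F p \<in> fst c" "snd c (?F p) = T (snd c p)" if "p \<in> fst c" for p
      using that T_img[of "snd c p"] by (simp_all add: chart_inv_in chart_inv_right)
    moreover have "p \<in> fst c" if "?F p \<in> fst c" for p using that by (cases "p \<in> fst c") auto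
    moreover have "dist (snd c p) (snd c (?F p)) \<le> norm w" if "p \<in> fst c" for p
      unfolding F(2)[OF that] by (rule dT)
    moreover have "snd c (?F p) = snd c p + w" if "p \<in> fst c" "dist (snd c p) x\<^sub>0 \<le> r" for p
      unfolding F(2)[OF that(1)] using \<beta>(4)[OF that(2)] by (simp add: T_def)
    ultimately show "\<exists>F\<in>immersions. (\<forall>p. F p \<in> fst c \<longrightarrow> p \<in> fst c) \<and>
        (\<forall>p\<in>fst c. dist (snd c p) (snd c (F p)) \<le> norm w \<and>
          (dist (snd c p) x\<^sub>0 \<le> r \<longrightarrow> snd c (F p) = snd c p + w \<and> F p \<in> fst c))"
      by (intro bexI[of _ ?F] conjI allI ballI impI)
  qed
qed

definition avoidable :: "'a set" where
  "avoidable = {p \<in> topspace X. \<exists>F\<in>immersions. p \<notin> F ` topspace X}"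

lemma chart_ball:
  assumes c: "c \<in> A" and p: "p \<in> fst c"
  obtains r where "0 < r" "cball (snd c p) (3 * r) \<inter> half_space \<subseteq> img c"
    "0 < snd c p $ 3 \<Longrightarrow> cball (snd c p) (3 * r) \<subseteq> half_space"
proof -
  obtain U where U: "open U" "img c = half_space \<inter> U"
    using open_img[OF c] by (auto simp: openin_open)
  have "snd c p \<in> U" using U(2) p by blast
  then obtain \<delta> where \<delta>: "0 < \<delta>" "cball (snd c p) \<delta> \<subseteq> U" using U(1) open_contains_cball by blast
  define s where "s = (if 0 < snd c p $ 3 then min \<delta> (snd c p $ 3) else \<delta>)"
  have s: "0 < s" "s \<le> \<delta>" "0 < snd c p $ 3 \<Longrightarrow> s \<le> snd c p $ 3" using \<delta>(1) by (auto simp: s_def)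
  show thesis
  proof (rule that[of "s / 3"])
    show "0 < s / 3" using s(1) by simp
    show "cball (snd c p) (3 * (s / 3)) \<inter> half_space \<subseteq> img c"
      using U(2) \<delta>(2) s(2) by auto
    show "cball (snd c p) (3 * (s / 3)) \<subseteq> half_space" if "0 < snd c p $ 3"
    proof
      fix x assume "x \<in> cball (snd c p) (3 * (s / 3))"
      then have "norm (snd c p - x) \<le> s" by (simp add: dist_norm)
      then have "\<bar>(snd c p - x) $ 3\<bar> \<le> s" using component_le_norm_cart order_trans by blast
      then show "x \<in> half_space" using s(3)[OF that] by (simp add: half_space_def)
    qed
  qed
qed

text \<open>Near an interior point some translation takes any point to any other. At a boundary
  point an inward translation by \<open>e\<close> raises everything nearby to height at least
  \<open>e\<close>, so points of smaller height have no preimage.\<close>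

lemma local_homogeneity:
  assumes c: "c \<in> A" "p \<in> fst c"
  obtains U where "openin X U" "p \<in> U"
    "0 < snd c p $ 3 \<longrightarrow> (\<forall>q\<in>U. \<forall>q'\<in>U. \<exists>F\<in>immersions. F q = q')"
    "snd c p $ 3 = 0 \<longrightarrow> U \<subseteq> avoidable"
proof -
  obtain r where r: "0 < r" "cball (snd c p) (3 * r) \<inter> half_space \<subseteq> img c"
    "0 < snd c p $ 3 \<Longrightarrow> cball (snd c p) (3 * r) \<subseteq> half_space"
    using chart_ball[OF c] by blast
  obtain e where e: "0 < e" "2 * e \<le> r" and F: "\<And>w. norm w \<le> e \<Longrightarrow>
      0 \<le> w $ 3 \<or> cball (snd c p) (3 * r) \<subseteq> half_space \<Longrightarrow>
      \<exists>F\<in>immersions. (\<forall>q. F q \<in> fst c \<longrightarrow> q \<in> fst c) \<and>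
        (\<forall>q\<in>fst c. dist (snd c q) (snd c (F q)) \<le> norm w \<and>
          (dist (snd c q) (snd c p) \<le> r \<longrightarrow> snd c (F q) = snd c q + w \<and> F q \<in> fst c))"
    using translation_immersion[OF c(1) r(1,2)] by blast
  \<comment> \<open>Radius \<open>e / 2\<close> makes differences of two points of \<open>?V\<close>
    at most \<open>e\<close> long, and keeps heights below \<open>e / 2\<close> if \<open>p\<close>
    is a boundary point.\<close>
  let ?V = "half_space \<inter> ball (snd c p) (e / 2)"
  let ?U = "chart_inv c ` ?V"
  have "ball (snd c p) (e / 2) \<subseteq> cball (snd c p) (3 * r)"
    using e r(1) by (auto intro!: ball_subset_cball[THEN order_trans] subset_cball)
  then have V: "?V \<subseteq> img c" using r(2) by blast
  have xp: "snd c p \<in> half_space" using img_half_space[OF c(1)] c(2) by blast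
  have U: "openin X ?U" by (rule open_chart_inv[OF c(1) _ V]) (simp add: openin_open_Int)
  have pU: "p \<in> ?U"
    using inv_chart[OF c] e(1) xp by (intro image_eqI[of _ _ "snd c p"]) auto
  have Uc: "q \<in> fst c" "dist (snd c q) (snd c p) < e / 2" "snd c q \<in> half_space" if "q \<in> ?U" for q
  proof -
    obtain y where y: "y \<in> ?V" "q = chart_inv c y" using \<open>q \<in> ?U\<close> by blast
    then have "y \<in> img c" using V by blast
    then show "q \<in> fst c" "dist (snd c q) (snd c p) < e / 2" "snd c q \<in> half_space"
      using y by (simp_all add: chart_inv_in chart_inv_right dist_commute)
  qed
  show thesis
  proof (rule that[OF U pU]; rule impI)
    assume pos: "0 < snd c p $ 3"
    have "\<exists>F\<in>immersions. F q = q'" if q: "q \<in> ?U" "q' \<in> ?U" for q q'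
    proof -
      have "norm (snd c q' - snd c q) \<le> e"
        using Uc(2)[OF q(1)] Uc(2)[OF q(2)] dist_triangle2[of "snd c q'" "snd c q" "snd c p"]
        by (simp add: dist_norm)
      from F[OF this] r(3)[OF pos] obtain F where "F \<in> immersions"
        "\<forall>z\<in>fst c. dist (snd c z) (snd c p) \<le> r \<longrightarrow> snd c (F z) = snd c z + (snd c q' - snd c q) \<and> F z \<in> fst c"
        by blast
      moreover have "dist (snd c q) (snd c p) \<le> r" using Uc(2)[OF q(1)] e by simp
      ultimately have F: "F \<in> immersions" "snd c (F q) = snd c q'" "F q \<in> fst c" using Uc(1)[OF q(1)] by auto
      have "F q = chart_inv c (snd c (F q))" using inv_chart[OF c(1) F(3)] by simp
      also have "\<dots> = q'" unfolding F(2) by (rule inv_chart[OF c(1) Uc(1)[OF q(2)]])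
      finally show ?thesis using F(1) by blast
    qed
    then show "\<forall>q\<in>?U. \<forall>q'\<in>?U. \<exists>F\<in>immersions. F q = q'" by blast
  next
    assume p3: "snd c p $ 3 = 0"
    define w :: "real^3" where "w = axis 3 e"
    have w: "norm w = e" "w $ 3 = e" using e(1) by (simp_all add: w_def norm_eq_sqrt_inner inner_axis_axis)
    obtain F where F: "F \<in> immersions" "\<forall>q. F q \<in> fst c \<longrightarrow> q \<in> fst c"
      "\<forall>q\<in>fst c. dist (snd c q) (snd c (F q)) \<le> norm w \<and>
          (dist (snd c q) (snd c p) \<le> r \<longrightarrow> snd c (F q) = snd c q + w \<and> F q \<in> fst c)"
      using F[of w] w e(1) by auto
    have "q \<in> avoidable" if q: "q \<in> ?U" for q
    proof -
      have "F z \<noteq> q" for z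
      proof
        assume z: "F z = q"
        then have zc: "z \<in> fst c" using F(2) Uc(1)[OF q] by blast
        have "dist (snd c z) (snd c q) \<le> e" using F(3) zc z w(1) by auto
        \<comment> \<open>A preimage \<open>z\<close> lies within
          \<open>e + e / 2 \<le> 2 * e \<le> r\<close> of \<open>p\<close> in the chart, where the
          map is an exact translation.\<close>
        then have "dist (snd c z) (snd c p) \<le> r"
          using Uc(2)[OF q] dist_triangle[of "snd c z" "snd c p" "snd c q"] e by (simp add: dist_commute)
        then have "snd c q = snd c z + w" using F(3) zc z by auto
        moreover have "0 \<le> snd c z $ 3" using img_half_space[OF c(1)] zc by (auto simp: half_space_def)
        ultimately have "e \<le> (snd c q - snd c p) $ 3" using w(2) p3 by simp
        also have "\<dots> \<le> norm (snd c q - snd c p)" using component_le_norm_cart by (metis abs_le_D1)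
        finally show False using Uc(2)[OF q] e(1) by (simp add: dist_norm)
      qed
      moreover have "q \<in> topspace X" using Uc(1)[OF q] chart_subset[OF c(1)] by blast
      moreover from calculation have "q \<notin> F ` topspace X" by auto
      ultimately show ?thesis
        unfolding avoidable_def using F(1) by (intro CollectI conjI bexI[of _ F])
    qed
    then show "?U \<subseteq> avoidable" by blast
  qed
qed

text \<open>If \<open>F\<close> misses \<open>p\<close>, then \<open>H \<circ> F\<close> misses
  \<open>H p\<close>, since \<open>H\<close> is injective.\<close>

lemma avoidable_image:
  assumes p: "p \<in> avoidable" and H: "H \<in> immersions"
  shows "H p \<in> avoidable"
proof -
  obtain F where F: "F \<in> immersions" "p \<notin> F ` topspace X" and pX: "p \<in> topspace X"
    using p unfolding avoidable_def by blast
  have "H p \<notin> (H \<circ> F) ` topspace X"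
  proof
    assume "H p \<in> (H \<circ> F) ` topspace X"
    then obtain z where z: "z \<in> topspace X" "H p = H (F z)" by auto
    have "p = F z" by (rule inj_onD[OF immersionsD(2)[OF H] z(2) pX immersionsD(1)[OF F(1) z(1)]])
    then show False using F(2) z(1) by blast
  qed
  then show ?thesis
    using immersions_compose[OF F(1) H] immersionsD(1)[OF H pX] unfolding avoidable_def by blast
qed

text \<open>Near each point avoidability is all or nothing: it holds throughout near a boundary
  point, and near an interior point it passes from any point to every other.\<close>

theorem all_avoidable:
  assumes "connected_space X" "manifold_boundary A \<noteq> {}"
  shows "avoidable = topspace X"
proof -
  have sub: "avoidable \<subseteq> topspace X" by (auto simp: avoidable_def)
  have "\<exists>U. openin X U \<and> p \<in> U \<and> (U \<subseteq> avoidable \<or> U \<inter> avoidable = {})" if p: "p \<in> topspace X" for p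
  proof -
    obtain c where c: "c \<in> A" "p \<in> fst c" using chart_at[OF p] by blast
    obtain U where U: "openin X U" "p \<in> U" "0 < snd c p $ 3 \<longrightarrow> (\<forall>q\<in>U. \<forall>q'\<in>U. \<exists>F\<in>immersions. F q = q')"
      "snd c p $ 3 = 0 \<longrightarrow> U \<subseteq> avoidable"
      by (rule local_homogeneity[OF c])
    have "0 \<le> snd c p $ 3" using img_half_space[OF c(1)] c(2) by (auto simp: half_space_def)
    then consider "0 < snd c p $ 3" | "snd c p $ 3 = 0" by linarith
    then have "U \<subseteq> avoidable \<or> U \<inter> avoidable = {}"
    proof cases
      case 1
      have "q' \<in> avoidable" if q: "q \<in> U" "q \<in> avoidable" "q' \<in> U" for q q'
      proof -
        obtain F where "F \<in> immersions" "F q = q'" using U(3) 1 q(1,3) by blast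
        then show ?thesis using avoidable_image[OF q(2), of F] by simp
      qed
      then show ?thesis by blast
    qed (use U(4) in blast)
    then show ?thesis using U(1,2) by blast
  qed
  then obtain U where U: "\<And>p. p \<in> topspace X \<Longrightarrow> openin X (U p) \<and> p \<in> U p \<and>
      (U p \<subseteq> avoidable \<or> U p \<inter> avoidable = {})" by metis
  have "openin X avoidable"
    unfolding openin_subopen[of X avoidable] using U sub by blast
  moreover have "openin X (topspace X - avoidable)"
    unfolding openin_subopen[of X "topspace X - avoidable"]
  proof
    fix p assume "p \<in> topspace X - avoidable"
    then have "p \<in> U p" "openin X (U p)" "U p \<inter> avoidable = {}" using U[of p] by blast+
    then show "\<exists>T. openin X T \<and> p \<in> T \<and> T \<subseteq> topspace X - avoidable"
      using openin_subset by (intro exI[of _ "U p"]) blast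
  qed
  ultimately have "avoidable = {} \<or> avoidable = topspace X"
    using assms(1) sub unfolding connected_space_clopen_in closedin_def by blast
  moreover have "avoidable \<noteq> {}"
  proof -
    obtain p c where c: "c \<in> A" "p \<in> fst c" "snd c p $ 3 = 0"
      using assms(2) unfolding manifold_boundary_def by blast
    obtain U where "p \<in> U" "snd c p $ 3 = 0 \<longrightarrow> U \<subseteq> avoidable"
      by (rule local_homogeneity[OF c(1,2)])
    then show ?thesis using c(3) by blast
  qed
  ultimately show ?thesis by blast
qed

text \<open>\<open>F\<close> maps the critical points of \<open>f \<circ> F\<close> injectively to
  those of \<open>f\<close>, and none of them to \<open>p\<close>.\<close>

lemma fewer_critical_points:
  assumes f: "smooth_function A f" and fin: "finite {p \<in> topspace X. critical f p}"
    and p: "p \<in> topspace X" "critical f p" "p \<in> avoidable"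
  obtains h where "smooth_function A h" "finite {p \<in> topspace X. critical h p}"
    "card {p \<in> topspace X. critical h p} < card {p \<in> topspace X. critical f p}"
proof -
  obtain F where F: "F \<in> immersions" "p \<notin> F ` topspace X"
    using p(3) unfolding avoidable_def by blast
  let ?C = "{p \<in> topspace X. critical f p}" and ?D = "{p \<in> topspace X. critical (f \<circ> F) p}"
  have sub: "F ` ?D \<subseteq> ?C - {p}"
  proof
    fix y assume "y \<in> F ` ?D"
    then obtain z where z: "z \<in> topspace X" "critical (f \<circ> F) z" "y = F z" by blast
    then show "y \<in> ?C - {p}"
      using immersionsD(4)[OF F(1) f z(1)] immersionsD(1)[OF F(1) z(1)] F(2) by auto
  qed
  have inj: "inj_on F ?D" by (rule inj_on_subset[OF immersionsD(2)[OF F(1)]]) blast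
  have fin': "finite (F ` ?D)" by (rule finite_subset[OF sub]) (use fin in simp)
  have "card ?D = card (F ` ?D)" by (rule card_image[OF inj, symmetric])
  also have "\<dots> \<le> card (?C - {p})" by (rule card_mono[OF _ sub]) (use fin in simp)
  also have "\<dots> < card ?C" by (rule card_Diff1_less[OF fin]) (use p in simp)
  finally have "card ?D < card ?C" .
  then show thesis
    by (rule that[OF immersionsD(3)[OF F(1) f] finite_imageD[OF fin' inj]])
qed

lemma remove_critical_points:
  assumes "connected_space X" "manifold_boundary A \<noteq> {}"
  shows "smooth_function A f \<Longrightarrow> finite {p \<in> topspace X. critical f p} \<Longrightarrow>
    \<exists>h. smooth_function A h \<and> (\<forall>p\<in>topspace X. \<not> critical h p)"
proof (induction "card {p \<in> topspace X. critical f p}" arbitrary: f rule: less_induct)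
  case less
  show ?case
  proof (cases "\<exists>p\<in>topspace X. critical f p")
    case True
    then obtain p where p: "p \<in> topspace X" "critical f p" by blast
    have "p \<in> avoidable" using all_avoidable[OF assms] p(1) by simp
    from fewer_critical_points[OF less.prems p this] obtain h where h: "smooth_function A h"
      "finite {p \<in> topspace X. critical h p}"
      "card {p \<in> topspace X. critical h p} < card {p \<in> topspace X. critical f p}" .
    show ?thesis by (rule less.hyps[OF h(3,1,2)])
  qed (use less.prems in blast)
qed

end

section \<open>Functions with finitely many critical points\<close>

text \<open>The Euclidean gradient in coordinates, as distinct from the metric gradient
  \<open>grad\<close>.\<close>

definition gradient :: "(real^3 \<Rightarrow> real) \<Rightarrow> real^3 \<Rightarrow> real^3" where
  "gradient h x = (\<chi> i. Dh h x (axis i 1))"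

definition hessian :: "(real^3 \<Rightarrow> real) \<Rightarrow> real^3 \<Rightarrow> real^3^3" where
  "hessian h x = (\<chi> i j. Dh (\<lambda>y. Dh h y (axis i 1)) x (axis j 1))"

text \<open>The Morse condition at a single point. At boundary points all three partial derivatives
  count, as at interior points, in agreement with \<open>critical\<close>.\<close>

definition morse_at :: "(real^3 \<Rightarrow> real) \<Rightarrow> real^3 \<Rightarrow> bool" where
  "morse_at h x \<longleftrightarrow> gradient h x \<noteq> 0 \<or> det (hessian h x) \<noteq> 0"

lemma gradient_eq_0_iff:
  assumes S: "openin (top_of_set half_space) S" "x \<in> S" and h: "smooth_on S h"
  shows "gradient h x = 0 \<longleftrightarrow> (\<forall>v. Dh h x v = 0)"
proof
  assume "gradient h x = 0"
  then have 0: "Dh h x (axis i 1) = 0" for i by (simp add: gradient_def vec_eq_iff)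
  have "Dh h x v = (\<Sum>i\<in>UNIV. v $ i *\<^sub>R Dh h x (axis i 1))" for v
    by (rule linear_vec3_expansion[OF has_derivative_linear[OF smooth_on_has_Dh(1)[OF S h]]])
  then show "\<forall>v. Dh h x v = 0" by (simp add: 0)
qed (simp add: gradient_def vec_eq_iff)

lemma gradient_has_derivative:
  assumes S: "openin (top_of_set half_space) S" "x \<in> S" and h: "smooth_on S h"
  shows "(gradient h has_derivative (*v) (hessian h x)) (at x within half_space)"
  unfolding has_derivative_componentwise_within[of "gradient h"]
proof
  fix b :: "real^3" assume "b \<in> Basis"
  then obtain i where b: "b = axis i 1" by (auto simp: Basis_vec_def)
  let ?D = "Dh (\<lambda>y. Dh h y (axis i 1)) x"
  have D: "((\<lambda>y. Dh h y (axis i 1)) has_derivative ?D) (at x within half_space)"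
    by (rule smooth_on_has_Dh(1)[OF S smooth_on_Dh[OF S(1) h]])
  have "(\<lambda>v. (hessian h x *v v) \<bullet> b) = ?D"
  proof
    fix v
    have "(hessian h x *v v) \<bullet> b = (\<Sum>j\<in>UNIV. v $ j *\<^sub>R ?D (axis j 1))"
      by (simp add: b inner_axis hessian_def matrix_vector_mult_def mult.commute)
    also have "\<dots> = ?D v"
      by (rule linear_vec3_expansion[OF has_derivative_linear[OF D], symmetric])
    finally show "(hessian h x *v v) \<bullet> b = ?D v" .
  qed
  then show "((\<lambda>y. gradient h y \<bullet> b) has_derivative (\<lambda>v. (hessian h x *v v) \<bullet> b)) (at x within half_space)"
    using D by (simp add: b inner_axis gradient_def)
qed

lemma closed_half_space: "closed half_space"
  by (simp add: half_space_def closed_Collect_le continuous_on_component)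

text \<open>A limit of zeros of the gradient is again a zero, by continuity. There the Hessian is
  invertible, hence bounded below by some \<open>B\<close>, and linear approximation with error
  \<open>B / 2\<close> excludes other zeros nearby.\<close>

lemma finite_gradient_zeros:
  assumes S: "openin (top_of_set half_space) S" and h: "smooth_on S h"
    and K: "compact K" "K \<subseteq> S" and morse: "\<And>x. x \<in> K \<Longrightarrow> morse_at h x"
  shows "finite {x \<in> K. gradient h x = 0}"
proof (rule ccontr)
  assume "infinite {x \<in> K. gradient h x = 0}"
  then obtain x where x: "x \<in> K" "x islimpt {x \<in> K. gradient h x = 0}"
    using K(1) unfolding compact_eq_Bolzano_Weierstrass by (metis (no_types, lifting) mem_Collect_eq subsetI)
  have xS: "x \<in> S" using x K by blast
  note d = gradient_has_derivative[OF S xS h]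
  have sub: "{x \<in> K. gradient h x = 0} \<subseteq> half_space"
    using K(2) openin_imp_subset[OF S] by blast
  have "gradient h x = 0"
  proof -
    have "(gradient h \<longlongrightarrow> gradient h x) (at x within half_space)"
      using has_derivative_continuous[OF d] by (simp add: continuous_within)
    then have "(gradient h \<longlongrightarrow> gradient h x) (at x within {x \<in> K. gradient h x = 0})"
      by (rule tendsto_within_subset[OF _ sub])
    moreover have "(gradient h \<longlongrightarrow> 0) (at x within {x \<in> K. gradient h x = 0})"
      by (rule Lim_transform_eventually[OF tendsto_const]) (simp add: eventually_at_filter)
    ultimately show ?thesis
      using x(2) tendsto_unique trivial_limit_within by blast
  qed
  then have "det (hessian h x) \<noteq> 0" using morse[OF x(1)] by (simp add: morse_at_def)
  then have "inj ((*v) (hessian h x))"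
    using det_nz_iff_inj[OF matrix_vector_mul_linear[of "hessian h x"]] by simp
  then obtain B where B: "0 < B" "\<And>v. B * norm v \<le> norm (hessian h x *v v)"
    using linear_inj_bounded_below_pos[OF matrix_vector_mul_linear] by blast
  have "0 < B / 2" using B(1) by simp
  then obtain \<delta> where \<delta>: "0 < \<delta>" "\<forall>y\<in>half_space. norm (y - x) < \<delta> \<longrightarrow>
      norm (gradient h y - gradient h x - hessian h x *v (y - x)) \<le> B / 2 * norm (y - x)"
    using d unfolding has_derivative_within_alt by blast
  obtain y where y: "y \<in> K" "gradient h y = 0" "y \<noteq> x" "dist y x < \<delta>"
    using x(2) \<delta>(1) unfolding islimpt_approachable by blast
  have "y \<in> half_space" using y(1,2) sub by blast
  then have "norm (hessian h x *v (y - x)) \<le> B / 2 * norm (y - x)"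
    using \<delta>(2) y(2,4) \<open>gradient h x = 0\<close> by (auto simp: dist_norm)
  then have "B * norm (y - x) \<le> B / 2 * norm (y - x)" using B(2)[of "y - x"] by linarith
  then show False using B(1) y(3) by simp
qed

text \<open>Sard's theorem for the gradient as a map into \<open>real^3\<close>: its derivative is
  the Hessian, so its singular points are those with vanishing Hessian determinant.\<close>

lemma negligible_degenerate_values:
  assumes S: "openin (top_of_set half_space) S" and h: "smooth_on S h"
  shows "negligible (gradient h ` {x \<in> S. det (hessian h x) = 0})"
proof (rule baby_Sard)
  fix x assume x: "x \<in> {x \<in> S. det (hessian h x) = 0}"
  show "(gradient h has_derivative (*v) (hessian h x)) (at x within {x \<in> S. det (hessian h x) = 0})"
    by (rule has_derivative_subset[OF gradient_has_derivative[OF S _ h]])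
       (use x openin_imp_subset[OF S] in auto)
  show "rank (matrix ((*v) (hessian h x))) < CARD(3)"
    using x det_nz_iff_inj[OF matrix_vector_mul_linear[of "hessian h x"]]
      less_rank_noninjective[of "hessian h x"] by simp
qed simp

lemma Dh_affine_combination:
  fixes h :: "real^3 \<Rightarrow> real" and e :: "3 \<Rightarrow> real^3 \<Rightarrow> real"
  assumes S: "openin (top_of_set half_space) S" "x \<in> S" and h: "smooth_on S h" and e: "\<And>k. smooth_on S (e k)"
  shows "Dh (\<lambda>y. h y - (\<Sum>k\<in>UNIV. a $ k * e k y)) x v = Dh h x v - (\<Sum>k\<in>UNIV. a $ k * Dh (e k) x v)"
proof -
  have "((\<lambda>y. h y - (\<Sum>k\<in>UNIV. a $ k * e k y)) has_derivative
      (\<lambda>v. Dh h x v - (\<Sum>k\<in>UNIV. a $ k * Dh (e k) x v))) (at x within half_space)"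
    by (intro has_derivative_diff has_derivative_sum has_derivative_mult_right
        smooth_on_has_Dh(1)[OF S h] smooth_on_has_Dh(1)[OF S e])
  moreover have "x \<in> half_space" using S openin_imp_subset by blast
  ultimately have "Dh (\<lambda>y. h y - (\<Sum>k\<in>UNIV. a $ k * e k y)) x =
      (\<lambda>v. Dh h x v - (\<Sum>k\<in>UNIV. a $ k * Dh (e k) x v))"
    by (intro half_space_derivative_unique)
  then show ?thesis by (simp only:)
qed

lemma Dh2_affine_combination:
  fixes h :: "real^3 \<Rightarrow> real" and e :: "3 \<Rightarrow> real^3 \<Rightarrow> real"
  assumes S: "openin (top_of_set half_space) S" "x \<in> S" and h: "smooth_on S h" and e: "\<And>k. smooth_on S (e k)"
  shows "Dh (\<lambda>y. Dh (\<lambda>y. h y - (\<Sum>k\<in>UNIV. a $ k * e k y)) y w) x v =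
    Dh (\<lambda>y. Dh h y w) x v - (\<Sum>k\<in>UNIV. a $ k * Dh (\<lambda>y. Dh (e k) y w) x v)"
proof -
  have sm: "smooth_on S (\<lambda>y. Dh h y w)" "smooth_on S (\<lambda>y. Dh (e k) y w)" for k
    by (rule smooth_on_Dh[OF S(1) h] smooth_on_Dh[OF S(1) e])+
  have "((\<lambda>y. Dh h y w - (\<Sum>k\<in>UNIV. a $ k * Dh (e k) y w)) has_derivative
      (\<lambda>v. Dh (\<lambda>y. Dh h y w) x v - (\<Sum>k\<in>UNIV. a $ k * Dh (\<lambda>y. Dh (e k) y w) x v))) (at x within half_space)"
    by (intro has_derivative_diff has_derivative_sum has_derivative_mult_right
        smooth_on_has_Dh(1)[OF S sm(1)] smooth_on_has_Dh(1)[OF S sm(2)])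
  then have "Dh (\<lambda>y. Dh (\<lambda>y. h y - (\<Sum>k\<in>UNIV. a $ k * e k y)) y w) x =
      (\<lambda>v. Dh (\<lambda>y. Dh h y w) x v - (\<Sum>k\<in>UNIV. a $ k * Dh (\<lambda>y. Dh (e k) y w) x v))"
    by (rule has_Dh_eqI(2)[OF S]) (rule Dh_affine_combination[OF S(1) _ h e, symmetric])
  then show ?thesis by (simp only:)
qed

text \<open>Being Morse on a compact set is stable under small perturbations, so it can be achieved one
  chart at a time.\<close>

lemma morse_stable:
  fixes h :: "real^3 \<Rightarrow> real" and e :: "3 \<Rightarrow> real^3 \<Rightarrow> real"
  assumes S: "openin (top_of_set half_space) S" and h: "smooth_on S h" and e: "\<And>k. smooth_on S (e k)"
    and K: "compact K" "K \<subseteq> S" and morse: "\<And>x. x \<in> K \<Longrightarrow> morse_at h x"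
  obtains \<delta> where "0 < \<delta>"
    "\<forall>a x. norm (a :: real^3) < \<delta> \<longrightarrow> x \<in> K \<longrightarrow> morse_at (\<lambda>y. h y - (\<Sum>k\<in>UNIV. a $ k * e k y)) x"
proof -
  \<comment> \<open>A function of point and parameter that vanishes exactly where the perturbed
    function fails to be Morse.\<close>
  define N where "N p = (norm (gradient (\<lambda>y. h y - (\<Sum>k\<in>UNIV. snd p $ k * e k y)) (fst p)))\<^sup>2 +
    (det (hessian (\<lambda>y. h y - (\<Sum>k\<in>UNIV. snd p $ k * e k y)) (fst p)))\<^sup>2" for p :: "(real^3) \<times> (real^3)"
  define D where "D = K \<times> (cball 0 1 :: (real^3) set)"
  have cD: "compact D" unfolding D_def by (intro compact_Times K compact_cball)
  have fD: "continuous_on D (\<lambda>p. f (fst p))" if "smooth_on S f" for f :: "real^3 \<Rightarrow> real"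
    by (rule continuous_on_compose2[OF smooth_on_imp_continuous_on[OF that] continuous_on_fst[OF continuous_on_id]])
       (use K(2) in \<open>auto simp: D_def\<close>)
  have g: "continuous_on D (\<lambda>p. Dh h (fst p) v - (\<Sum>k\<in>UNIV. snd p $ k * Dh (e k) (fst p) v))" for v
    by (intro continuous_intros fD smooth_on_Dh[OF S] h e)
  have H: "continuous_on D (\<lambda>p. Dh (\<lambda>y. Dh h y w) (fst p) v -
      (\<Sum>k\<in>UNIV. snd p $ k * Dh (\<lambda>y. Dh (e k) y w) (fst p) v))" for v w
    by (intro continuous_intros fD smooth_on_Dh[OF S] h e)
  have N_eq: "N p = (norm (\<chi> i. Dh h (fst p) (axis i 1) - (\<Sum>k\<in>UNIV. snd p $ k * Dh (e k) (fst p) (axis i 1))))\<^sup>2 +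
    (det (\<chi> i j. Dh (\<lambda>y. Dh h y (axis i 1)) (fst p) (axis j 1) -
      (\<Sum>k\<in>UNIV. snd p $ k * Dh (\<lambda>y. Dh (e k) y (axis i 1)) (fst p) (axis j 1))))\<^sup>2" if "p \<in> D" for p
  proof -
    have x: "fst p \<in> S" using that K(2) by (auto simp: D_def)
    show ?thesis
      unfolding N_def gradient_def hessian_def Dh2_affine_combination[OF S x h e] Dh_affine_combination[OF S x h e] ..
  qed
  have "continuous_on D (\<lambda>p. (norm (\<chi> i. Dh h (fst p) (axis i 1) - (\<Sum>k\<in>UNIV. snd p $ k * Dh (e k) (fst p) (axis i 1))))\<^sup>2 +
    (det (\<chi> i j. Dh (\<lambda>y. Dh h y (axis i 1)) (fst p) (axis j 1) -
      (\<Sum>k\<in>UNIV. snd p $ k * Dh (\<lambda>y. Dh (e k) y (axis i 1)) (fst p) (axis j 1))))\<^sup>2)"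
    unfolding det_def
    by (intro continuous_on_add continuous_on_power continuous_on_norm continuous_on_vec_lambda g
        continuous_on_sum continuous_on_mult continuous_on_const continuous_on_prod)
       (simp_all add: H)
  then have cN: "continuous_on D N"
    by (rule continuous_on_eq) (rule N_eq[symmetric])
  define Z where "Z = {p \<in> D. N p = 0}"
  have "compact Z"
    unfolding Z_def using continuous_closedin_preimage_constant[OF cN, of 0] cD closedin_compact by blast
  then have "compact (snd ` Z)" by (intro compact_continuous_image continuous_on_snd continuous_on_id)
  \<comment> \<open>Projecting the compact failure set to the parameters gives a closed set; it
    misses 0, hence a whole ball around 0.\<close>
  then have "open (- (snd ` Z))" by (intro open_Compl compact_imp_closed)
  moreover have "0 \<notin> snd ` Z"
  proof
    assume "0 \<in> snd ` Z"
    then obtain x where "x \<in> K" "N (x, 0) = 0" by (force simp: Z_def D_def)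
    then show False using morse[of x] by (simp add: N_def morse_at_def sum_power2_eq_zero_iff)
  qed
  ultimately obtain \<delta> where \<delta>: "0 < \<delta>" "ball 0 \<delta> \<subseteq> - (snd ` Z)"
    unfolding open_contains_ball by (metis ComplI)
  show thesis
  proof (rule that[of "min \<delta> 1"], safe)
    fix a x :: "real^3" assume a: "norm a < min \<delta> 1" and x: "x \<in> K"
    have "a \<notin> snd ` Z" using a \<delta>(2) by (auto simp: dist_norm)
    moreover have "(x, a) \<in> D" using a x by (simp add: D_def dist_norm)
    ultimately have "N (x, a) \<noteq> 0" by (force simp: Z_def)
    then show "morse_at (\<lambda>y. h y - (\<Sum>k\<in>UNIV. a $ k * e k y)) x"
      by (auto simp: N_def morse_at_def)
  qed (use \<delta> in simp)
qed

section \<open>Morse functions over a finite cover by half-balls\<close>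

context manifold3
begin

text \<open>The factor \<open>3\<close> leaves room for a bump function that is constant near the ball of radius \<open>r\<close>.\<close>

definition chart_ball_data :: "'a chart \<times> (real^3) \<times> real \<Rightarrow> bool" where
  "chart_ball_data = (\<lambda>(c, x\<^sub>0, r). c \<in> A \<and> 0 < r \<and> cball x\<^sub>0 (3 * r) \<inter> half_space \<subseteq> img c)"

abbreviation half_ball :: "'a chart \<times> (real^3) \<times> real \<Rightarrow> (real^3) set" where
  "half_ball t \<equiv> cball (fst (snd t)) (snd (snd t)) \<inter> half_space"

lemma half_ball:
  assumes "chart_ball_data t"
  shows "compact (half_ball t)" "half_ball t \<subseteq> img (fst t)"
proof -
  obtain c x\<^sub>0 r where t: "t = (c, x\<^sub>0, r)" by (cases t)
  show "compact (half_ball t)" by (rule compact_Int_closed[OF compact_cball closed_half_space])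
  have "cball x\<^sub>0 r \<subseteq> cball x\<^sub>0 (3 * r)" using assms by (auto simp: t chart_ball_data_def)
  then show "half_ball t \<subseteq> img (fst t)" using assms by (auto simp: t chart_ball_data_def)
qed

text \<open>Open half-balls are used to extract a finite cover; their closed versions are kept
  because the estimates are made on compact sets.\<close>

lemma finite_chart_ball_cover:
  assumes "compact_space X"
  obtains D where "finite D" "\<And>t. t \<in> D \<Longrightarrow> chart_ball_data t"
    "topspace X \<subseteq> (\<Union>t\<in>D. chart_inv (fst t) ` half_ball t)"
proof -
  have "\<exists>t. chart_ball_data t \<and> p \<in> chart_inv (fst t) ` (half_space \<inter> ball (fst (snd t)) (snd (snd t)))"
    if p: "p \<in> topspace X" for p
  proof -
    obtain c where c: "c \<in> A" "p \<in> fst c" using chart_at[OF p] by blast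
    obtain r where r: "0 < r" "cball (snd c p) (3 * r) \<inter> half_space \<subseteq> img c"
      using chart_ball[OF c] by blast
    have "snd c p \<in> half_space" using img_half_space[OF c(1)] c(2) by blast
    then have "p \<in> chart_inv c ` (half_space \<inter> ball (snd c p) r)"
      using inv_chart[OF c] r(1) by (intro image_eqI[of _ _ "snd c p"]) auto
    then show ?thesis
      using c r by (intro exI[of _ "(c, snd c p, r)"]) (simp add: chart_ball_data_def)
  qed
  then obtain t where t: "\<And>p. p \<in> topspace X \<Longrightarrow> chart_ball_data (t p) \<and>
      p \<in> chart_inv (fst (t p)) ` (half_space \<inter> ball (fst (snd (t p))) (snd (snd (t p))))" by metis
  let ?U = "\<lambda>p. chart_inv (fst (t p)) ` (half_space \<inter> ball (fst (snd (t p))) (snd (snd (t p))))"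
  have "openin X (?U p)" if "p \<in> topspace X" for p
  proof (rule open_chart_inv)
    show "fst (t p) \<in> A" using t[OF that] by (auto simp: chart_ball_data_def)
    show "openin (top_of_set half_space) (half_space \<inter> ball (fst (snd (t p))) (snd (snd (t p))))"
      by (simp add: openin_open_Int)
    show "half_space \<inter> ball (fst (snd (t p))) (snd (snd (t p))) \<subseteq> img (fst (t p))"
      using half_ball(2)[of "t p"] t[OF that] ball_subset_cball by blast
  qed
  then have "\<forall>U\<in>?U ` topspace X. openin X U" by blast
  moreover have "topspace X \<subseteq> \<Union> (?U ` topspace X)" using t by blast
  ultimately obtain \<F> where \<F>: "finite \<F>" "\<F> \<subseteq> ?U ` topspace X" "topspace X \<subseteq> \<Union> \<F>"
    using assms unfolding compact_space_alt by meson
  obtain P where P: "P \<subseteq> topspace X" "finite P" "\<F> = ?U ` P"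
    using finite_subset_image[OF \<F>(1,2)] by blast
  show thesis
  proof (rule that[of "t ` P"])
    show "finite (t ` P)" using P(2) by simp
    show "chart_ball_data s" if "s \<in> t ` P" for s using that t P(1) by blast
    have sub: "?U p \<subseteq> chart_inv (fst (t p)) ` half_ball (t p)" for p
      using ball_subset_cball by (intro image_mono) blast
    show "topspace X \<subseteq> (\<Union>t\<in>t ` P. chart_inv (fst t) ` half_ball t)"
    proof
      fix p assume "p \<in> topspace X"
      then obtain q where "q \<in> P" "p \<in> ?U q" using \<F>(3) unfolding P(3) by blast
      then show "p \<in> (\<Union>t\<in>t ` P. chart_inv (fst t) ` half_ball t)" using sub[of q] by blast
    qed
  qed
qed

text \<open>Coordinates times a bump that is 1 up to radius \<open>3 / 2 * r\<close>. This exceeds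
  the radius \<open>r\<close> of the half-ball, so on the half-ball the derivatives, too, are those
  of the coordinates; the support lies within radius \<open>3 * r\<close>.\<close>

lemma chart_coordinate_functions:
  assumes t: "chart_ball_data t"
  obtains \<eta> :: "3 \<Rightarrow> 'a \<Rightarrow> real" where "\<And>k. smooth_function A (\<eta> k)"
    "\<And>k p. p \<in> fst (fst t) \<Longrightarrow> dist (snd (fst t) p) (fst (snd t)) < 3 / 2 * snd (snd t) \<Longrightarrow> \<eta> k p = snd (fst t) p $ k"
proof -
  obtain c x\<^sub>0 r where t_eq: "t = (c, x\<^sub>0, r)" by (cases t)
  have c: "c \<in> A" and r: "0 < r" "cball x\<^sub>0 (3 * r) \<inter> half_space \<subseteq> img c"
    using t by (auto simp: t_eq chart_ball_data_def)
  have r': "0 < 3 / 2 * r" using r(1) by simp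
  obtain \<beta> :: "real^3 \<Rightarrow> real" where \<beta>: "\<And>k. Ck_on k UNIV \<beta>" "\<And>x. 0 \<le> \<beta> x" "\<And>x. \<beta> x \<le> 1"
    "\<And>x. dist x x\<^sub>0 \<le> 3 / 2 * r \<Longrightarrow> \<beta> x = 1" "\<And>x. 2 * (3 / 2 * r) \<le> dist x x\<^sub>0 \<Longrightarrow> \<beta> x = 0"
    using smooth_bump[OF r'] by blast
  show thesis
  proof (rule that[of "\<lambda>k p. if p \<in> fst c then \<beta> (snd c p) * snd c p $ k else 0"])
    fix k
    show "smooth_function A (\<lambda>p. if p \<in> fst c then \<beta> (snd c p) * snd c p $ k else 0)"
    proof (rule smooth_function_extend[OF c, where h = "\<lambda>x. \<beta> x * x $ k"])
      show "compact (cball x\<^sub>0 (3 * r) \<inter> half_space)"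
        by (rule compact_Int_closed[OF compact_cball closed_half_space])
      show "smooth_on (img c) (\<lambda>x. \<beta> x * x $ k)"
        by (intro smooth_on_mult smooth_on_Ck_on[OF open_UNIV subset_UNIV \<beta>(1)]
            smooth_on_bounded_linear bounded_linear_vec_nth)
      show "\<beta> x * x $ k = 0" if "x \<in> img c" "x \<notin> cball x\<^sub>0 (3 * r) \<inter> half_space" for x
        using that img_half_space[OF c] \<beta>(5)[of x] by (auto simp: dist_commute)
    qed (rule r(2))
  qed (simp add: t_eq \<beta>(4))
qed

text \<open>Induction on the set of balls. Near the new ball a linear function with coefficients
  \<open>a\<close> is subtracted: this subtracts \<open>a\<close> from the gradient and leaves the
  Hessian alone, so the result is Morse there as soon as \<open>a\<close> is not a value of the old
  gradient at a point with singular Hessian. By Sard almost every \<open>a\<close> will do, and a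
  small one preserves what was achieved on the other balls.\<close>

lemma morse_on_chart_balls:
  assumes "finite D" "\<And>t. t \<in> D \<Longrightarrow> chart_ball_data t"
  shows "\<exists>f. smooth_function A f \<and> (\<forall>t\<in>D. \<forall>x\<in>half_ball t. morse_at (f \<circ> chart_inv (fst t)) x)"
  using assms
proof (induction D rule: finite_induct)
  case empty
  show ?case using smooth_function_const by blast
next
  case (insert t D)
  then obtain f where f: "smooth_function A f"
    "\<And>s x. s \<in> D \<Longrightarrow> x \<in> half_ball s \<Longrightarrow> morse_at (f \<circ> chart_inv (fst s)) x" by blast
  have t: "chart_ball_data t" using insert.prems by simp
  have cA: "fst s \<in> A" if "chart_ball_data s" for s using that by (auto simp: chart_ball_data_def)
  obtain \<eta> where \<eta>: "\<And>k. smooth_function A (\<eta> k)"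
    "\<And>k p. p \<in> fst (fst t) \<Longrightarrow> dist (snd (fst t) p) (fst (snd t)) < 3 / 2 * snd (snd t) \<Longrightarrow> \<eta> k p = snd (fst t) p $ k"
    using chart_coordinate_functions[OF t] by blast
  define F where "F a p = f p - (\<Sum>k\<in>UNIV. a $ k * \<eta> k p)" for a p
  have F_chart: "F a \<circ> chart_inv c = (\<lambda>y. (f \<circ> chart_inv c) y - (\<Sum>k\<in>UNIV. a $ k * (\<eta> k \<circ> chart_inv c) y))" for a c
    by (simp add: F_def fun_eq_iff)
  have F_smooth: "smooth_function A (F a)" for a
    unfolding smooth_function_def
  proof
    fix c assume c: "c \<in> A"
    have "smooth_on (img c) (\<lambda>y. (f \<circ> chart_inv c) y + (\<Sum>k\<in>UNIV. (- a $ k) * (\<eta> k \<circ> chart_inv c) y))"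
      by (rule smooth_on_add[OF smooth_functionD[OF f(1) c] smooth_on_sum[OF smooth_on_mult[OF smooth_on_const
              smooth_functionD[OF \<eta>(1) c]]]])
    then show "smooth_on (img c) (F a \<circ> chart_inv c)"
      by (simp add: F_chart sum_negf)
  qed
  have "\<exists>\<delta>>0. \<forall>a x. norm a < \<delta> \<longrightarrow> x \<in> half_ball s \<longrightarrow> morse_at (F a \<circ> chart_inv (fst s)) x" if s: "s \<in> D" for s
  proof -
    have sd: "chart_ball_data s" using s insert.prems by simp
    note c = cA[OF sd]
    obtain \<delta> where "0 < \<delta>" "\<forall>a x. norm (a :: real^3) < \<delta> \<longrightarrow> x \<in> half_ball s \<longrightarrow>
        morse_at (\<lambda>y. (f \<circ> chart_inv (fst s)) y - (\<Sum>k\<in>UNIV. a $ k * (\<eta> k \<circ> chart_inv (fst s)) y)) x"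
      by (rule morse_stable[OF open_img[OF c] smooth_functionD[OF f(1) c] smooth_functionD[OF \<eta>(1) c]
          half_ball[OF sd] f(2)[OF s]])
    then show ?thesis unfolding F_chart by (intro exI[of _ \<delta>] conjI)
  qed
  then have "\<forall>s\<in>D. \<exists>\<delta>>0. \<forall>a x. norm a < \<delta> \<longrightarrow> x \<in> half_ball s \<longrightarrow> morse_at (F a \<circ> chart_inv (fst s)) x"
    by (rule ballI)
  from bchoice[OF this] obtain \<delta> where \<delta>: "\<forall>s\<in>D. 0 < \<delta> s \<and>
    (\<forall>a x. norm a < \<delta> s \<longrightarrow> x \<in> half_ball s \<longrightarrow> morse_at (F a \<circ> chart_inv (fst s)) x)" ..
  \<comment> \<open>The extra 1 keeps the minimum meaningful when \<open>D\<close> is empty.\<close>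
  define d where "d = Min (insert 1 (\<delta> ` D))"
  have d: "0 < d" "\<And>s. s \<in> D \<Longrightarrow> d \<le> \<delta> s"
    using insert.hyps(1) \<delta> by (simp_all add: d_def)
  let ?c = "fst t"
  let ?h = "f \<circ> chart_inv ?c"
  note c = cA[OF t]
  let ?B = "gradient ?h ` {x \<in> img ?c. det (hessian ?h x) = 0}"
  have neg: "negligible ?B"
    by (rule negligible_degenerate_values[OF open_img[OF c] smooth_functionD[OF f(1) c]])
  \<comment> \<open>A nonempty open ball is not negligible, so it contains a parameter outside the
    bad set.\<close>
  have "\<not> ball 0 d \<subseteq> ?B"
    using open_not_negligible[of "ball (0 :: real^3) d"] d(1) negligible_subset[OF neg, of "ball 0 d"] by auto
  then obtain a where "a \<in> ball 0 d" "a \<notin> ?B" by blast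
  then have a: "norm a < d" "a \<notin> ?B" by simp_all
  have "morse_at (F a \<circ> chart_inv ?c) x" if x: "x \<in> half_ball t" for x
  proof -
    obtain x\<^sub>0 r where xr: "snd t = (x\<^sub>0, r)" by (cases "snd t")
    have r: "0 < r" using t by (cases t) (use xr in \<open>auto simp: chart_ball_data_def\<close>)
    \<comment> \<open>On this relatively open set around the half-ball the cut-off coordinates are
      the true ones, so first and second derivatives can be compared.\<close>
    let ?T = "img ?c \<inter> ball x\<^sub>0 (3 / 2 * r)"
    have T: "openin (top_of_set half_space) ?T" by (rule openin_Int_open[OF open_img[OF c] open_ball])
    have xI: "x \<in> img ?c" using half_ball(2)[OF t] x by blast
    have xT: "x \<in> ?T" using xI x r by (simp add: xr)
    have h: "smooth_on ?T ?h" by (rule smooth_on_subset[OF smooth_functionD[OF f(1) c]]) blast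
    have eq: "?h y - (\<Sum>k\<in>UNIV. a $ k * y $ k) = (F a \<circ> chart_inv ?c) y" if y: "y \<in> ?T" for y
    proof -
      have "\<eta> k (chart_inv ?c y) = y $ k" for k
        using \<eta>(2)[of "chart_inv ?c y" k] y chart_inv_in[of y ?c] chart_inv_right[of y ?c]
        by (simp add: xr dist_commute)
      then show ?thesis by (simp add: F_def)
    qed
    have coord: "((\<lambda>y::real^3. y $ k) has_derivative (\<lambda>v. v $ k)) (at y within half_space)" for k y
      by (rule bounded_linear_imp_has_derivative[OF bounded_linear_vec_nth])
    have D1: "Dh (F a \<circ> chart_inv ?c) y v = Dh ?h y v - (\<Sum>k\<in>UNIV. a $ k * v $ k)" if y: "y \<in> ?T" for y v
    proof -
      have "((\<lambda>y. ?h y - (\<Sum>k\<in>UNIV. a $ k * y $ k)) has_derivative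
          (\<lambda>v. Dh ?h y v - (\<Sum>k\<in>UNIV. a $ k * v $ k))) (at y within half_space)"
        by (intro has_derivative_diff has_derivative_sum has_derivative_mult_right
            smooth_on_has_Dh(1)[OF T y h] coord)
      then have "Dh (F a \<circ> chart_inv ?c) y = (\<lambda>v. Dh ?h y v - (\<Sum>k\<in>UNIV. a $ k * v $ k))"
        by (rule has_Dh_eqI(2)[OF T y _ eq])
      then show ?thesis by (simp only:)
    qed
    have D2: "Dh (\<lambda>y. Dh (F a \<circ> chart_inv ?c) y w) x v = Dh (\<lambda>y. Dh ?h y w) x v" for v w
    proof -
      have "((\<lambda>y. Dh ?h y w - (\<Sum>k\<in>UNIV. a $ k * w $ k)) has_derivative
          (\<lambda>v. Dh (\<lambda>y. Dh ?h y w) x v - 0)) (at x within half_space)"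
        by (intro has_derivative_diff has_derivative_const
            smooth_on_has_Dh(1)[OF T xT smooth_on_Dh[OF T h]])
      then have "Dh (\<lambda>y. Dh (F a \<circ> chart_inv ?c) y w) x = (\<lambda>v. Dh (\<lambda>y. Dh ?h y w) x v - 0)"
        by (rule has_Dh_eqI(2)[OF T xT _ D1[symmetric]])
      then show ?thesis by (simp only: diff_zero)
    qed
    have "(\<Sum>k\<in>UNIV. a $ k * axis i 1 $ k) = a $ i" for i
      by (simp add: axis_def if_distrib[of "\<lambda>z. _ * z"] sum.delta cong: if_cong)
    then have G: "gradient (F a \<circ> chart_inv ?c) x = gradient ?h x - a"
      by (simp add: gradient_def D1[OF xT] vec_eq_iff)
    have H: "hessian (F a \<circ> chart_inv ?c) x = hessian ?h x"
      by (simp only: hessian_def D2)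
    show ?thesis
      unfolding morse_at_def G H using a(2) xI by auto
  qed
  moreover have "morse_at (F a \<circ> chart_inv (fst s)) x" if "s \<in> D" "x \<in> half_ball s" for s x
  proof -
    have "norm a < \<delta> s" using a(1) d(2)[OF that(1)] by simp
    then show ?thesis using bspec[OF \<delta> that(1)] that(2) by simp
  qed
  ultimately show ?case using F_smooth[of a] by (intro exI[of _ "F a"]) blast
qed

theorem finite_critical_points:
  assumes "compact_space X"
  shows "\<exists>f. smooth_function A f \<and> finite {p \<in> topspace X. critical f p}"
proof -
  obtain D where D: "finite D" "\<And>t. t \<in> D \<Longrightarrow> chart_ball_data t"
    "topspace X \<subseteq> (\<Union>t\<in>D. chart_inv (fst t) ` half_ball t)"
    using finite_chart_ball_cover[OF assms] by blast
  obtain f where f: "smooth_function A f"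
    "\<And>t x. t \<in> D \<Longrightarrow> x \<in> half_ball t \<Longrightarrow> morse_at (f \<circ> chart_inv (fst t)) x"
    using morse_on_chart_balls[OF D(1,2)] by blast
  let ?Z = "\<lambda>t. {x \<in> half_ball t. gradient (f \<circ> chart_inv (fst t)) x = 0}"
  have cA: "fst t \<in> A" if "t \<in> D" for t using D(2)[OF that] by (auto simp: chart_ball_data_def)
  have fin: "finite (?Z t)" if t: "t \<in> D" for t
    by (rule finite_gradient_zeros[OF open_img[OF cA[OF t]] smooth_functionD[OF f(1) cA[OF t]]
          half_ball[OF D(2)[OF t]] f(2)[OF t]])
  have "{p \<in> topspace X. critical f p} \<subseteq> (\<Union>t\<in>D. chart_inv (fst t) ` ?Z t)"
  proof
    fix p assume p: "p \<in> {p \<in> topspace X. critical f p}"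
    then obtain t x where tx: "t \<in> D" "x \<in> half_ball t" "p = chart_inv (fst t) x" using D(3) by blast
    have x: "x \<in> img (fst t)" using half_ball(2)[OF D(2)[OF tx(1)]] tx(2) by blast
    have "\<forall>v. Dh (f \<circ> chart_inv (fst t)) x v = 0"
      using p critical_iff[OF f(1) cA[OF tx(1)] chart_inv_in[OF x]] chart_inv_right[OF x] tx(3) by simp
    then have "gradient (f \<circ> chart_inv (fst t)) x = 0"
      using gradient_eq_0_iff[OF open_img[OF cA[OF tx(1)]] x smooth_functionD[OF f(1) cA[OF tx(1)]]] by blast
    then have "x \<in> ?Z t" using tx(2) by blast
    then show "p \<in> (\<Union>t\<in>D. chart_inv (fst t) ` ?Z t)" using tx(1,3) by blast
  qed
  moreover have "finite (\<Union>t\<in>D. chart_inv (fst t) ` ?Z t)"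
    using D(1) fin by (intro finite_UN_I finite_imageI)
  ultimately show ?thesis using f(1) finite_subset by blast
qed

end

section \<open>Riemannian metrics on the manifold\<close>

context manifold3
begin

lemma tvec_of:
  assumes "c \<in> A" "p \<in> fst c"
  shows "tvec_of A c p a \<in> tangent_space A p" "tvec_of A c p a c = a"
  using theI'[OF tangent_space_coordinates[OF manifold assms, of a]] by (simp_all add: tvec_of_def)

lemma tvec_of_eqI:
  assumes "c \<in> A" "p \<in> fst c" "v \<in> tangent_space A p" "v c = a"
  shows "tvec_of A c p a = v"
  unfolding tvec_of_def
  by (rule the1_equality[OF tangent_space_coordinates[OF manifold assms(1,2)]]) (use assms in simp)

lemma tangent_vector_eqI:
  assumes "c \<in> A" "p \<in> fst c" "v \<in> tangent_space A p" "w \<in> tangent_space A p" "v c = w c"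
  shows "v = w"
  using tvec_of_eqI[OF assms(1-3) assms(5)] tvec_of_eqI[OF assms(1,2,4) refl] by simp

lemma transition_linear:
  "c \<in> A \<Longrightarrow> c' \<in> A \<Longrightarrow> p \<in> fst c \<Longrightarrow> p \<in> fst c' \<Longrightarrow> linear (Dh (transition c c') (snd c p))"
  by (rule has_derivative_linear[OF transition_derivative[OF manifold]])

lemma zero_tangent_space: "(\<lambda>_. 0) \<in> tangent_space A p"
  using linear_0[OF transition_linear] by (auto simp: tangent_space_def)

lemma lincomb_tangent_space:
  assumes v: "v \<in> tangent_space A p" and w: "w \<in> tangent_space A p"
  shows "lincomb r v s w \<in> tangent_space A p"
  unfolding tangent_space_def
proof (intro CollectI conjI allI ballI impI)
  fix c assume "\<not> (c \<in> A \<and> p \<in> fst c)"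
  then have "v c = 0" "w c = 0" using v w unfolding tangent_space_def by blast+
  then show "lincomb r v s w c = 0" by (simp add: lincomb_def)
next
  fix c c' assume c: "c \<in> A" "c' \<in> A" "p \<in> fst c \<inter> fst c'"
  then have "v c' = Dh (transition c c') (snd c p) (v c)" "w c' = Dh (transition c c') (snd c p) (w c)"
    using v w unfolding tangent_space_def by blast+
  then show "lincomb r v s w c' = Dh (transition c c') (snd c p) (lincomb r v s w c)"
    using linear_add[OF transition_linear] linear_cmul[OF transition_linear] c by (simp add: lincomb_def)
qed

lemma tvec_of_lincomb:
  assumes c: "c \<in> A" "p \<in> fst c"
  shows "tvec_of A c p (r *\<^sub>R a + s *\<^sub>R b) = lincomb r (tvec_of A c p a) s (tvec_of A c p b)"
  by (rule tvec_of_eqI[OF c lincomb_tangent_space[OF tvec_of(1)[OF c] tvec_of(1)[OF c]]])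
     (simp add: lincomb_def tvec_of(2)[OF c])

lemma tvec_of_chart_change:
  assumes c: "c \<in> A" "c' \<in> A" "p \<in> fst c" "p \<in> fst c'"
  shows "tvec_of A c' p (Dh (transition c c') (snd c p) a) = tvec_of A c p a"
proof (rule tvec_of_eqI[OF c(2,4) tvec_of(1)[OF c(1,3)]])
  have "tvec_of A c p a c' = Dh (transition c c') (snd c p) (tvec_of A c p a c)"
    using tvec_of(1)[OF c(1,3), of a] c unfolding tangent_space_def by blast
  then show "tvec_of A c p a c' = Dh (transition c c') (snd c p) a"
    by (simp add: tvec_of(2)[OF c(1,3)])
qed

lemma metric_in_chart_at:
  "c \<in> A \<Longrightarrow> p \<in> fst c \<Longrightarrow> metric_in_chart A g c (snd c p) a b = g p (tvec_of A c p a) (tvec_of A c p b)"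
  by (simp add: metric_in_chart_def inv_chart)

lemma chart_metric_riemannian:
  assumes g: "riemannian_metric X A g" and c: "c \<in> A"
  shows "chart_metric (img c) (metric_in_chart A g c)"
proof
  show "openin (top_of_set half_space) (img c)" by (rule open_img[OF c])
  show "smooth_on (img c) (\<lambda>y. metric_in_chart A g c y a b)" for a b
    using g c by (simp add: riemannian_metric_def)
  fix x assume "x \<in> img c"
  then obtain p where p: "p \<in> fst c" "x = snd c p" by blast
  have "p \<in> topspace X" using chart_subset[OF c] p(1) by blast
  then have ip: "inner_product_on_tangent_space A p (g p)" using g by (simp add: riemannian_metric_def)
  note G = metric_in_chart_at[OF c p(1), of g, folded p(2)]
  note T = tvec_of[OF c p(1)]
  show sym: "metric_in_chart A g c x a b = metric_in_chart A g c x b a" for a b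
    using ip T(1) by (simp add: G inner_product_on_tangent_space_def)
  have comb: "metric_in_chart A g c x (r *\<^sub>R a + s *\<^sub>R a') b =
      r * metric_in_chart A g c x a b + s * metric_in_chart A g c x a' b" for r s a a' b
    using ip T(1) by (simp add: G tvec_of_lincomb[OF c p(1)] inner_product_on_tangent_space_def)
  have lin: "linear (\<lambda>a. metric_in_chart A g c x a b)" for b
    by (rule linearI) (use comb[of 1 _ 1 _ b] comb[of _ _ 0 0 b] in simp_all)
  then show "bilinear (metric_in_chart A g c x)"
    unfolding bilinear_def using sym by simp
  show "0 < metric_in_chart A g c x v v" if "v \<noteq> 0" for v
  proof -
    have "tvec_of A c p v \<noteq> (\<lambda>_. 0)" using T(2)[of v] that by auto
    then show ?thesis using ip T(1) by (simp add: G inner_product_on_tangent_space_def)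
  qed
qed

lemma conformal_metric_in_chart:
  "metric_in_chart A (conformal_metric u g) c =
    (\<lambda>x a b. exp (2 * (u \<circ> chart_inv c) x) * metric_in_chart A g c x a b)"
  by (intro ext) (simp add: metric_in_chart_def conformal_metric_def Let_def)

lemma riemannian_conformal_metric:
  assumes g: "riemannian_metric X A g" and u: "smooth_function A u"
  shows "riemannian_metric X A (conformal_metric u g)"
  unfolding riemannian_metric_def
proof (intro conjI ballI allI)
  fix p assume "p \<in> topspace X"
  then have "inner_product_on_tangent_space A p (g p)" using g by (simp add: riemannian_metric_def)
  then show "inner_product_on_tangent_space A p (conformal_metric u g p)"
    by (simp add: inner_product_on_tangent_space_def conformal_metric_def distrib_left mult.left_commute)
next
  fix c a b assume c: "c \<in> A"
  have "smooth_on (img c) (\<lambda>x. metric_in_chart A g c x a b)" using g c by (simp add: riemannian_metric_def)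
  then show "smooth_on (img c) (\<lambda>x. metric_in_chart A (conformal_metric u g) c x a b)"
    unfolding conformal_metric_in_chart
    by (intro smooth_on_mult smooth_on_exp smooth_on_const smooth_functionD[OF u c])
qed

text \<open>Tangent vectors are compatible families of components, so the transition between two
  charts is an isometry of the coordinate metrics. Since \<open>sectional_curvature\<close> picks
  its chart arbitrarily, this is what allows it to be computed in a chart of the cover.\<close>

lemma sectional_in_chart_independent:
  assumes g: "riemannian_metric X A g" and c: "c \<in> A" "c' \<in> A" "p \<in> fst c" "p \<in> fst c'"
    and v: "v \<in> tangent_space A p" "w \<in> tangent_space A p"
  shows "sectional_in_chart (metric_in_chart A g c) (snd c p) (v c) (w c) =
    sectional_in_chart (metric_in_chart A g c') (snd c' p) (v c') (w c')"
proof -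
  let ?S = "snd c ` (fst c \<inter> fst c')"
  have S: "openin (top_of_set half_space) ?S" by (rule open_image[OF c(1) open_chart[OF c(2)]])
  have "chart_metric ?S (metric_in_chart A g c)"
    by (rule chart_metric.chart_metric_subset[OF chart_metric_riemannian[OF g c(1)] S]) blast
  moreover have "chart_metric (img c') (metric_in_chart A g c')" by (rule chart_metric_riemannian[OF g c(2)])
  moreover have "isometric_charts_axioms ?S (metric_in_chart A g c) (img c') (metric_in_chart A g c') (transition c c')"
  proof
    show "smooth_on ?S (transition c c')" by (rule smooth_transition[OF c(1,2)])
    show "transition c c' ` ?S \<subseteq> img c'" by (auto simp: transition_eq[OF c(1)])
    fix y a b assume "y \<in> ?S"
    then obtain q where q: "q \<in> fst c" "q \<in> fst c'" "y = snd c q" by blast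
    show "metric_in_chart A g c y a b =
        metric_in_chart A g c' (transition c c' y) (Dh (transition c c') y a) (Dh (transition c c') y b)"
      unfolding q(3) transition_eq[OF c(1) q(1)] metric_in_chart_at[OF c(1) q(1)] metric_in_chart_at[OF c(2) q(2)]
        tvec_of_chart_change[OF c(1,2) q(1,2)] ..
  qed
  ultimately interpret isometric_charts ?S "metric_in_chart A g c" "img c'" "metric_in_chart A g c'" "transition c c'"
    by (intro isometric_charts.intro)
  have "v c' = Dh (transition c c') (snd c p) (v c)" "w c' = Dh (transition c c') (snd c p) (w c)"
    using v c unfolding tangent_space_def by blast+
  then show ?thesis
    using sectional_in_chart_transform[of "snd c p" "v c" "w c"] c(3,4) by (simp add: transition_eq[OF c(1,3)])
qed

text \<open>Passing to the exponential of a function without critical points makes it positive, and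
  the positive factor in the differential creates no critical points.\<close>

lemma regular_function:
  assumes "compact_space X" "connected_space X" "manifold_boundary A \<noteq> {}"
  obtains f where "smooth_function A f" "\<forall>p\<in>topspace X. 0 \<le> f p"
    "\<forall>c\<in>A. \<forall>x\<in>img c. \<exists>v. Dh (f \<circ> chart_inv c) x v \<noteq> 0"
proof -
  obtain f0 where "smooth_function A f0" "finite {p \<in> topspace X. critical f0 p}"
    using finite_critical_points[OF assms(1)] by blast
  then obtain f where f: "smooth_function A f" "\<forall>p\<in>topspace X. \<not> critical f p"
    using remove_critical_points[OF assms(2,3)] by blast
  have "\<exists>v. Dh ((\<lambda>p. exp (f p)) \<circ> chart_inv c) x v \<noteq> 0" if c: "c \<in> A" and "x \<in> img c" for c x
  proof -
    obtain p where p: "p \<in> fst c" "x = snd c p" using \<open>x \<in> img c\<close> by blast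
    have "\<not> critical f p" using f(2) p(1) chart_subset[OF c] by blast
    then obtain v where v: "Dh (f \<circ> chart_inv c) x v \<noteq> 0"
      using critical_iff[OF f(1) c p(1)] p(2) by blast
    have "((f \<circ> chart_inv c) has_derivative Dh (f \<circ> chart_inv c) x) (at x within half_space)"
      by (rule smooth_on_has_Dh(1)[OF open_img[OF c] \<open>x \<in> img c\<close> smooth_functionD[OF f(1) c]])
    from DERIV_compose_FDERIV[OF DERIV_exp this]
    have "((\<lambda>p. exp (f p)) \<circ> chart_inv c has_derivative
        (\<lambda>v. Dh (f \<circ> chart_inv c) x v * exp (f (chart_inv c x)))) (at x within half_space)"
      by (simp add: o_def)
    from half_space_derivative_unique[OF _ this]
    have "Dh ((\<lambda>p. exp (f p)) \<circ> chart_inv c) x = (\<lambda>v. Dh (f \<circ> chart_inv c) x v * exp (f (chart_inv c x)))"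
      using img_half_space[OF c] \<open>x \<in> img c\<close> by blast
    then show ?thesis using v by (intro exI[of _ v]) (simp only:, simp)
  qed
  then show thesis
    by (intro that[OF smooth_function_exp[OF f(1)]]) auto
qed

text \<open>The estimate holds on each half-ball of a finite cover for all large \<open>l\<close>,
  so the maximum of the thresholds serves for all of them at once. The function \<open>f\<close> is
  global, hence so is the resulting \<open>u\<close>.\<close>

theorem conformal_to_negative_curvature:
  assumes X: "compact_space X" "connected_space X" "manifold_boundary A \<noteq> {}"
    and g: "riemannian_metric X A g"
  shows "\<exists>u. smooth_function A u \<and> riemannian_metric X A (conformal_metric u g) \<and>
    (\<forall>p\<in>topspace X. \<forall>\<Sigma>. tangent_plane A p \<Sigma> \<longrightarrow> sectional_curvature A (conformal_metric u g) p \<Sigma> < 0)"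
proof -
  obtain f where f: "smooth_function A f" "\<forall>p\<in>topspace X. 0 \<le> f p"
    "\<forall>c\<in>A. \<forall>x\<in>img c. \<exists>v. Dh (f \<circ> chart_inv c) x v \<noteq> 0"
    by (rule regular_function[OF X])
  obtain D where D: "finite D" "\<And>t. t \<in> D \<Longrightarrow> chart_ball_data t"
    "topspace X \<subseteq> (\<Union>t\<in>D. chart_inv (fst t) ` half_ball t)"
    using finite_chart_ball_cover[OF X(1)] by blast
  have cA: "fst t \<in> A" if "t \<in> D" for t using D(2)[OF that] by (auto simp: chart_ball_data_def)
  have "\<forall>t\<in>D. \<exists>l\<^sub>0. \<forall>l x v w. l\<^sub>0 \<le> l \<longrightarrow> x \<in> half_ball t \<longrightarrow>
      (\<forall>r s. r *\<^sub>R v + s *\<^sub>R w = 0 \<longrightarrow> r = 0 \<and> s = 0) \<longrightarrow>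
      sectional_in_chart (\<lambda>y a b. exp (2 * exp (l * (f \<circ> chart_inv (fst t)) y)) *
        metric_in_chart A g (fst t) y a b) x v w < 0"
  proof
    fix t assume t: "t \<in> D"
    note K = half_ball[OF D(2)[OF t]]
    show "\<exists>l\<^sub>0. \<forall>l x v w. l\<^sub>0 \<le> l \<longrightarrow> x \<in> half_ball t \<longrightarrow>
      (\<forall>r s. r *\<^sub>R v + s *\<^sub>R w = 0 \<longrightarrow> r = 0 \<and> s = 0) \<longrightarrow>
      sectional_in_chart (\<lambda>y a b. exp (2 * exp (l * (f \<circ> chart_inv (fst t)) y)) *
        metric_in_chart A g (fst t) y a b) x v w < 0"
    proof (rule chart_metric.conformal_negative_curvature[OF chart_metric_riemannian[OF g cA[OF t]] K
          smooth_functionD[OF f(1) cA[OF t]]])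
      fix x assume "x \<in> half_ball t"
      then have x: "x \<in> img (fst t)" using K(2) by blast
      have "chart_inv (fst t) x \<in> topspace X" using chart_inv_in[OF x] chart_subset[OF cA[OF t]] by blast
      then show "0 \<le> (f \<circ> chart_inv (fst t)) x" using f(2) by simp
      show "\<exists>v. Dh (f \<circ> chart_inv (fst t)) x v \<noteq> 0" using f(3) cA[OF t] x by blast
    qed
  qed
  from bchoice[OF this] obtain l\<^sub>0 where l\<^sub>0: "\<forall>t\<in>D. \<forall>l x v w. l\<^sub>0 t \<le> l \<longrightarrow> x \<in> half_ball t \<longrightarrow>
      (\<forall>r s. r *\<^sub>R v + s *\<^sub>R w = 0 \<longrightarrow> r = 0 \<and> s = 0) \<longrightarrow>
      sectional_in_chart (\<lambda>y a b. exp (2 * exp (l * (f \<circ> chart_inv (fst t)) y)) *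
        metric_in_chart A g (fst t) y a b) x v w < 0" ..
  define l where "l = Max (insert 0 (l\<^sub>0 ` D))"
  have l: "l\<^sub>0 t \<le> l" if "t \<in> D" for t using D(1) that by (simp add: l_def)
  define u where "u p = exp (l * f p)" for p
  have u: "smooth_function A u"
    unfolding u_def
    by (intro smooth_function_exp smooth_function_binop[where F = "(*)"] smooth_function_const f(1) smooth_on_mult)
  let ?g = "conformal_metric u g"
  have gu: "riemannian_metric X A ?g" by (rule riemannian_conformal_metric[OF g u])
  have "sectional_curvature A ?g p \<Sigma> < 0" if p: "p \<in> topspace X" and \<Sigma>: "tangent_plane A p \<Sigma>" for p \<Sigma>
  proof -
    \<comment> \<open>The chart and the basis behind \<open>sectional_curvature\<close> are
      arbitrary choices; the inequality is proved in the chart of a half-ball containing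
      \<open>p\<close> and then transferred.\<close>
    define c where "c = (SOME c. c \<in> A \<and> p \<in> fst c)"
    have c: "c \<in> A" "p \<in> fst c"
      using someI_ex[of "\<lambda>c. c \<in> A \<and> p \<in> fst c"] chart_at[OF p] unfolding c_def by blast+
    obtain v w where vw: "(SOME b. plane_basis A p \<Sigma> b) = (v, w)" by (cases "SOME b. plane_basis A p \<Sigma> b")
    have "plane_basis A p \<Sigma> (v, w)"
      using \<Sigma> someI_ex[of "plane_basis A p \<Sigma>"] unfolding tangent_plane_def vw by blast
    then have T: "v \<in> tangent_space A p" "w \<in> tangent_space A p"
      and indep: "\<And>r s. lincomb r v s w = (\<lambda>_. 0) \<Longrightarrow> r = 0 \<and> s = 0"
      by (auto simp: plane_basis_def)
    obtain t x where tx: "t \<in> D" "x \<in> half_ball t" "p = chart_inv (fst t) x" using D(3) p by blast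
    have x: "x \<in> img (fst t)" using half_ball(2)[OF D(2)[OF tx(1)]] tx(2) by blast
    have pt: "p \<in> fst (fst t)" "snd (fst t) p = x"
      using chart_inv_in[OF x] chart_inv_right[OF x] tx(3) by simp_all
    \<comment> \<open>A tangent vector is determined by its component in one chart, so the
      independence of \<open>v\<close> and \<open>w\<close> passes to their components.\<close>
    have "r = 0 \<and> s = 0" if "r *\<^sub>R v (fst t) + s *\<^sub>R w (fst t) = 0" for r s
    proof (rule indep, rule tangent_vector_eqI[OF cA[OF tx(1)] pt(1) lincomb_tangent_space[OF T] zero_tangent_space])
      show "lincomb r v s w (fst t) = 0" using that by (simp add: lincomb_def)
    qed
    then have "sectional_in_chart (\<lambda>y a b. exp (2 * exp (l * (f \<circ> chart_inv (fst t)) y)) *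
        metric_in_chart A g (fst t) y a b) x (v (fst t)) (w (fst t)) < 0"
      using bspec[OF l\<^sub>0 tx(1)] l[OF tx(1)] tx(2) by blast
    also have "(\<lambda>y a b. exp (2 * exp (l * (f \<circ> chart_inv (fst t)) y)) * metric_in_chart A g (fst t) y a b) =
        metric_in_chart A ?g (fst t)"
      unfolding conformal_metric_in_chart by (simp add: u_def)
    finally have "sectional_in_chart (metric_in_chart A ?g c) (snd c p) (v c) (w c) < 0"
      unfolding sectional_in_chart_independent[OF gu c(1) cA[OF tx(1)] c(2) pt(1) T] pt(2) .
    then show ?thesis
      unfolding sectional_curvature_def c_def[symmetric] vw Let_def by simp
  qed
  then show ?thesis using u gu by blast
qed

end

theorem theorem1p1:
  fixes X :: "'a topology" and A :: "'a chart set" and g :: "'a metric_field"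
  assumes "smooth_manifold_with_boundary X A"
    and "compact_space X"
    and "connected_space X"
    and "manifold_boundary A \<noteq> {}"
    and "riemannian_metric X A g"
  shows "\<exists>u. smooth_function A u \<and>
           riemannian_metric X A (conformal_metric u g) \<and>
           (\<forall>p\<in>topspace X. \<forall>\<Sigma>. tangent_plane A p \<Sigma> \<longrightarrow>
              sectional_curvature A (conformal_metric u g) p \<Sigma> < 0)"
proof -
  interpret manifold3 X A by (rule manifold3.intro[OF assms(1)])
  show ?thesis by (rule conformal_to_negative_curvature[OF assms(2-5)])
qed

end
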